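(* The exterior derivative on $\Omega^*(S\mathbb{O}^2)^{\overline{\mathrm{Spin}(9)}}\cong\left[\bigwedge(T_pS\mathbb{O}^2)^*\right]^{\mathrm{Spin}(7)}$ is completely determined by the following (formal) differentiation rules: $$\begin{aligned} d(\alpha+\theta_0)&=-\varphi_0\wedge(\alpha+\theta_0)-\theta_1\wedge\overline{\varphi_1},\\ d\theta_1&=(\alpha+\theta_0)\wedge\varphi_1-\varphi_0\wedge\theta_1+\theta_1\wedge\varphi_0,\\ d\varphi_0&=-\varphi_0\wedge\varphi_0-\varphi_1\wedge\overline{\varphi_1},\\ d\varphi_1&=\varphi_1\wedge\varphi_0.\end{aligned}$$
   Context: $\mathbb{O}$ denotes the octonions: $\mathbb{R}^8$ with standard orthonormal basis $e_0=1,e_1,\dots,e_7$ and the bilinear product with unit $e_0$, $e_i^2=-e_0$ and $e_ie_j=-e_je_i$ for distinct $i,j\in\{1,\dots,7\}$, and $e_ie_j=e_k,\ e_je_k=e_i,\ e_ke_i=e_j$ for $(i,j,k)\in\{(1,2,4),(2,3,5),(3,4,6),(4,5,7),(5,6,1),(6,7,2),(7,1,3)\}$. $\mathrm{Im}\,\mathbb{O}=\mathrm{span}(e_1,\dots,e_7)$, conjugation is $\overline{x}=\mathrm{Re}(x)-\mathrm{Im}(x)$, and $R_w(x)=xw$. $\mathrm{Spin}(9)\subset\mathrm{SO}(16)$ is the subgroup of $\mathrm{GL}(\mathbb{O}^2)$, $\mathbb{O}^2=\mathbb{R}^{16}$, generated by $\begin{pmatrix}r&R_x\\R_{\overline x}&-r\end{pmatrix}$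 with $r\in\mathbb{R}$, $x\in\mathbb{O}$, $r^2+|x|^2=1$. The group $G=\overline{\mathrm{Spin}(9)}=\mathrm{Spin}(9)\ltimes\mathbb{O}^2$ acts transitively on the sphere bundle $S\mathbb{O}^2=\mathbb{O}^2\times S^{15}$ by $(g,x)\cdot(y,v)=(gy+x,gv)$. Put $E_0=\begin{pmatrix}1\\0\end{pmatrix}$ and $p=(0,E_0)$; the stabilizer of $p$ is isomorphic to $\mathrm{Spin}(7)$, and the isomorphism in the claim is evaluation of an invariant form at $p$. Under the stabilizer, $T_pS\mathbb{O}^2\cong\mathbb{R}\oplus\mathrm{Im}\,\mathbb{O}\oplus\mathbb{O}\oplus\mathrm{Im}\,\mathbb{O}\oplus\mathbb{O}$, and $\alpha,\theta_0,\theta_1,\varphi_0,\varphi_1$ are the corresponding ($\mathbb{O}$-valued) coordinate $1$-forms. $\mathbb{O}$-valued forms are multiplied by $(u\otimes\phi)\wedge(v\otimes\psi)=uv\otimes\phi\wedge\psi$ and conjugated by $\overline{u\otimes\phi}=\overline u\otimes\phi$; linear operators on real forms act on them componentwise. The rules are formal, since the individual forms are not invariant; their rigorous meaning is the following. Let $\pi:G\to S\mathbb{O}^2$, $\pi(g,x)=(x,gE_0)$. A vector in $\mathbb{O}^2$ has components $x_k^a$ and an endomorphism of $\mathbb{O}^2$ has entries $A_{k,l}^{a,b}$ (row $(k,a)$, column $(l,b)$), where $k,l\in\{0,1\}$ label the two copies of $\mathbb{O}$ and $a,b\in\{0,\dots,7\}$ the coordinates with respect to $e_0,\dots,e_7$.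 The Maurer–Cartan form of $G$ is $(\varphi,\theta)=(g^{-1}dg,g^{-1}dx)$, with components $\varphi_{k,l}^{a,b}$ and $\theta_k^a$; put $\varphi_k^a=\varphi_{k,0}^{a,0}$ (so $\varphi_0^0=0$). On $G$ one sets $$\alpha=\theta_0^0,\quad\theta_0=\sum_{a=1}^7e_a\theta_0^a,\quad\theta_1=\sum_{a=0}^7e_a\theta_1^a,\quad\varphi_0=\sum_{a=1}^7e_a\varphi_0^a,\quad\varphi_1=\sum_{a=0}^7e_a\varphi_1^a.$$ The algebra $\Omega^*(G)^G$ of left-invariant forms is generated by the $52$ linearly independent $1$-forms $\theta_0^a$ ($0\le a\le7$), $\theta_1^a$ ($0\le a\le7$), $\varphi_0^a$ ($1\le a\le7$), $\varphi_1^a$ ($0\le a\le7$), $\varphi_{1,1}^{a,b}$ ($1\le b<a\le7$). Let $h$ be the unique endomorphism of this algebra fixing all $\theta_0^a,\theta_1^a,\varphi_0^a,\varphi_1^a$ and sending each $\varphi_{1,1}^{a,b}$, $1\le b<a\le7$, to $0$, and let $d_h=h\circ d$ on $\Omega^*(G)^G$. In rigorous form: the anti-derivation $d_h$ satisfies $d\circ\pi^*=d_h\circ\pi^*$ on $\Omega^*(S\mathbb{O}^2)^{\overline{\mathrm{Spin}(9)}}$ and is determined by the four displayed equations with $d$ replaced by $d_h$. *)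

theory Defs
  imports
    "HOL-Analysis.Analysis"
    "HOL-Algebra.Generated_Groups"
    "HOL-Library.Function_Algebras"
begin

section \<open>Differential forms on embedded submanifolds\<close>

text \<open>
  A submanifold is represented by its underlying subset \<open>M\<close> of a Euclidean space. The definitions
  of this section have their intended meaning only if \<open>M\<close> is an embedded submanifold.
\<close>

fun times_differentiable_on ::
  "'a::real_normed_vector set \<Rightarrow> ('a \<Rightarrow> 'b::real_normed_vector) \<Rightarrow> nat \<Rightarrow> bool" where
  "times_differentiable_on S f 0 \<longleftrightarrow> continuous_on S f"
| "times_differentiable_on S f (Suc n) \<longleftrightarrow>
     (\<forall>x\<in>S. f differentiable (at x)) \<and>
     (\<forall>v. times_differentiable_on S (\<lambda>x. frechet_derivative f (at x) v) n)"

text \<open>Only meant for open \<open>S\<close>.\<close>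

definition smooth_on :: "'a::real_normed_vector set \<Rightarrow> ('a \<Rightarrow> 'b::real_normed_vector) \<Rightarrow> bool" where
  "smooth_on S f \<longleftrightarrow> (\<forall>n. times_differentiable_on S f n)"

definition tangent_space :: "'a::euclidean_space set \<Rightarrow> 'a \<Rightarrow> 'a set" where
  "tangent_space M x =
     {v. \<exists>\<epsilon>>0. \<exists>\<gamma>::real \<Rightarrow> 'a. smooth_on {-\<epsilon><..<\<epsilon>} \<gamma> \<and> \<gamma> ` {-\<epsilon><..<\<epsilon>} \<subseteq> M \<and>
           \<gamma> 0 = x \<and> (\<gamma> has_vector_derivative v) (at 0)}"

text \<open>
  An element of the exterior algebra of the dual of a finite-dimensional vector space \<open>T\<close> is a
  function on lists of vectors: its restriction to lists of length \<open>k\<close> is the component of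
  degree \<open>k\<close>. It is normalised to be \<open>0\<close> on lists which are not contained in \<open>T\<close>.
\<close>

definition alt_forms :: "'a::real_vector set \<Rightarrow> ('a list \<Rightarrow> real) set" where
  "alt_forms T = {f.
     (\<forall>vs. \<not> set vs \<subseteq> T \<longrightarrow> f vs = 0) \<and>
     (\<forall>us ws. \<forall>v\<in>T. \<forall>w\<in>T. \<forall>a b. set us \<subseteq> T \<and> set ws \<subseteq> T \<longrightarrow>
        f (us @ (a *\<^sub>R v + b *\<^sub>R w) # ws) = a * f (us @ v # ws) + b * f (us @ w # ws)) \<and>
     (\<forall>vs. set vs \<subseteq> T \<and> \<not> distinct vs \<longrightarrow> f vs = 0)}"

text \<open>\<open>('a, 'b) form\<close>: (inhomogeneous) forms on a subset of \<open>'a\<close> with values in \<open>'b\<close>.\<close>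

type_synonym ('a, 'b) form = "'a \<Rightarrow> 'a list \<Rightarrow> 'b"

definition local_extension ::
  "'a::euclidean_space set \<Rightarrow> ('a, real) form \<Rightarrow> 'a \<Rightarrow> 'a set \<Rightarrow> ('a, real) form \<Rightarrow> bool" where
  "local_extension M \<omega> x U \<eta> \<longleftrightarrow>
     open U \<and> x \<in> U \<and> (\<forall>y\<in>U. \<eta> y \<in> alt_forms UNIV) \<and> (\<forall>vs. smooth_on U (\<lambda>y. \<eta> y vs)) \<and>
     (\<forall>y\<in>U \<inter> M. \<forall>vs. set vs \<subseteq> tangent_space M y \<longrightarrow> \<eta> y vs = \<omega> y vs)"

definition forms :: "'a::euclidean_space set \<Rightarrow> ('a, real) form set" where
  "forms M = {\<omega>.
     (\<forall>x. x \<notin> M \<longrightarrow> \<omega> x = 0) \<and>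
     (\<forall>x\<in>M. \<omega> x \<in> alt_forms (tangent_space M x)) \<and>
     (\<forall>x\<in>M. \<exists>U \<eta>. local_extension M \<omega> x U \<eta>)}"

definition flat_ext_deriv :: "('a::euclidean_space, real) form \<Rightarrow> ('a, real) form" where
  "flat_ext_deriv \<eta> x vs =
     (\<Sum>i<length vs. (-1) ^ i *
        frechet_derivative (\<lambda>y. \<eta> y (take i vs @ drop (Suc i) vs)) (at x) (vs ! i))"

text \<open>
  The exterior derivative of a form on \<open>M\<close> is the restriction of the exterior derivative of an
  arbitrary local extension; on tangent vectors of \<open>M\<close> the value is independent of that choice.
\<close>

definition ext_deriv :: "'a::euclidean_space set \<Rightarrow> ('a, real) form \<Rightarrow> ('a, real) form" where
  "ext_deriv M \<omega> x vs =
     (if x \<in> M \<and> set vs \<subseteq> tangent_space M x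
      then flat_ext_deriv (SOME \<eta>. \<exists>U. local_extension M \<omega> x U \<eta>) x vs else 0)"

text \<open>The map \<open>f\<close> has to be differentiable on a neighbourhood of \<open>N\<close> in the ambient space.\<close>

definition pullback ::
  "'a::euclidean_space set \<Rightarrow> ('a \<Rightarrow> 'b::euclidean_space) \<Rightarrow> ('b, real) form \<Rightarrow> ('a, real) form" where
  "pullback N f \<omega> x vs =
     (if x \<in> N \<and> set vs \<subseteq> tangent_space N x
      then \<omega> (f x) (map (frechet_derivative f (at x)) vs) else 0)"

text \<open>
  The wedge product as a sum over shuffles, without factorials, where the values are multiplied
  by \<open>m\<close>: a subset \<open>I\<close> of the positions selects the arguments of the first factor.
\<close>

definition shuffle_sign :: "nat \<Rightarrow> nat set \<Rightarrow> real" where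
  "shuffle_sign n I = (-1) ^ card {(i, j). i \<in> I \<and> j \<in> {..<n} - I \<and> j < i}"

definition wedge_by ::
  "('b::real_vector \<Rightarrow> 'b \<Rightarrow> 'b) \<Rightarrow> ('a, 'b) form \<Rightarrow> ('a, 'b) form \<Rightarrow> ('a, 'b) form" where
  "wedge_by m \<omega> \<eta> x vs =
     (\<Sum>I\<in>Pow {..<length vs}.
        shuffle_sign (length vs) I *\<^sub>R m (\<omega> x (nths vs I)) (\<eta> x (nths vs (- I))))"

abbreviation wedge :: "('a, real) form \<Rightarrow> ('a, real) form \<Rightarrow> ('a, real) form"
    (infixl "\<and>\<^sub>\<real>" 70) where
  "\<omega> \<and>\<^sub>\<real> \<eta> \<equiv> wedge_by (*) \<omega> \<eta>"

definition form_scale :: "real \<Rightarrow> ('a, real) form \<Rightarrow> ('a, real) form" where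
  "form_scale c \<omega> = (\<lambda>x vs. c * \<omega> x vs)"

definition unit_form :: "'a set \<Rightarrow> ('a, real) form" where
  "unit_form M = (\<lambda>x vs. if x \<in> M \<and> vs = [] then 1 else 0)"

definition has_degree :: "nat \<Rightarrow> ('a, real) form \<Rightarrow> bool" where
  "has_degree k \<omega> \<longleftrightarrow> (\<forall>x vs. \<omega> x vs \<noteq> 0 \<longrightarrow> length vs = k)"

definition one_form ::
  "'a::euclidean_space set \<Rightarrow> ('a \<Rightarrow> 'a \<Rightarrow> real) \<Rightarrow> ('a, real) form" where
  "one_form M f x vs =
     (if x \<in> M \<and> length vs = 1 \<and> set vs \<subseteq> tangent_space M x then f x (hd vs) else 0)"

definition invariant_forms ::
  "'a::euclidean_space set \<Rightarrow> 'g set \<Rightarrow> ('g \<Rightarrow> 'a \<Rightarrow> 'a) \<Rightarrow> ('a, real) form set" where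
  "invariant_forms M H act = {\<omega> \<in> forms M. \<forall>a\<in>H. pullback M (act a) \<omega> = \<omega>}"

inductive_set generated_algebra :: "'a set \<Rightarrow> ('a, real) form set \<Rightarrow> ('a, real) form set"
  for M S where
  unit: "unit_form M \<in> generated_algebra M S"
| gen: "\<omega> \<in> S \<Longrightarrow> \<omega> \<in> generated_algebra M S"
| add: "\<omega> \<in> generated_algebra M S \<Longrightarrow> \<eta> \<in> generated_algebra M S \<Longrightarrow> \<omega> + \<eta> \<in> generated_algebra M S"
| scale: "\<omega> \<in> generated_algebra M S \<Longrightarrow> form_scale c \<omega> \<in> generated_algebra M S"
| wedge: "\<omega> \<in> generated_algebra M S \<Longrightarrow> \<eta> \<in> generated_algebra M S \<Longrightarrow> \<omega> \<and>\<^sub>\<real> \<eta> \<in> generated_algebra M S"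

definition linear_on_forms :: "('a, real) form set \<Rightarrow> (('a, real) form \<Rightarrow> ('a, real) form) \<Rightarrow> bool" where
  "linear_on_forms A D \<longleftrightarrow>
     (\<forall>\<omega>\<in>A. \<forall>\<eta>\<in>A. D (\<omega> + \<eta>) = D \<omega> + D \<eta>) \<and>
     (\<forall>c. \<forall>\<omega>\<in>A. D (form_scale c \<omega>) = form_scale c (D \<omega>))"

definition algebra_endo ::
  "'a set \<Rightarrow> ('a, real) form set \<Rightarrow> (('a, real) form \<Rightarrow> ('a, real) form) \<Rightarrow> bool" where
  "algebra_endo M A h \<longleftrightarrow>
     h \<in> A \<rightarrow> A \<and> linear_on_forms A h \<and> h (unit_form M) = unit_form M \<and>
     (\<forall>\<omega>\<in>A. \<forall>\<eta>\<in>A. h (\<omega> \<and>\<^sub>\<real> \<eta>) = h \<omega> \<and>\<^sub>\<real> h \<eta>)"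

definition antiderivation ::
  "('a, real) form set \<Rightarrow> (('a, real) form \<Rightarrow> ('a, real) form) \<Rightarrow> bool" where
  "antiderivation A D \<longleftrightarrow>
     D \<in> A \<rightarrow> A \<and> linear_on_forms A D \<and>
     (\<forall>k. \<forall>\<omega>\<in>A. \<forall>\<eta>\<in>A. has_degree k \<omega> \<longrightarrow>
        D (\<omega> \<and>\<^sub>\<real> \<eta>) = D \<omega> \<and>\<^sub>\<real> \<eta> + form_scale ((-1) ^ k) (\<omega> \<and>\<^sub>\<real> D \<eta>))"


section \<open>Octonions\<close>

text \<open>
  The coordinates of an octonion are indexed by the elements \<open>0, \<dots>, 7\<close> of the type \<open>8\<close>.
  The product of vectors which \<open>real ^ 8\<close> inherits from the library is the componentwise one
  and is not used.
\<close>

type_synonym octonion = "real ^ 8"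

abbreviation oct_basis :: "8 \<Rightarrow> octonion" where
  "oct_basis a \<equiv> axis a 1"

definition oct_triples :: "(8 \<times> 8 \<times> 8) set" where
  "oct_triples = {(1,2,4), (2,3,5), (3,4,6), (4,5,7), (5,6,1), (6,7,2), (7,1,3)}"

definition oct_cyclic :: "8 \<Rightarrow> 8 \<Rightarrow> 8 \<Rightarrow> bool" where
  "oct_cyclic i j k \<longleftrightarrow>
     (i, j, k) \<in> oct_triples \<or> (j, k, i) \<in> oct_triples \<or> (k, i, j) \<in> oct_triples"

text \<open>\<open>oct_coeff i j k\<close> is the coefficient of the \<open>k\<close>-th basis element in the product of the
  \<open>i\<close>-th and the \<open>j\<close>-th.\<close>

definition oct_coeff :: "8 \<Rightarrow> 8 \<Rightarrow> 8 \<Rightarrow> real" where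
  "oct_coeff i j k =
     (if i = 0 then (if k = j then 1 else 0)
      else if j = 0 then (if k = i then 1 else 0)
      else if i = j then (if k = 0 then -1 else 0)
      else if oct_cyclic i j k then 1
      else if oct_cyclic j i k then -1
      else 0)"

definition oct_mult :: "octonion \<Rightarrow> octonion \<Rightarrow> octonion" where
  "oct_mult x y = (\<chi> k. \<Sum>i\<in>UNIV. \<Sum>j\<in>UNIV. oct_coeff i j k * x $ i * y $ j)"

definition oct_cnj :: "octonion \<Rightarrow> octonion" where
  "oct_cnj x = (\<chi> a. if a = 0 then x $ 0 else - x $ a)"

abbreviation oct_wedge :: "('a, octonion) form \<Rightarrow> ('a, octonion) form \<Rightarrow> ('a, octonion) form"
    (infixl "\<and>\<^sub>O" 70) where
  "\<omega> \<and>\<^sub>O \<eta> \<equiv> wedge_by oct_mult \<omega> \<eta>"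

definition cnj_form :: "('a, octonion) form \<Rightarrow> ('a, octonion) form" where
  "cnj_form \<omega> = (\<lambda>x vs. oct_cnj (\<omega> x vs))"

definition oct_tensor :: "octonion \<Rightarrow> ('a, real) form \<Rightarrow> ('a, octonion) form" where
  "oct_tensor u \<omega> = (\<lambda>x vs. \<omega> x vs *\<^sub>R u)"

definition componentwise ::
  "(('a, real) form \<Rightarrow> ('a, real) form) \<Rightarrow> ('a, octonion) form \<Rightarrow> ('a, octonion) form" where
  "componentwise D \<omega> = (\<lambda>x vs. \<chi> a. D (\<lambda>y ws. \<omega> y ws $ a) x vs)"


section \<open>The group and the sphere bundle\<close>

text \<open>
  The octonionic plane is \<open>\<real>\<^sup>1\<^sup>6\<close> with coordinates indexed by pairs \<open>(k, a)\<close>, where \<open>k\<close> is the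
  copy of the octonions and \<open>a\<close> the octonionic coordinate. The entry of a matrix \<open>A\<close> in row
  \<open>(k, a)\<close> and column \<open>(l, b)\<close> is \<open>A $ (k, a) $ (l, b)\<close>.
\<close>

type_synonym oct_plane = "real ^ (2 \<times> 8)"
type_synonym oct_matrix = "real ^ (2 \<times> 8) ^ (2 \<times> 8)"

definition oct_comp :: "2 \<Rightarrow> oct_plane \<Rightarrow> octonion" where
  "oct_comp k x = (\<chi> a. x $ (k, a))"

definition oct_pair :: "octonion \<Rightarrow> octonion \<Rightarrow> oct_plane" where
  "oct_pair x y = (\<chi> i. if fst i = 0 then x $ snd i else y $ snd i)"

definition spin9_generator :: "real \<Rightarrow> octonion \<Rightarrow> oct_matrix" where
  "spin9_generator r x = matrix (\<lambda>y.
     oct_pair (r *\<^sub>R oct_comp 0 y + oct_mult (oct_comp 1 y) x)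
              (oct_mult (oct_comp 0 y) (oct_cnj x) - r *\<^sub>R oct_comp 1 y))"

definition GL16 :: "oct_matrix monoid" where
  "GL16 = \<lparr>carrier = {A. invertible A}, monoid.mult = (**), one = mat 1\<rparr>"

definition Spin9 :: "oct_matrix set" where
  "Spin9 = generate GL16 {spin9_generator r x | r x. r\<^sup>2 + (norm x)\<^sup>2 = 1}"

text \<open>The semidirect product of \<open>Spin9\<close> and the translations.\<close>

definition G :: "(oct_matrix \<times> oct_plane) set" where
  "G = Spin9 \<times> UNIV"

definition G_mult ::
  "oct_matrix \<times> oct_plane \<Rightarrow> oct_matrix \<times> oct_plane \<Rightarrow> oct_matrix \<times> oct_plane" where
  "G_mult = (\<lambda>(g, x) (h, y). (g ** h, g *v y + x))"

definition sphere_bundle :: "(oct_plane \<times> oct_plane) set" where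
  "sphere_bundle = UNIV \<times> sphere 0 1"

definition G_act ::
  "oct_matrix \<times> oct_plane \<Rightarrow> oct_plane \<times> oct_plane \<Rightarrow> oct_plane \<times> oct_plane" where
  "G_act = (\<lambda>(g, x) (y, v). (g *v y + x, g *v v))"

definition E0 :: oct_plane where
  "E0 = oct_pair (oct_basis 0) 0"

definition base_point :: "oct_plane \<times> oct_plane" where
  "base_point = (0, E0)"

definition G_proj :: "oct_matrix \<times> oct_plane \<Rightarrow> oct_plane \<times> oct_plane" where
  "G_proj = (\<lambda>(g, x). (x, g *v E0))"

definition stabilizer :: "(oct_matrix \<times> oct_plane) set" where
  "stabilizer = {s \<in> G. G_act s base_point = base_point}"

text \<open>The stabilizer (a copy of \<open>Spin(7)\<close>) acts on the tangent space at the base point by the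
  differentials of its elements.\<close>

definition stabilizer_invariants :: "((oct_plane \<times> oct_plane) list \<Rightarrow> real) set" where
  "stabilizer_invariants = {f \<in> alt_forms (tangent_space sphere_bundle base_point).
     \<forall>s\<in>stabilizer. \<forall>vs. set vs \<subseteq> tangent_space sphere_bundle base_point \<longrightarrow>
       f (map (frechet_derivative (G_act s) (at base_point)) vs) = f vs}"

abbreviation "bundle_invariant_forms \<equiv> invariant_forms sphere_bundle G G_act"
abbreviation "left_invariant_forms \<equiv> invariant_forms G G G_mult"


section \<open>Maurer-Cartan forms\<close>

type_synonym 'b G_form = "(oct_matrix \<times> oct_plane, 'b) form"

definition theta_entry :: "2 \<Rightarrow> 8 \<Rightarrow> real G_form" where
  "theta_entry k a = one_form G (\<lambda>(g, x) (A, u). (matrix_inv g *v u) $ (k, a))"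

definition phi_entry :: "2 \<times> 8 \<Rightarrow> 2 \<times> 8 \<Rightarrow> real G_form" where
  "phi_entry i j = one_form G (\<lambda>(g, x) (A, u). (matrix_inv g ** A) $ i $ j)"

definition phi_col :: "2 \<Rightarrow> 8 \<Rightarrow> real G_form" where
  "phi_col k a = phi_entry (k, a) (0, 0)"

text \<open>The real form \<open>\<alpha>\<close> is regarded as octonion-valued.\<close>

definition \<alpha> :: "octonion G_form" where
  "\<alpha> = oct_tensor (oct_basis 0) (theta_entry 0 0)"

definition \<theta>\<^sub>0 :: "octonion G_form" where
  "\<theta>\<^sub>0 = (\<Sum>a | a \<noteq> 0. oct_tensor (oct_basis a) (theta_entry 0 a))"

definition \<theta>\<^sub>1 :: "octonion G_form" where
  "\<theta>\<^sub>1 = (\<Sum>a\<in>UNIV. oct_tensor (oct_basis a) (theta_entry 1 a))"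

definition \<phi>\<^sub>0 :: "octonion G_form" where
  "\<phi>\<^sub>0 = (\<Sum>a | a \<noteq> 0. oct_tensor (oct_basis a) (phi_col 0 a))"

definition \<phi>\<^sub>1 :: "octonion G_form" where
  "\<phi>\<^sub>1 = (\<Sum>a\<in>UNIV. oct_tensor (oct_basis a) (phi_col 1 a))"

definition horizontal_generators :: "real G_form set" where
  "horizontal_generators =
     {theta_entry k a | k a. True} \<union> {phi_col 0 a | a. a \<noteq> 0} \<union> {phi_col 1 a | a. True}"

definition horizontal_algebra :: "real G_form set" where
  "horizontal_algebra = generated_algebra G horizontal_generators"

text \<open>Membership in \<open>extensional\<close> makes such an endomorphism unique as a total function.\<close>

definition is_horizontal_projection :: "(real G_form \<Rightarrow> real G_form) \<Rightarrow> bool" where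
  "is_horizontal_projection h \<longleftrightarrow>
     h \<in> extensional left_invariant_forms \<and>
     algebra_endo G left_invariant_forms h \<and>
     (\<forall>\<omega>\<in>horizontal_generators. h \<omega> = \<omega>) \<and>
     (\<forall>a b. 1 \<le> b \<and> b < a \<longrightarrow> h (phi_entry (1, a) (1, b)) = 0)"

definition horizontal_projection :: "real G_form \<Rightarrow> real G_form" where
  "horizontal_projection = (THE h. is_horizontal_projection h)"

definition d\<^sub>h :: "real G_form \<Rightarrow> real G_form" where
  "d\<^sub>h \<omega> = horizontal_projection (ext_deriv G \<omega>)"

definition differentiation_rules :: "(real G_form \<Rightarrow> real G_form) \<Rightarrow> bool" where
  "differentiation_rules D \<longleftrightarrow>
     componentwise D (\<alpha> + \<theta>\<^sub>0) = - (\<phi>\<^sub>0 \<and>\<^sub>O (\<alpha> + \<theta>\<^sub>0)) - \<theta>\<^sub>1 \<and>\<^sub>O cnj_form \<phi>\<^sub>1 \<and>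
     componentwise D \<theta>\<^sub>1 = (\<alpha> + \<theta>\<^sub>0) \<and>\<^sub>O \<phi>\<^sub>1 - \<phi>\<^sub>0 \<and>\<^sub>O \<theta>\<^sub>1 + \<theta>\<^sub>1 \<and>\<^sub>O \<phi>\<^sub>0 \<and>
     componentwise D \<phi>\<^sub>0 = - (\<phi>\<^sub>0 \<and>\<^sub>O \<phi>\<^sub>0) - \<phi>\<^sub>1 \<and>\<^sub>O cnj_form \<phi>\<^sub>1 \<and>
     componentwise D \<phi>\<^sub>1 = \<phi>\<^sub>1 \<and>\<^sub>O \<phi>\<^sub>0"

end

theory Submission
  imports Defs
begin

text \<open>
  The proof has an algebraic and a geometric part.

  The algebraic part concerns the Lie algebra. The generators \<open>M p\<close> of the group, for \<open>p\<close> in the unit sphere of \<open>\<real> \<times> \<O>\<close>, span a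
  nine-dimensional space \<open>V\<close> of symmetric matrices, and \<open>M p M q + M q M p = 2 (p \<bullet> q)\<close>. The group
  normalizes \<open>V\<close>, so its tangent vectors at the identity lie in the Lie algebra of the skew
  matrices \<open>A\<close> with \<open>[A, V] \<subseteq> V\<close>. Conversely, the Clifford relations give for each such \<open>A\<close> a sum of
  products \<open>M u M v\<close> with \<open>u \<bullet> v = 0\<close> which acts on \<open>V\<close> like \<open>A\<close>; the difference commutes with \<open>V\<close>, and hence is
  zero because the nucleus of the octonions is real (lemma \<open>spin9_algebra_clifford\<close>). Each product
  \<open>M u M v\<close> is the velocity of a rotation in the group, so that all tangent spaces of \<open>G\<close> are
  known. An element of the Lie algebra is determined by its first column, which carries the values
  of \<open>\<phi>\<^sub>0\<close> and \<open>\<phi>\<^sub>1\<close>, and by its entries between imaginary coordinates of the second copy of \<open>\<O>\<close>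
  (\<open>spin9_algebra_eq_0\<close>). The elements for which the latter vanish are the matrices
  \<open>hor_matrix w z\<close> with rows \<open>(L\<^sub>w, - R\<^sub>y)\<close> and \<open>(R\<^sub>z, L\<^sub>w + R\<^sub>w)\<close>, where \<open>w\<close> is imaginary and \<open>y\<close> is the
  conjugate of \<open>z\<close>; that they belong to the Lie algebra is infinitesimal triality. The
  Maurer-Cartan equations \<open>d\<theta> = -\<phi> \<and> \<theta>\<close>, \<open>d\<phi> = -\<phi> \<and> \<phi>\<close>, restricted to these matrices, are
  the four differentiation rules (\<open>bracket_rules\<close>).

  The geometric part begins with forms. Contraction with the first argument turns the sum over shuffles and the exterior
  derivative into recursions on the list of arguments, from which the algebra of forms and the
  Leibniz rule follow by induction. Both \<open>G\<close> and the sphere bundle are homogeneous under affine maps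
  of the ambient space; therefore the derivative of an extension of a form does not
  depend on the extension (\<open>flat_ext_deriv_tangential\<close>), and \<open>d\<close> commutes with affine pullbacks. A
  left-invariant form is an alternating form on the Lie algebra of \<open>G\<close>, and splitting off one
  coordinate after the other writes it as a polynomial in the dual basis (\<open>split_coordinate\<close>). Hence
  \<open>h\<close> is unique, it is precomposition with a linear projection \<open>hor_proj\<close> of the Lie algebra, its
  fixed forms are the horizontal algebra, and antiderivations of this algebra are determined by
  their values on the generators.

  For the sphere bundle, the group acts transitively on the unit sphere with explicit smooth local
  sections, so that an element of the exterior algebra at the base point which is fixed by the
  stabilizer spreads to an invariant form. The differential of the projection
  from \<open>G\<close> factors through \<open>hor_proj\<close>; therefore pullbacks of invariant forms are fixed by \<open>h\<close>, and \<open>h\<close> may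
  be inserted in \<open>\<pi>\<^sup>* d = d \<pi>\<^sup>*\<close>.
\<close>


section \<open>Alternating forms as functions on lists\<close>

definition contract :: "'a \<Rightarrow> ('a list \<Rightarrow> real) \<Rightarrow> 'a list \<Rightarrow> real" where
  "contract v f = (\<lambda>vs. f (v # vs))"

definition grade :: "('a list \<Rightarrow> real) \<Rightarrow> 'a list \<Rightarrow> real" where
  "grade f = (\<lambda>vs. (-1) ^ length vs * f vs)"

definition ext_prod :: "('a list \<Rightarrow> real) \<Rightarrow> ('a list \<Rightarrow> real) \<Rightarrow> 'a list \<Rightarrow> real" where
  "ext_prod f g vs =
     (\<Sum>I\<in>Pow {..<length vs}. shuffle_sign (length vs) I * (f (nths vs I) * g (nths vs (- I))))"

definition ext_one :: "'a list \<Rightarrow> real" where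
  "ext_one vs = (if vs = [] then 1 else 0)"

lemma wedge_eq_ext_prod: "(\<omega> \<and>\<^sub>\<real> \<eta>) x = ext_prod (\<omega> x) (\<eta> x)"
  by (simp add: fun_eq_iff wedge_by_def ext_prod_def)

lemma alt_formsD_off: "f \<in> alt_forms T \<Longrightarrow> \<not> set vs \<subseteq> T \<Longrightarrow> f vs = 0"
  by (simp add: alt_forms_def)

lemma alt_formsD_linear:
  "f \<in> alt_forms T \<Longrightarrow> v \<in> T \<Longrightarrow> w \<in> T \<Longrightarrow> set us \<subseteq> T \<Longrightarrow> set ws \<subseteq> T \<Longrightarrow>
     f (us @ (a *\<^sub>R v + b *\<^sub>R w) # ws) = a * f (us @ v # ws) + b * f (us @ w # ws)"
  by (simp add: alt_forms_def)

lemma alt_formsD_distinct: "f \<in> alt_forms T \<Longrightarrow> set vs \<subseteq> T \<Longrightarrow> \<not> distinct vs \<Longrightarrow> f vs = 0"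
  by (simp add: alt_forms_def)

text \<open>
  Alternation can be tested on equal neighbours: polarising two neighbours shows that exchanging
  them changes the sign, so that two equal arguments can be moved next to each other.
\<close>

lemma alt_formsI:
  assumes off: "\<And>vs. \<not> set vs \<subseteq> T \<Longrightarrow> f vs = 0"
    and lin: "\<And>us ws v w a b. set us \<subseteq> T \<Longrightarrow> set ws \<subseteq> T \<Longrightarrow> v \<in> T \<Longrightarrow> w \<in> T \<Longrightarrow>
       f (us @ (a *\<^sub>R v + b *\<^sub>R w) # ws) = a * f (us @ v # ws) + b * f (us @ w # ws)"
    and adj: "\<And>us v ws. set us \<subseteq> T \<Longrightarrow> set ws \<subseteq> T \<Longrightarrow> v \<in> T \<Longrightarrow> f (us @ v # v # ws) = 0"
    and T: "subspace T"
  shows "f \<in> alt_forms T"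
proof -
  have swap: "f (us @ v # w # ws) = - f (us @ w # v # ws)"
    if "set us \<subseteq> T" "set ws \<subseteq> T" "v \<in> T" "w \<in> T" for us v w ws
  proof -
    have vw: "v + w \<in> T" using T that by (simp add: subspace_add)
    have "0 = f (us @ (v + w) # (v + w) # ws)" using adj[of us ws "v + w"] that vw by simp
    also have "\<dots> = f (us @ v # (v + w) # ws) + f (us @ w # (v + w) # ws)"
      using lin[of us "(v + w) # ws" v w 1 1] that vw by simp
    also have "\<dots> = f (us @ v # v # ws) + f (us @ v # w # ws)
                   + (f (us @ w # v # ws) + f (us @ w # w # ws))"
      using lin[of "us @ [v]" ws v w 1 1] lin[of "us @ [w]" ws v w 1 1] that by simp
    finally show ?thesis using adj[of us ws v] adj[of us ws w] that by simp
  qed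
  have sep: "f (us @ v # ws @ v # zs) = 0"
    if "set us \<subseteq> T" "set ws \<subseteq> T" "set zs \<subseteq> T" "v \<in> T" for us v ws zs
    using that
  proof (induction ws arbitrary: us)
    case Nil
    then show ?case using adj by simp
  next
    case (Cons w ws)
    have "f (us @ v # w # ws @ v # zs) = - f ((us @ [w]) @ v # ws @ v # zs)"
      using swap[of us "ws @ v # zs" v w] Cons.prems by simp
    then show ?case using Cons.IH[of "us @ [w]"] Cons.prems by simp
  qed
  have dist: "f vs = 0" if "set vs \<subseteq> T" and nd: "\<not> distinct vs" for vs
  proof -
    from not_distinct_decomp[OF nd] obtain us ws zs v where "vs = us @ [v] @ ws @ [v] @ zs" by blast
    then show ?thesis using sep[of us ws zs v] that by simp
  qed
  show ?thesis
    unfolding alt_forms_def using off lin dist by blast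
qed

lemma contract_alt:
  assumes "f \<in> alt_forms T" and "v \<in> T"
  shows "contract v f \<in> alt_forms T"
proof -
  have "f (v # us @ (a *\<^sub>R u + b *\<^sub>R w) # ws) = a * f (v # us @ u # ws) + b * f (v # us @ w # ws)"
    if "u \<in> T" "w \<in> T" "set us \<subseteq> T" "set ws \<subseteq> T" for us u w ws a b
    using alt_formsD_linear[OF assms(1) that(1,2), of "v # us" ws a b] that assms(2) by simp
  then show ?thesis
    using assms by (auto simp: alt_forms_def contract_def)
qed

lemma alt_cons_linear:
  "f \<in> alt_forms T \<Longrightarrow> v \<in> T \<Longrightarrow> w \<in> T \<Longrightarrow> set ws \<subseteq> T \<Longrightarrow>
     f ((a *\<^sub>R v + b *\<^sub>R w) # ws) = a * f (v # ws) + b * f (w # ws)"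
  using alt_formsD_linear[of f T v w "[]" ws a b] by simp

lemma alt_cons_add:
  "f \<in> alt_forms T \<Longrightarrow> v \<in> T \<Longrightarrow> w \<in> T \<Longrightarrow> set ws \<subseteq> T \<Longrightarrow>
     f ((v + w) # ws) = f (v # ws) + f (w # ws)"
  using alt_cons_linear[of f T v w ws 1 1] by simp

lemma alt_cons_scale:
  "f \<in> alt_forms T \<Longrightarrow> v \<in> T \<Longrightarrow> set ws \<subseteq> T \<Longrightarrow> f ((a *\<^sub>R v) # ws) = a * f (v # ws)"
  using alt_cons_linear[of f T v v ws a 0] by simp

lemma alt_cons_zero: "f \<in> alt_forms T \<Longrightarrow> f (0 # ws) = 0"
  using alt_formsD_off[of f T "0 # ws"] alt_cons_scale[of f T 0 ws 0] by fastforce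

lemma alt_cons_sum:
  assumes "f \<in> alt_forms T" and "subspace T" and "finite B" and "\<And>b. b \<in> B \<Longrightarrow> g b \<in> T"
    and "set ws \<subseteq> T"
  shows "f ((\<Sum>b\<in>B. g b) # ws) = (\<Sum>b\<in>B. f (g b # ws))"
  using assms(3,4)
proof (induction B rule: finite_induct)
  case empty
  then show ?case using alt_cons_zero[OF assms(1)] by simp
next
  case (insert b B)
  then have "sum g B \<in> T" using assms(2) by (simp add: subspace_sum)
  then show ?case using insert assms by (simp add: alt_cons_add)
qed

lemma alt_swap:
  assumes f: "f \<in> alt_forms T" and T: "subspace T" and v: "v \<in> T" and w: "w \<in> T"
  shows "f (v # w # ws) = - f (w # v # ws)"
proof (cases "set ws \<subseteq> T")
  case True
  have vw: "v + w \<in> T" using T v w by (simp add: subspace_add)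
  have *: "f (u # u # ws) = 0" if "u \<in> T" for u
    using alt_formsD_distinct[OF f, of "u # u # ws"] that True by simp
  have "0 = f ((v + w) # (v + w) # ws)" using *[OF vw] by simp
  also have "\<dots> = f (v # (v + w) # ws) + f (w # (v + w) # ws)"
    using alt_cons_add[OF f v w, of "(v + w) # ws"] True vw by simp
  also have "\<dots> = f (v # v # ws) + f (v # w # ws) + (f (w # v # ws) + f (w # w # ws))"
    using alt_cons_add[OF contract_alt[OF f v] v w, of ws]
      alt_cons_add[OF contract_alt[OF f w] v w, of ws] True by (simp add: contract_def)
  finally show ?thesis using * v w by simp
next
  case False
  then show ?thesis using alt_formsD_off[OF f] by simp
qed

lemma alt_add: "f \<in> alt_forms T \<Longrightarrow> g \<in> alt_forms T \<Longrightarrow> f + g \<in> alt_forms T"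
  unfolding alt_forms_def by (simp add: algebra_simps)

lemma alt_scale: "f \<in> alt_forms T \<Longrightarrow> (\<lambda>vs. c * f vs) \<in> alt_forms T"
  unfolding alt_forms_def by (simp add: algebra_simps)

lemma alt_zero: "(\<lambda>vs. 0) \<in> alt_forms T"
  unfolding alt_forms_def by simp

lemma alt_ext_one: "ext_one \<in> alt_forms T"
  unfolding alt_forms_def ext_one_def by auto

lemma alt_grade:
  assumes "f \<in> alt_forms T"
  shows "grade f \<in> alt_forms T"
  using assms unfolding alt_forms_def grade_def by (simp add: algebra_simps)

text \<open>
  Pullback along \<open>L\<close>, normalised to \<open>0\<close> off \<open>T\<close> as in \<open>alt_forms\<close>; for the identity map it is the
  restriction to \<open>T\<close>.
\<close>

definition pull_alt :: "'a set \<Rightarrow> ('a \<Rightarrow> 'b) \<Rightarrow> ('b list \<Rightarrow> real) \<Rightarrow> 'a list \<Rightarrow> real" where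
  "pull_alt T L f vs = (if set vs \<subseteq> T then f (map L vs) else 0)"

lemma pull_alt_alt:
  assumes L: "linear L" and f: "f \<in> alt_forms T'" and LT: "L ` T \<subseteq> T'" and T: "subspace T"
  shows "pull_alt T L f \<in> alt_forms T"
proof -
  interpret L: linear L by fact
  have 1: "L v \<in> T'" if "v \<in> T" for v using LT that by auto
  show ?thesis
    unfolding alt_forms_def pull_alt_def
  proof (intro CollectI conjI allI ballI impI; (elim conjE)?)
    fix us ws v w a b
    assume *: "v \<in> T" "w \<in> T" "set us \<subseteq> T" "set ws \<subseteq> T"
    have "a *\<^sub>R v + b *\<^sub>R w \<in> T" using * T by (simp add: subspace_add subspace_scale)
    then show "(if set (us @ (a *\<^sub>R v + b *\<^sub>R w) # ws) \<subseteq> T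
         then f (map L (us @ (a *\<^sub>R v + b *\<^sub>R w) # ws)) else 0) =
        a * (if set (us @ v # ws) \<subseteq> T then f (map L (us @ v # ws)) else 0) +
        b * (if set (us @ w # ws) \<subseteq> T then f (map L (us @ w # ws)) else 0)"
      using * alt_formsD_linear[OF f, of "L v" "L w" "map L us" "map L ws" a b] 1
      by (auto simp: L.add L.scaleR subset_iff)
  next
    fix vs assume *: "set vs \<subseteq> T" "\<not> distinct vs"
    then have "\<not> distinct (map L vs)" by (simp add: distinct_map)
    then show "(if set vs \<subseteq> T then f (map L vs) else 0) = 0"
      using alt_formsD_distinct[OF f, of "map L vs"] * 1 by auto
  qed auto
qed


section \<open>The exterior product\<close>

lemma nths_suc_image: "nths (v # vs) (Suc ` J) = nths vs J"
  by (simp add: nths_Cons inj_image_mem_iff)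

text \<open>
  If the first position belongs to the second factor then it contributes one inversion for each
  element of \<open>J\<close>; if it belongs to the first factor then it contributes none.
\<close>

lemma shuffle_sign_shift:
  assumes J: "J \<subseteq> {..<n}"
  shows "shuffle_sign (Suc n) (Suc ` J) = (-1) ^ card J * shuffle_sign n J"
    and "shuffle_sign (Suc n) (insert 0 (Suc ` J)) = shuffle_sign n J"
proof -
  let ?inv = "\<lambda>n I. {(i, j). i \<in> I \<and> j \<in> {..<n} - I \<and> j < i}"
  have finJ: "finite J" using J finite_subset by blast
  then have fin: "finite (?inv n J)"
    by (rule finite_subset[of _ "J \<times> {..<n}", rotated, OF finite_cartesian_product]) auto
  have suc: "map_prod Suc Suc ` ?inv n J = {(i, j). i \<in> Suc ` J \<and> j \<in> Suc ` ({..<n} - J) \<and> j < i}"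
    by (auto simp: image_iff)
  have c: "card (map_prod Suc Suc ` ?inv n J) = card (?inv n J)"
    by (rule card_image) (auto simp: inj_on_def)
  have "?inv (Suc n) (insert 0 (Suc ` J)) = map_prod Suc Suc ` ?inv n J"
    unfolding suc by (auto simp: image_iff gr0_conv_Suc less_Suc_eq_0_disj)
  then show "shuffle_sign (Suc n) (insert 0 (Suc ` J)) = shuffle_sign n J"
    using c by (simp add: shuffle_sign_def)
  have "?inv (Suc n) (Suc ` J) = (\<lambda>i. (Suc i, 0)) ` J \<union> map_prod Suc Suc ` ?inv n J"
    unfolding suc by (auto simp: image_iff gr0_conv_Suc less_Suc_eq_0_disj)
  moreover have "(\<lambda>i. (Suc i, 0::nat)) ` J \<inter> map_prod Suc Suc ` ?inv n J = {}" by auto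
  moreover have "card ((\<lambda>i. (Suc i, 0::nat)) ` J) = card J"
    by (rule card_image) (auto simp: inj_on_def)
  ultimately have "card (?inv (Suc n) (Suc ` J)) = card J + card (?inv n J)"
    using c fin finJ by (simp add: card_Un_disjoint)
  then show "shuffle_sign (Suc n) (Suc ` J) = (-1) ^ card J * shuffle_sign n J"
    by (simp add: shuffle_sign_def power_add)
qed

lemma ext_prod_Nil [simp]: "ext_prod f g [] = f [] * g []"
  by (simp add: ext_prod_def shuffle_sign_def)

text \<open>
  Splitting the sum over the shuffles according to the factor that receives the first argument shows
  that contraction with a vector is an antiderivation. Alternation, the Leibniz rule and the
  splitting of coordinates are derived from this recursion by induction on the list of arguments.
\<close>

lemma ext_prod_Cons:
  "ext_prod f g (v # vs) = ext_prod (contract v f) g vs + ext_prod (grade f) (contract v g) vs"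
proof -
  let ?n = "length vs"
  let ?t = "\<lambda>I. shuffle_sign (Suc ?n) I * (f (nths (v # vs) I) * g (nths (v # vs) (- I)))"
  have P: "Pow {..<Suc ?n} = (\<lambda>J. insert 0 (Suc ` J)) ` Pow {..<?n} \<union> (\<lambda>J. Suc ` J) ` Pow {..<?n}"
  proof -
    have "Pow {..<Suc ?n} = Pow (insert 0 (Suc ` {..<?n}))"
      by (simp add: lessThan_Suc_eq_insert_0)
    also have "\<dots> = insert 0 ` Pow (Suc ` {..<?n}) \<union> Pow (Suc ` {..<?n})"
      by (auto simp: Pow_insert)
    also have "Pow (Suc ` {..<?n}) = (\<lambda>J. Suc ` J) ` Pow {..<?n}"
      by (simp add: image_Pow_surj)
    finally show ?thesis by (simp add: image_image)
  qed
  have 1: "nths (v # vs) (insert 0 (Suc ` J)) = v # nths vs J" for J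
    by (simp add: nths_Cons inj_image_mem_iff)
  have 2: "nths (v # vs) (- insert 0 (Suc ` J)) = nths vs (- J)" for J
    by (simp add: nths_Cons inj_image_mem_iff Compl_eq)
  have 3: "nths (v # vs) (- (Suc ` J)) = v # nths vs (- J)" for J
    by (auto simp add: nths_Cons inj_image_mem_iff Compl_eq)
  have len: "length (nths vs J) = card J" if "J \<subseteq> {..<?n}" for J
    using that by (simp add: length_nths) (rule arg_cong[where f = card], auto)
  have inj0: "inj_on (\<lambda>J. insert 0 (Suc ` J)) (Pow {..<?n})"
  proof (rule inj_onI)
    fix J K assume "insert 0 (Suc ` J) = insert 0 (Suc ` K)"
    then have "insert 0 (Suc ` J) - {0} = insert 0 (Suc ` K) - {0}" by simp
    then have "Suc ` J = Suc ` K" by auto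
    then show "J = K" by (simp add: inj_image_eq_iff)
  qed
  have injS: "inj_on (\<lambda>J. Suc ` J) (Pow {..<?n})"
    by (auto intro!: inj_onI simp: inj_image_eq_iff)
  have "ext_prod f g (v # vs) = sum ?t (Pow {..<Suc ?n})" by (simp add: ext_prod_def)
  also have "\<dots> = sum ?t ((\<lambda>J. insert 0 (Suc ` J)) ` Pow {..<?n}) + sum ?t ((\<lambda>J. Suc ` J) ` Pow {..<?n})"
    unfolding P by (rule sum.union_disjoint) auto
  also have "sum ?t ((\<lambda>J. insert 0 (Suc ` J)) ` Pow {..<?n}) = ext_prod (contract v f) g vs"
    unfolding sum.reindex[OF inj0] ext_prod_def contract_def
    by (rule sum.cong) (simp_all add: 1 2 shuffle_sign_shift(2))
  also have "sum ?t ((\<lambda>J. Suc ` J) ` Pow {..<?n}) = ext_prod (grade f) (contract v g) vs"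
    unfolding sum.reindex[OF injS] ext_prod_def contract_def grade_def
    by (rule sum.cong) (simp_all add: nths_suc_image 3 shuffle_sign_shift(1) len)
  finally show ?thesis .
qed

lemma ext_prod_add_left: "ext_prod (f + f') g = ext_prod f g + ext_prod f' g"
  by (simp add: fun_eq_iff ext_prod_def sum.distrib algebra_simps)

lemma ext_prod_add_right: "ext_prod f (g + g') = ext_prod f g + ext_prod f g'"
  by (simp add: fun_eq_iff ext_prod_def sum.distrib algebra_simps)

lemma ext_prod_scale_left: "ext_prod (\<lambda>vs. c * f vs) g = (\<lambda>vs. c * ext_prod f g vs)"
  by (simp add: fun_eq_iff ext_prod_def sum_distrib_left algebra_simps)

lemma ext_prod_scale_right: "ext_prod f (\<lambda>vs. c * g vs) = (\<lambda>vs. c * ext_prod f g vs)"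
  by (simp add: fun_eq_iff ext_prod_def sum_distrib_left algebra_simps)

lemma ext_prod_uminus_left: "ext_prod (- f) g = - ext_prod f g"
  by (simp add: fun_eq_iff ext_prod_def sum_negf)

lemma ext_prod_uminus_right: "ext_prod f (- g) = - ext_prod f g"
  by (simp add: fun_eq_iff ext_prod_def sum_negf)

lemma ext_prod_diff_left: "ext_prod (f - f') g = ext_prod f g - ext_prod f' g"
  by (simp add: fun_eq_iff ext_prod_def sum_subtractf algebra_simps)

lemma ext_prod_diff_right: "ext_prod f (g - g') = ext_prod f g - ext_prod f g'"
  by (simp add: fun_eq_iff ext_prod_def sum_subtractf algebra_simps)

lemma ext_prod_zero_left: "ext_prod (\<lambda>vs. 0) g = (\<lambda>vs. 0)"
  by (simp add: fun_eq_iff ext_prod_def)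

lemma ext_prod_zero_right: "ext_prod f (\<lambda>vs. 0) = (\<lambda>vs. 0)"
  by (simp add: fun_eq_iff ext_prod_def)

lemma contract_grade: "contract v (grade f) = - grade (contract v f)"
  by (simp add: fun_eq_iff contract_def grade_def)

lemma grade_grade: "grade (grade f) = f"
  by (simp add: fun_eq_iff grade_def flip: power_mult_distrib mult.assoc)

lemma contract_ext_prod:
  "contract v (ext_prod f g) = ext_prod (contract v f) g + ext_prod (grade f) (contract v g)"
  by (simp add: fun_eq_iff contract_def[of _ "ext_prod f g"] ext_prod_Cons)

lemma contract_off: "f \<in> alt_forms T \<Longrightarrow> v \<notin> T \<Longrightarrow> contract v f = (\<lambda>vs. 0)"
  by (simp add: fun_eq_iff contract_def alt_formsD_off)

lemma contract_twice:
  assumes "f \<in> alt_forms T" and "v \<in> T"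
  shows "contract v (contract v f) = (\<lambda>vs. 0)"
proof
  fix ws
  have "f (v # v # ws) = 0"
    using alt_formsD_distinct[OF assms(1), of "v # v # ws"] alt_formsD_off[OF assms(1), of "v # v # ws"]
      assms(2) by auto
  then show "contract v (contract v f) ws = 0" by (simp add: contract_def)
qed

lemma contract_linear:
  assumes f: "f \<in> alt_forms T" and "v \<in> T" "w \<in> T" "subspace T"
  shows "contract (a *\<^sub>R v + b *\<^sub>R w) f = (\<lambda>vs. a * contract v f vs) + (\<lambda>vs. b * contract w f vs)"
proof
  fix vs
  show "contract (a *\<^sub>R v + b *\<^sub>R w) f vs = ((\<lambda>vs. a * contract v f vs) + (\<lambda>vs. b * contract w f vs)) vs"
    using alt_cons_linear[OF f assms(2,3), of vs a b] alt_formsD_off[OF f] assms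
    by (cases "set vs \<subseteq> T") (auto simp: contract_def)
qed

lemma ext_prod_alt:
  assumes f: "f \<in> alt_forms T" and g: "g \<in> alt_forms T" and T: "subspace T"
  shows "ext_prod f g \<in> alt_forms T"
proof (rule alt_formsI[OF _ _ _ T])
  show "ext_prod f g vs = 0" if "\<not> set vs \<subseteq> T" for vs
    using f g that
  proof (induction vs arbitrary: f g)
    case (Cons v vs)
    show ?case
    proof (cases "v \<in> T")
      case True
      then show ?thesis
        using Cons.IH[of "contract v f" g] Cons.IH[of "grade f" "contract v g"] Cons.prems
        by (simp add: ext_prod_Cons contract_alt alt_grade)
    next
      case False
      then show ?thesis
        using Cons.prems by (simp add: ext_prod_Cons contract_off ext_prod_zero_left ext_prod_zero_right)
    qed
  qed simp
next
  fix us ws v w a b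
  assume *: "set us \<subseteq> T" "set ws \<subseteq> T" "v \<in> T" "w \<in> T"
  show "ext_prod f g (us @ (a *\<^sub>R v + b *\<^sub>R w) # ws) =
     a * ext_prod f g (us @ v # ws) + b * ext_prod f g (us @ w # ws)"
    using f g *(1)
  proof (induction us arbitrary: f g)
    case Nil
    then show ?case
      using *
      by (simp add: ext_prod_Cons contract_linear[OF _ *(3,4) T] ext_prod_add_left ext_prod_add_right
          ext_prod_scale_left ext_prod_scale_right algebra_simps)
  next
    case (Cons u us)
    then have "u \<in> T" "set us \<subseteq> T" by auto
    then show ?case
      using Cons.IH[of "contract u f" g] Cons.IH[of "grade f" "contract u g"] Cons.prems
      by (simp add: ext_prod_Cons contract_alt alt_grade algebra_simps)
  qed
next
  fix us v ws
  assume *: "set us \<subseteq> T" "set ws \<subseteq> T" "v \<in> T"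
  show "ext_prod f g (us @ v # v # ws) = 0"
    using f g *(1)
  proof (induction us arbitrary: f g)
    case Nil
    then show ?case
      using *
      by (simp add: ext_prod_Cons contract_twice[OF _ *(3)] ext_prod_zero_left ext_prod_zero_right
          contract_grade ext_prod_uminus_left grade_grade)
  next
    case (Cons u us)
    then have "u \<in> T" "set us \<subseteq> T" by auto
    then show ?case
      using Cons.IH[of "contract u f" g] Cons.IH[of "grade f" "contract u g"] Cons.prems
      by (simp add: ext_prod_Cons contract_alt alt_grade)
  qed
qed

lemma ext_prod_one_left:
  fixes g :: "'a list \<Rightarrow> real"
  shows "ext_prod ext_one g = g"
proof
  fix vs show "ext_prod ext_one g vs = g vs"
  proof (induction vs arbitrary: g)
    case (Cons v vs)
    have "contract v ext_one = (\<lambda>vs. 0)" "grade ext_one = (ext_one :: 'a list \<Rightarrow> real)"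
      by (auto simp: fun_eq_iff contract_def ext_one_def grade_def)
    then show ?case using Cons.IH[of "contract v g"]
      by (simp add: ext_prod_Cons ext_prod_zero_left) (simp add: contract_def)
  qed (simp add: ext_one_def)
qed

lemma ext_prod_one_right: "ext_prod f ext_one = f"
proof
  fix vs show "ext_prod f ext_one vs = f vs"
  proof (induction vs arbitrary: f)
    case (Cons v vs)
    have "contract v ext_one = (\<lambda>vs. 0)"
      by (auto simp: fun_eq_iff contract_def ext_one_def grade_def)
    then show ?case using Cons.IH[of "contract v f"]
      by (simp add: ext_prod_Cons ext_prod_zero_right) (simp add: contract_def)
  qed (simp add: ext_one_def)
qed

lemma ext_prod_pull_alt:
  "pull_alt T L (ext_prod f g) = ext_prod (pull_alt T L f) (pull_alt T L g)"
proof
  fix vs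
  show "pull_alt T L (ext_prod f g) vs = ext_prod (pull_alt T L f) (pull_alt T L g) vs"
  proof (cases "set vs \<subseteq> T")
    case True
    have "set (nths vs I) \<subseteq> T" for I using True set_nths_subset by fast
    then show ?thesis using True by (simp add: pull_alt_def ext_prod_def nths_map)
  next
    case False
    have "set vs \<subseteq> set (nths vs I) \<union> set (nths vs (- I))" for I
      by (auto simp: set_nths in_set_conv_nth) blast
    then have "\<not> set (nths vs I) \<subseteq> T \<or> \<not> set (nths vs (- I)) \<subseteq> T" for I
      using False by blast
    then have "pull_alt T L f (nths vs I) * pull_alt T L g (nths vs (- I)) = 0" for I
      by (auto simp: pull_alt_def simp del: set_nths)
    then have "ext_prod (pull_alt T L f) (pull_alt T L g) vs = 0"
      unfolding ext_prod_def by (intro sum.neutral) simp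
    then show ?thesis using False by (simp add: pull_alt_def)
  qed
qed


section \<open>Splitting off one coordinate\<close>

definition alt_one :: "'a set \<Rightarrow> ('a \<Rightarrow> real) \<Rightarrow> 'a list \<Rightarrow> real" where
  "alt_one T l vs = (if length vs = 1 \<and> set vs \<subseteq> T then l (hd vs) else 0)"

lemma contract_alt_one:
  "contract v (alt_one T l) = (\<lambda>vs. (if v \<in> T then l v else 0) * ext_one vs)"
  by (auto simp: fun_eq_iff contract_def alt_one_def ext_one_def)

lemma grade_alt_one: "grade (alt_one T l) = - alt_one T l"
  by (auto simp: fun_eq_iff grade_def alt_one_def)

lemma alt_one_alt:
  assumes l: "linear l" and T: "subspace T"
  shows "alt_one T l \<in> alt_forms T"
proof (rule alt_formsI[OF _ _ _ T])
  interpret linear l by fact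
  fix us ws v w a b
  assume "set us \<subseteq> T" "set ws \<subseteq> T" "v \<in> T" "w \<in> T"
  moreover from this have "a *\<^sub>R v + b *\<^sub>R w \<in> T" using T by (simp add: subspace_add subspace_scale)
  ultimately show "alt_one T l (us @ (a *\<^sub>R v + b *\<^sub>R w) # ws) =
     a * alt_one T l (us @ v # ws) + b * alt_one T l (us @ w # ws)"
    by (cases us; cases ws) (auto simp: alt_one_def add scaleR)
qed (auto simp: alt_one_def)

text \<open>
  Multilinear expansion in the component along \<open>e\<close>: terms with two arguments \<open>e\<close> vanish, and the terms
  with one argument \<open>e\<close>, moved to the front, form the product of \<open>l\<close> with the contraction. Applied to one
  coordinate after the other this expresses an alternating form through the dual basis.
\<close>

lemma split_coordinate:
  assumes P: "linear P" and PT: "\<And>v. v \<in> T \<Longrightarrow> P v \<in> T" and e: "e \<in> T" and T: "subspace T"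
    and f: "f \<in> alt_forms T"
  shows "pull_alt T (\<lambda>v. P v + l v *\<^sub>R e) f =
     pull_alt T P f + ext_prod (alt_one T l) (pull_alt T P (contract e f))"
proof
  fix vs
  have "f (map (\<lambda>v. P v + l v *\<^sub>R e) vs) = f (map P vs) + ext_prod (alt_one T l) (pull_alt T P (contract e f)) vs"
    if "set vs \<subseteq> T"
    using f that
  proof (induction vs arbitrary: f)
    case Nil
    then show ?case by (simp add: alt_one_def)
  next
    case (Cons v vs)
    have v: "v \<in> T" and vs: "set vs \<subseteq> T" using Cons.prems by auto
    have Pv: "P v \<in> T" using PT v by simp
    have w: "P v + l v *\<^sub>R e \<in> T" using Pv e T by (simp add: subspace_add subspace_scale)
    have Pvs: "set (map P vs) \<subseteq> T" using vs PT by auto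
    have c: "contract (P v + l v *\<^sub>R e) f = contract (P v) f + (\<lambda>us. l v * contract e f us)"
      using contract_linear[OF Cons.prems(1) Pv e T, of 1 "l v"] by simp
    have "f (map (\<lambda>v. P v + l v *\<^sub>R e) (v # vs)) =
        contract (P v + l v *\<^sub>R e) f (map (\<lambda>v. P v + l v *\<^sub>R e) vs)"
      by (simp add: contract_def)
    also have "\<dots> = contract (P v + l v *\<^sub>R e) f (map P vs) +
        ext_prod (alt_one T l) (pull_alt T P (contract e (contract (P v + l v *\<^sub>R e) f))) vs"
      by (rule Cons.IH) (use Cons.prems w vs contract_alt in auto)
    also have "contract e (contract (P v + l v *\<^sub>R e) f) = contract e (contract (P v) f)"
      unfolding c using contract_twice[OF Cons.prems(1) e] by (simp add: fun_eq_iff contract_def)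
    also have "contract (P v + l v *\<^sub>R e) f (map P vs) = f (map P (v # vs)) + l v * f (e # map P vs)"
      unfolding c by (simp add: contract_def)
    also have "pull_alt T P (contract e (contract (P v) f)) = - contract v (pull_alt T P (contract e f))"
      using alt_swap[OF Cons.prems(1) T Pv e] v by (auto simp: fun_eq_iff pull_alt_def contract_def)
    also have "ext_prod (alt_one T l) (- contract v (pull_alt T P (contract e f))) vs
        = ext_prod (grade (alt_one T l)) (contract v (pull_alt T P (contract e f))) vs"
      by (simp add: grade_alt_one ext_prod_uminus_left ext_prod_uminus_right)
    also have "l v * f (e # map P vs) = ext_prod (contract v (alt_one T l)) (pull_alt T P (contract e f)) vs"
      using v vs by (simp add: contract_alt_one ext_prod_scale_left ext_prod_one_left)
         (simp add: pull_alt_def contract_def)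
    finally show ?case by (simp add: ext_prod_Cons)
  qed
  moreover have "ext_prod (alt_one T l) (pull_alt T P (contract e f)) vs = 0" if "\<not> set vs \<subseteq> T"
  proof -
    have "pull_alt T P (contract e f) = pull_alt T id (pull_alt T P (contract e f))"
         "alt_one T l = pull_alt T id (alt_one T l)"
      by (auto simp: fun_eq_iff pull_alt_def alt_one_def)
    then have "ext_prod (alt_one T l) (pull_alt T P (contract e f)) =
       pull_alt T id (ext_prod (alt_one T l) (pull_alt T P (contract e f)))"
      by (metis ext_prod_pull_alt)
    then show ?thesis using that by (metis pull_alt_def)
  qed
  ultimately show "pull_alt T (\<lambda>v. P v + l v *\<^sub>R e) f vs =
     (pull_alt T P f + ext_prod (alt_one T l) (pull_alt T P (contract e f))) vs"
    by (auto simp: pull_alt_def)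
qed


section \<open>Smooth functions\<close>

text \<open>
  For open sets the notion is local, so that derivatives may be computed by the usual rules. The
  closure properties below follow by induction on the order, since each rule of differentiation
  expresses the derivative by functions of the same kind.
\<close>

lemma times_differentiable_on_cong:
  assumes S: "open S" and eq: "\<And>x. x \<in> S \<Longrightarrow> f x = g x" and f: "times_differentiable_on S f n"
  shows "times_differentiable_on S g n"
  using eq f
proof (induction n arbitrary: f g)
  case 0
  then have "continuous_on S g" by (metis continuous_on_cong times_differentiable_on.simps(1))
  then show ?case by simp
next
  case (Suc n)
  have D: "(f has_derivative frechet_derivative f (at x)) (at x)" if "x \<in> S" for x
    using Suc.prems(2) that frechet_derivative_works by auto
  have g: "(g has_derivative frechet_derivative f (at x)) (at x)" if "x \<in> S" for x
    by (rule has_derivative_transform_within_open[OF D[OF that] S that]) (use Suc.prems in auto)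
  then have "frechet_derivative f (at x) v = frechet_derivative g (at x) v" if "x \<in> S" for x v
    using frechet_derivative_at that by metis
  then have "times_differentiable_on S (\<lambda>x. frechet_derivative g (at x) v) n" for v
    using Suc.IH[of "\<lambda>x. frechet_derivative f (at x) v"] Suc.prems(2) by simp
  then show ?case using g by (auto simp: differentiable_def)
qed

lemma times_differentiable_on_Suc:
  assumes S: "open S" and f: "\<And>x. x \<in> S \<Longrightarrow> (f has_derivative f' x) (at x)"
    and f': "\<And>v. times_differentiable_on S (\<lambda>x. f' x v) n"
  shows "times_differentiable_on S f (Suc n)"
proof -
  have "f' x v = frechet_derivative f (at x) v" if "x \<in> S" for x v
    using frechet_derivative_at[OF f[OF that]] by simp
  then have "times_differentiable_on S (\<lambda>x. frechet_derivative f (at x) v) n" for v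
    by (rule times_differentiable_on_cong[OF S _ f'[of v]])
  then show ?thesis using f by (auto simp: differentiable_def)
qed

lemma times_differentiable_on_subset:
  assumes "T \<subseteq> S" and "times_differentiable_on S f n"
  shows "times_differentiable_on T f n"
  using assms(2)
proof (induction n arbitrary: f)
  case 0
  then show ?case using assms(1) continuous_on_subset by auto
qed (use assms(1) in auto)

lemma times_differentiable_on_lower:
  "times_differentiable_on S f (Suc n) \<Longrightarrow> times_differentiable_on S f n"
proof (induction n arbitrary: f)
  case 0
  then show ?case
    by (auto intro!: continuous_at_imp_continuous_on differentiable_imp_continuous_within)
qed auto

lemma times_differentiable_on_derivative:
  "times_differentiable_on S f (Suc n) \<Longrightarrow> x \<in> S \<Longrightarrow>
     (f has_derivative frechet_derivative f (at x)) (at x)"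
  using frechet_derivative_works by auto

lemma times_differentiable_on_const: "times_differentiable_on S (\<lambda>x. c) n"
  by (induction n arbitrary: c) auto

lemma times_differentiable_on_bounded_linear:
  assumes S: "open S" and L: "bounded_linear L" and f: "times_differentiable_on S f n"
  shows "times_differentiable_on S (\<lambda>x. L (f x)) n"
  using f
proof (induction n arbitrary: f)
  case 0
  then show ?case by (simp add: bounded_linear.continuous_on[OF L])
next
  case (Suc n)
  show ?case
    by (rule times_differentiable_on_Suc[OF S bounded_linear.has_derivative[OF L
            times_differentiable_on_derivative[OF Suc.prems]]], assumption)
      (use Suc.prems in \<open>simp add: Suc.IH\<close>)
qed

lemma times_differentiable_on_add:
  assumes S: "open S" and f: "times_differentiable_on S f n" and g: "times_differentiable_on S g n"
  shows "times_differentiable_on S (\<lambda>x. f x + g x) n"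
  using f g
proof (induction n arbitrary: f g)
  case 0
  then show ?case by (simp add: continuous_on_add)
next
  case (Suc n)
  show ?case
    by (rule times_differentiable_on_Suc[OF S has_derivative_add[OF
            times_differentiable_on_derivative[OF Suc.prems(1)]
            times_differentiable_on_derivative[OF Suc.prems(2)]]], assumption, assumption)
      (use Suc.prems in \<open>simp add: Suc.IH\<close>)
qed

lemma times_differentiable_on_bilinear:
  assumes S: "open S" and B: "bounded_bilinear B"
    and f: "times_differentiable_on S f n" and g: "times_differentiable_on S g n"
  shows "times_differentiable_on S (\<lambda>x. B (f x) (g x)) n"
  using f g
proof (induction n arbitrary: f g)
  case 0
  then show ?case by (simp add: bounded_bilinear.continuous_on[OF B])
next
  case (Suc n)
  show ?case
    by (rule times_differentiable_on_Suc[OF S bounded_bilinear.FDERIV[OF B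
            times_differentiable_on_derivative[OF Suc.prems(1)]
            times_differentiable_on_derivative[OF Suc.prems(2)]]], assumption, assumption)
      (use Suc.prems times_differentiable_on_lower[OF Suc.prems(1)]
         times_differentiable_on_lower[OF Suc.prems(2)] in
         \<open>simp add: times_differentiable_on_add[OF S] Suc.IH\<close>)
qed

lemma times_differentiable_on_inverse:
  fixes f :: "'a::real_normed_vector \<Rightarrow> real"
  assumes S: "open S" and f: "times_differentiable_on S f n" and nz: "\<And>x. x \<in> S \<Longrightarrow> f x \<noteq> 0"
  shows "times_differentiable_on S (\<lambda>x. inverse (f x)) n"
  using f
proof (induction n)
  case 0
  then show ?case using nz by (simp add: continuous_on_inverse)
next
  case (Suc n)
  note B = times_differentiable_on_bilinear[OF S bounded_bilinear_mult]
  note IH = Suc.IH[OF times_differentiable_on_lower[OF Suc.prems]]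
  show ?case
  proof (rule times_differentiable_on_Suc[OF S])
    fix x assume x: "x \<in> S"
    show "((\<lambda>x. inverse (f x)) has_derivative
        (\<lambda>v. - (inverse (f x) * frechet_derivative f (at x) v * inverse (f x)))) (at x)"
      using Deriv.has_derivative_inverse[OF nz[OF x] times_differentiable_on_derivative[OF Suc.prems x]]
      by simp
  next
    fix v
    have "times_differentiable_on S (\<lambda>x. frechet_derivative f (at x) v) n"
      using Suc.prems by simp
    then show "times_differentiable_on S
        (\<lambda>x. - (inverse (f x) * frechet_derivative f (at x) v * inverse (f x))) n"
      by (intro times_differentiable_on_bounded_linear[OF S, where L = uminus] B IH
          bounded_linear_minus bounded_linear_ident)
  qed
qed

lemma times_differentiable_on_compose_affine:
  assumes S: "open S" and T: "open T" and L: "bounded_linear L" and TS: "\<And>x. x \<in> T \<Longrightarrow> L x + c \<in> S"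
    and f: "times_differentiable_on S f n"
  shows "times_differentiable_on T (\<lambda>x. f (L x + c)) n"
  using f
proof (induction n arbitrary: f)
  case 0
  have "continuous_on T (\<lambda>x. L x + c)"
    by (intro continuous_intros bounded_linear.continuous_on[OF L])
  then show ?case using 0 TS continuous_on_compose2[of S f T "\<lambda>x. L x + c"] by auto
next
  case (Suc n)
  have D: "((\<lambda>x. L x + c) has_derivative L) (at x)" for x
    using has_derivative_add_const[OF bounded_linear_imp_has_derivative[OF L]] by blast
  have *: "((\<lambda>x. f (L x + c)) has_derivative (\<lambda>v. frechet_derivative f (at (L x + c)) (L v))) (at x)"
    if "x \<in> T" for x
    using has_derivative_compose[OF D times_differentiable_on_derivative[OF Suc.prems TS[OF that]]] .
  show ?case
  proof (rule times_differentiable_on_Suc[OF T *])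
    show "times_differentiable_on T (\<lambda>x. frechet_derivative f (at (L x + c)) (L v)) n" for v
      by (rule Suc.IH[of "\<lambda>x. frechet_derivative f (at x) (L v)"]) (use Suc.prems in simp)
  qed
qed

lemma smooth_on_cong: "open S \<Longrightarrow> (\<And>x. x \<in> S \<Longrightarrow> f x = g x) \<Longrightarrow> smooth_on S f \<Longrightarrow> smooth_on S g"
  unfolding smooth_on_def using times_differentiable_on_cong by blast

lemma smooth_on_subset: "smooth_on S f \<Longrightarrow> T \<subseteq> S \<Longrightarrow> smooth_on T f"
  unfolding smooth_on_def using times_differentiable_on_subset by blast

lemma smooth_on_has_derivative:
  "smooth_on S f \<Longrightarrow> x \<in> S \<Longrightarrow> (f has_derivative frechet_derivative f (at x)) (at x)"
  unfolding smooth_on_def using times_differentiable_on_derivative by blast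

lemma smooth_on_frechet_derivative:
  "smooth_on S f \<Longrightarrow> smooth_on S (\<lambda>x. frechet_derivative f (at x) v)"
  unfolding smooth_on_def by (metis times_differentiable_on.simps(2))

lemma smooth_on_const: "smooth_on S (\<lambda>x. c)"
  by (simp add: smooth_on_def times_differentiable_on_const)

lemma smooth_on_bounded_linear:
  "open S \<Longrightarrow> bounded_linear L \<Longrightarrow> smooth_on S f \<Longrightarrow> smooth_on S (\<lambda>x. L (f x))"
  by (simp add: smooth_on_def times_differentiable_on_bounded_linear)

lemma smooth_on_add:
  "open S \<Longrightarrow> smooth_on S f \<Longrightarrow> smooth_on S g \<Longrightarrow> smooth_on S (\<lambda>x. f x + g x)"
  by (simp add: smooth_on_def times_differentiable_on_add)

lemma smooth_on_bilinear:
  "open S \<Longrightarrow> bounded_bilinear B \<Longrightarrow> smooth_on S f \<Longrightarrow> smooth_on S g \<Longrightarrow> smooth_on S (\<lambda>x. B (f x) (g x))"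
  by (simp add: smooth_on_def times_differentiable_on_bilinear)

lemma smooth_on_inverse:
  fixes f :: "'a::real_normed_vector \<Rightarrow> real"
  shows "open S \<Longrightarrow> smooth_on S f \<Longrightarrow> (\<And>x. x \<in> S \<Longrightarrow> f x \<noteq> 0) \<Longrightarrow> smooth_on S (\<lambda>x. inverse (f x))"
  by (simp add: smooth_on_def times_differentiable_on_inverse)

lemma smooth_on_compose_affine:
  "open S \<Longrightarrow> open T \<Longrightarrow> bounded_linear L \<Longrightarrow> (\<And>x. x \<in> T \<Longrightarrow> L x + c \<in> S) \<Longrightarrow> smooth_on S f \<Longrightarrow>
     smooth_on T (\<lambda>x. f (L x + c))"
  by (simp add: smooth_on_def times_differentiable_on_compose_affine)

lemma smooth_on_linear_map:
  assumes "open S" "bounded_linear L" shows "smooth_on S L"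
proof -
  have "times_differentiable_on S (\<lambda>x. x) n" for n :: nat and S :: "'a set"
    by (cases n) (auto simp: times_differentiable_on_const)
  then show ?thesis
    using smooth_on_bounded_linear[OF assms, of "\<lambda>x. x"] by (simp add: smooth_on_def)
qed

lemma smooth_on_mult:
  fixes f g :: "'a::real_normed_vector \<Rightarrow> real"
  shows "open S \<Longrightarrow> smooth_on S f \<Longrightarrow> smooth_on S g \<Longrightarrow> smooth_on S (\<lambda>x. f x * g x)"
  by (rule smooth_on_bilinear[OF _ bounded_bilinear_mult])

lemma smooth_on_sum:
  assumes "open S" and "\<And>i. i \<in> I \<Longrightarrow> smooth_on S (f i)"
  shows "smooth_on S (\<lambda>x. \<Sum>i\<in>I. f i x)"
  using assms(2)
  by (induction I rule: infinite_finite_induct) (simp_all add: smooth_on_const smooth_on_add assms(1))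

lemma smooth_on_Pair:
  assumes "open S" and "smooth_on S f" and "smooth_on S g"
  shows "smooth_on S (\<lambda>x. (f x, g x))"
proof -
  have "smooth_on S (\<lambda>x. (f x, 0) + (0, g x))"
    by (intro smooth_on_add smooth_on_bounded_linear[where L = "\<lambda>y. (y, 0)"]
       smooth_on_bounded_linear[where L = "\<lambda>y. (0, y)"] assms bounded_linear_intros
        bounded_linear_Pair bounded_linear_ident bounded_linear_zero)
  then show ?thesis by simp
qed

lemma smooth_on_cos_sin: "smooth_on UNIV (cos :: real \<Rightarrow> real)" "smooth_on UNIV (sin :: real \<Rightarrow> real)"
proof -
  have "times_differentiable_on UNIV (cos :: real \<Rightarrow> real) n \<and> times_differentiable_on UNIV (sin :: real \<Rightarrow> real) n" for n
  proof (induction n)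
    case 0
    show ?case by (simp add: continuous_on_cos continuous_on_sin)
  next
    case (Suc n)
    have "times_differentiable_on UNIV (\<lambda>x::real. v * - sin x) n" for v
      using Suc times_differentiable_on_bounded_linear[of UNIV "\<lambda>y. v * - y" sin n]
      by (simp add: bounded_linear_mult_right bounded_linear_minus bounded_linear_intros)
    moreover have "times_differentiable_on UNIV (\<lambda>x::real. v * cos x) n" for v
      using Suc times_differentiable_on_bounded_linear[of UNIV "\<lambda>y. v * y" cos n]
      by (simp add: bounded_linear_mult_right)
    moreover have "(cos has_derivative (\<lambda>v. v * - sin x)) (at x)"
        "(sin has_derivative (\<lambda>v. v * cos x)) (at x)" for x :: real
      by (auto intro!: derivative_eq_intros)
    ultimately show ?case
      by (intro conjI times_differentiable_on_Suc[OF open_UNIV, of cos "\<lambda>x v. v * - sin x"]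
          times_differentiable_on_Suc[OF open_UNIV, of sin "\<lambda>x v. v * cos x"])
  qed
  then show "smooth_on UNIV (cos :: real \<Rightarrow> real)" "smooth_on UNIV (sin :: real \<Rightarrow> real)"
    by (auto simp: smooth_on_def)
qed


section \<open>The exterior derivative in the ambient space\<close>

abbreviation along :: "('a::real_normed_vector, real) form \<Rightarrow> 'a \<Rightarrow> 'a \<Rightarrow> 'a list \<Rightarrow> real" where
  "along \<eta> x v vs \<equiv> frechet_derivative (\<lambda>y. \<eta> y vs) (at x) v"

lemma flat_ext_deriv_Nil [simp]: "flat_ext_deriv \<eta> x [] = 0"
  by (simp add: flat_ext_deriv_def)

text \<open>
  This is Cartan's formula \<open>\<iota>\<^sub>v d\<eta> = L\<^sub>v \<eta> - d \<iota>\<^sub>v \<eta>\<close> for a constant vector field \<open>v\<close>, whose Lie derivative is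
  the derivative of the coefficients.
\<close>

lemma flat_ext_deriv_Cons:
  "flat_ext_deriv \<eta> x (v # vs) =
     along \<eta> x v vs - flat_ext_deriv (\<lambda>y. contract v (\<eta> y)) x vs"
  by (simp add: flat_ext_deriv_def contract_def sum.lessThan_Suc_shift sum_negf
      del: sum.lessThan_Suc)

lemma contract_flat_ext_deriv:
  "contract v (flat_ext_deriv \<eta> x) = along \<eta> x v - flat_ext_deriv (\<lambda>y. contract v (\<eta> y)) x"
  by (simp add: fun_eq_iff contract_def[of v "flat_ext_deriv \<eta> x"] flat_ext_deriv_Cons)

lemma frechet_derivative_cong_open:
  assumes "open U" "x \<in> U" and "\<And>y. y \<in> U \<Longrightarrow> f y = g y"
  shows "frechet_derivative f (at x) = frechet_derivative g (at x)"
proof -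
  have "(f has_derivative D) (at x) \<longleftrightarrow> (g has_derivative D) (at x)" for D
    using has_derivative_transform_within_open[OF _ assms(1,2)] assms(3) by metis
  then show ?thesis by (simp add: frechet_derivative_def)
qed

lemma flat_ext_deriv_cong:
  assumes "open U" "x \<in> U" and "\<And>y vs. y \<in> U \<Longrightarrow> \<eta> y vs = \<zeta> y vs"
  shows "flat_ext_deriv \<eta> x vs = flat_ext_deriv \<zeta> x vs"
proof -
  have "frechet_derivative (\<lambda>y. \<eta> y us) (at x) = frechet_derivative (\<lambda>y. \<zeta> y us) (at x)" for us
    by (rule frechet_derivative_cong_open[OF assms(1,2)]) (use assms(3) in auto)
  then show ?thesis by (simp add: flat_ext_deriv_def)
qed

lemma frechet_derivative_eqI:
  "(f has_derivative D) (at x) \<Longrightarrow> frechet_derivative f (at x) v = D v"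
  using frechet_derivative_at[of f D x] by simp

definition smooth_form :: "'a::euclidean_space set \<Rightarrow> ('a, real) form \<Rightarrow> bool" where
  "smooth_form U \<eta> \<longleftrightarrow> open U \<and> (\<forall>y\<in>U. \<eta> y \<in> alt_forms UNIV) \<and> (\<forall>vs. smooth_on U (\<lambda>y. \<eta> y vs))"

lemma smooth_formD:
  assumes "smooth_form U \<eta>"
  shows "open U" "y \<in> U \<Longrightarrow> \<eta> y \<in> alt_forms UNIV" "smooth_on U (\<lambda>y. \<eta> y vs)"
    "x \<in> U \<Longrightarrow> ((\<lambda>y. \<eta> y vs) has_derivative (\<lambda>v. along \<eta> x v vs)) (at x)"
  using assms smooth_on_has_derivative[of U "\<lambda>y. \<eta> y vs" x] by (auto simp: smooth_form_def)

lemma smooth_form_subset: "smooth_form U \<eta> \<Longrightarrow> open V \<Longrightarrow> V \<subseteq> U \<Longrightarrow> smooth_form V \<eta>"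
  unfolding smooth_form_def using smooth_on_subset by blast

lemma smooth_form_contract: "smooth_form U \<eta> \<Longrightarrow> smooth_form U (\<lambda>y. contract v (\<eta> y))"
  unfolding smooth_form_def using contract_alt[of _ UNIV v] by (auto simp: contract_def[abs_def])

lemma smooth_form_linear:
  assumes "smooth_form U \<eta>" "smooth_form U \<zeta>"
  shows "smooth_form U (\<lambda>y vs. a * \<eta> y vs + b * \<zeta> y vs)"
proof -
  have "(\<lambda>vs. a * \<eta> y vs + b * \<zeta> y vs) = (\<lambda>vs. a * \<eta> y vs) + (\<lambda>vs. b * \<zeta> y vs)" for y
    by (simp add: fun_eq_iff)
  then show ?thesis
    using assms unfolding smooth_form_def
    by (auto intro!: alt_add alt_scale smooth_on_add smooth_on_mult smooth_on_const)
qed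

lemma smooth_form_ext_prod:
  assumes "smooth_form U \<eta>" "smooth_form U \<zeta>"
  shows "smooth_form U (\<lambda>y. ext_prod (\<eta> y) (\<zeta> y))"
  using assms unfolding smooth_form_def ext_prod_def
  by (auto intro!: ext_prod_alt[unfolded ext_prod_def[abs_def]] subspace_UNIV
        smooth_on_sum smooth_on_mult smooth_on_const)

lemma along_linear:
  assumes "smooth_form U \<eta>" "smooth_form U \<zeta>" "x \<in> U"
  shows "along (\<lambda>y vs. a * \<eta> y vs + b * \<zeta> y vs) x v vs = a * along \<eta> x v vs + b * along \<zeta> x v vs"
proof -
  have "((\<lambda>y. a * \<eta> y vs + b * \<zeta> y vs) has_derivative
     (\<lambda>v. a * along \<eta> x v vs + b * along \<zeta> x v vs)) (at x)"
    using assms by (auto intro!: derivative_eq_intros smooth_formD)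
  then show ?thesis by (rule frechet_derivative_eqI)
qed

lemma flat_ext_deriv_linear:
  assumes "smooth_form U \<eta>" "smooth_form U \<zeta>" "x \<in> U"
  shows "flat_ext_deriv (\<lambda>y vs. a * \<eta> y vs + b * \<zeta> y vs) x vs =
     a * flat_ext_deriv \<eta> x vs + b * flat_ext_deriv \<zeta> x vs"
  by (simp add: flat_ext_deriv_def along_linear[OF assms] sum.distrib sum_distrib_left algebra_simps)

lemma flat_ext_deriv_uminus:
  assumes "smooth_form U \<eta>" "x \<in> U"
  shows "flat_ext_deriv (\<lambda>y. - \<eta> y) x vs = - flat_ext_deriv \<eta> x vs"
  using flat_ext_deriv_linear[OF assms(1,1,2), of "-1" 0 vs] by (simp add: fun_Compl_def)

lemma flat_ext_deriv_zero: "flat_ext_deriv (\<lambda>y vs. 0) x vs = 0"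
  by (simp add: flat_ext_deriv_def)

text \<open>
  By the recursion, \<open>d\<eta>\<close> takes on \<open>v, v, \<dots>\<close> the value \<open>D\<^sub>v \<iota>\<^sub>v \<eta> - D\<^sub>v \<iota>\<^sub>v \<eta> + d \<iota>\<^sub>v \<iota>\<^sub>v \<eta> = 0\<close>. Equal neighbours at later
  positions are reached by contracting the preceding arguments.
\<close>

lemma smooth_form_flat_ext_deriv:
  assumes \<eta>: "smooth_form U \<eta>"
  shows "smooth_form U (flat_ext_deriv \<eta>)"
proof -
  have "flat_ext_deriv \<eta> x \<in> alt_forms UNIV" if x: "x \<in> U" for x
  proof (rule alt_formsI)
    fix us ws v w and a b :: real
    note U = smooth_formD(1)[OF \<eta>]
    show "flat_ext_deriv \<eta> x (us @ (a *\<^sub>R v + b *\<^sub>R w) # ws) =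
      a * flat_ext_deriv \<eta> x (us @ v # ws) + b * flat_ext_deriv \<eta> x (us @ w # ws)"
      using \<eta>
    proof (induction us arbitrary: \<eta>)
      case Nil
      have "flat_ext_deriv (\<lambda>y. contract (a *\<^sub>R v + b *\<^sub>R w) (\<eta> y)) x ws =
          flat_ext_deriv (\<lambda>y vs. a * contract v (\<eta> y) vs + b * contract w (\<eta> y) vs) x ws"
        by (rule flat_ext_deriv_cong[OF U x])
          (simp add: contract_linear[OF smooth_formD(2)[OF Nil] _ _ subspace_UNIV])
      moreover have "along \<eta> x (a *\<^sub>R v + b *\<^sub>R w) ws = a * along \<eta> x v ws + b * along \<eta> x w ws"
      proof -
        have l: "linear (\<lambda>v. along \<eta> x v ws)"
          using smooth_formD(4)[OF Nil x, of ws] has_derivative_linear by blast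
        show ?thesis using linear_add[OF l] linear_scale[OF l] by simp
      qed
      ultimately show ?case
        by (simp only: append_Nil flat_ext_deriv_Cons flat_ext_deriv_linear[OF smooth_form_contract[OF Nil]
            smooth_form_contract[OF Nil] x] right_diff_distrib)
    next
      case (Cons u us)
      have "along \<eta> x u (us @ (a *\<^sub>R v + b *\<^sub>R w) # ws) =
         frechet_derivative (\<lambda>y. a * \<eta> y (us @ v # ws) + b * \<eta> y (us @ w # ws)) (at x) u"
        by (rule arg_cong[where f = "\<lambda>f. f u"], rule frechet_derivative_cong_open[OF U x])
          (use alt_formsD_linear[OF smooth_formD(2)[OF Cons.prems]] in simp)
      also have "\<dots> = a * along \<eta> x u (us @ v # ws) + b * along \<eta> x u (us @ w # ws)"
      proof -
        have "((\<lambda>y. a * \<eta> y (us @ v # ws) + b * \<eta> y (us @ w # ws)) has_derivative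
          (\<lambda>u. a * along \<eta> x u (us @ v # ws) + b * along \<eta> x u (us @ w # ws))) (at x)"
          using Cons.prems x by (auto intro!: derivative_eq_intros smooth_formD)
        then show ?thesis by (rule frechet_derivative_eqI)
      qed
      finally show ?case
        using Cons.IH[OF smooth_form_contract[OF Cons.prems]]
        by (simp add: flat_ext_deriv_Cons algebra_simps)
    qed
  next
    fix us v ws
    note U = smooth_formD(1)[OF \<eta>]
    show "flat_ext_deriv \<eta> x (us @ v # v # ws) = 0"
      using \<eta>
    proof (induction us arbitrary: \<eta>)
      case Nil
      have "flat_ext_deriv (\<lambda>y. contract v (contract v (\<eta> y))) x ws = flat_ext_deriv (\<lambda>y vs. 0) x ws"
        by (rule flat_ext_deriv_cong[OF U x]) (simp add: contract_twice[OF smooth_formD(2)[OF Nil]])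
      then show ?case
        by (simp add: flat_ext_deriv_Cons flat_ext_deriv_zero contract_def)
    next
      case (Cons u us)
      have "along \<eta> x u (us @ v # v # ws) = frechet_derivative (\<lambda>y. 0) (at x) u"
        by (rule arg_cong[where f = "\<lambda>f. f u"], rule frechet_derivative_cong_open[OF U x])
          (use alt_formsD_distinct[OF smooth_formD(2)[OF Cons.prems]] in simp)
      then show ?case
        using Cons.IH[OF smooth_form_contract[OF Cons.prems]] by (simp add: flat_ext_deriv_Cons)
    qed
  qed auto
  moreover have "smooth_on U (\<lambda>x. flat_ext_deriv \<eta> x vs)" for vs
    unfolding flat_ext_deriv_def
    by (intro smooth_on_sum smooth_on_mult smooth_on_const smooth_on_frechet_derivative smooth_formD[OF \<eta>])
  ultimately show ?thesis
    using \<eta> by (simp add: smooth_form_def)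
qed

lemma grade_flat_ext_deriv:
  assumes \<eta>: "smooth_form U \<eta>" and x: "x \<in> U"
  shows "grade (flat_ext_deriv \<eta> x) = - flat_ext_deriv (\<lambda>y. grade (\<eta> y)) x"
proof
  fix vs
  show "grade (flat_ext_deriv \<eta> x) vs = (- flat_ext_deriv (\<lambda>y. grade (\<eta> y)) x) vs"
  proof (cases vs)
    case (Cons v us)
    have "along (\<lambda>y. grade (\<eta> y)) x w (take i vs @ drop (Suc i) vs) =
        (-1) ^ length us * along \<eta> x w (take i vs @ drop (Suc i) vs)" if "i < length vs" for i w
    proof -
      have "length (take i vs @ drop (Suc i) vs) = length us" using that Cons by auto
      then have "((\<lambda>y. grade (\<eta> y) (take i vs @ drop (Suc i) vs)) has_derivative
          (\<lambda>w. (-1) ^ length us * along \<eta> x w (take i vs @ drop (Suc i) vs))) (at x)"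
        unfolding grade_def using \<eta> x by (auto intro!: derivative_eq_intros smooth_formD)
      then show ?thesis by (rule frechet_derivative_eqI)
    qed
    then have "(\<Sum>i<length vs. (-1) ^ i * along (\<lambda>y. grade (\<eta> y)) x (vs ! i) (take i vs @ drop (Suc i) vs)) =
        (\<Sum>i<length vs. (-1) ^ i * ((-1) ^ length us * along \<eta> x (vs ! i) (take i vs @ drop (Suc i) vs)))"
      by (intro sum.cong) auto
    also have "\<dots> = (-1) ^ length us * flat_ext_deriv \<eta> x vs"
      unfolding flat_ext_deriv_def sum_distrib_left by (intro sum.cong) auto
    finally show ?thesis
      using Cons by (simp add: grade_def[of "flat_ext_deriv \<eta> x"] flat_ext_deriv_def)
  qed (simp add: grade_def)
qed

lemma along_ext_prod:
  assumes \<eta>: "smooth_form U \<eta>" and \<zeta>: "smooth_form U \<zeta>" and x: "x \<in> U"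
  shows "along (\<lambda>y. ext_prod (\<eta> y) (\<zeta> y)) x v vs =
     ext_prod (along \<eta> x v) (\<zeta> x) vs + ext_prod (\<eta> x) (along \<zeta> x v) vs"
proof -
  have "((\<lambda>y. ext_prod (\<eta> y) (\<zeta> y) vs) has_derivative
     (\<lambda>v. ext_prod (along \<eta> x v) (\<zeta> x) vs + ext_prod (\<eta> x) (along \<zeta> x v) vs)) (at x)"
    unfolding ext_prod_def
    using x by (auto intro!: derivative_eq_intros smooth_formD[OF \<eta>] smooth_formD[OF \<zeta>]
        simp: sum.distrib algebra_simps)
  then show ?thesis by (rule frechet_derivative_eqI)
qed

text \<open>
  Both sides of the Leibniz rule satisfy the same recursion on the list of arguments, by Cartan's
  formula for constant vector fields and the derivation property of the contraction.
\<close>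

lemma flat_ext_deriv_ext_prod:
  assumes \<eta>: "smooth_form U \<eta>" and \<zeta>: "smooth_form U \<zeta>" and x: "x \<in> U"
  shows "flat_ext_deriv (\<lambda>y. ext_prod (\<eta> y) (\<zeta> y)) x vs =
     (ext_prod (flat_ext_deriv \<eta> x) (\<zeta> x) + ext_prod (grade (\<eta> x)) (flat_ext_deriv \<zeta> x)) vs"
  using \<eta> \<zeta>
proof (induction vs arbitrary: \<eta> \<zeta>)
  case (Cons v vs)
  have g: "smooth_form U (\<lambda>y. grade (\<eta> y))"
    using Cons.prems(1) unfolding smooth_form_def grade_def
    by (auto intro!: alt_grade[unfolded grade_def] smooth_on_mult smooth_on_const)
  note c = smooth_form_contract[OF Cons.prems(1), of v] smooth_form_contract[OF Cons.prems(2), of v]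
  note lin = flat_ext_deriv_linear[OF smooth_form_ext_prod[OF c(1) Cons.prems(2)]
      smooth_form_ext_prod[OF g c(2)] x, of 1 1 vs]
  have "flat_ext_deriv (\<lambda>y. contract v (ext_prod (\<eta> y) (\<zeta> y))) x vs =
      flat_ext_deriv (\<lambda>y. ext_prod (contract v (\<eta> y)) (\<zeta> y)) x vs +
      flat_ext_deriv (\<lambda>y. ext_prod (grade (\<eta> y)) (contract v (\<zeta> y))) x vs"
    using lin by (simp add: contract_ext_prod plus_fun_def)
  also have "\<dots> =
      (ext_prod (flat_ext_deriv (\<lambda>y. contract v (\<eta> y)) x) (\<zeta> x) +
       ext_prod (grade (contract v (\<eta> x))) (flat_ext_deriv \<zeta> x)) vs +
      (ext_prod (flat_ext_deriv (\<lambda>y. grade (\<eta> y)) x) (contract v (\<zeta> x)) +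
       ext_prod (\<eta> x) (flat_ext_deriv (\<lambda>y. contract v (\<zeta> y)) x)) vs"
    using Cons.IH[OF c(1) Cons.prems(2)] Cons.IH[OF g c(2)] by (simp add: grade_grade)
  finally show ?case
    by (simp only: flat_ext_deriv_Cons along_ext_prod[OF Cons.prems x] ext_prod_Cons plus_fun_apply
        contract_flat_ext_deriv contract_grade grade_grade ext_prod_uminus_left uminus_apply minus_apply
        ext_prod_diff_left ext_prod_diff_right grade_flat_ext_deriv[OF Cons.prems(1) x]
        algebra_simps)
qed simp

lemma smooth_form_affine:
  assumes \<eta>: "smooth_form U \<eta>" and L: "bounded_linear L"
  shows "smooth_form {y. L y + c \<in> U} (\<lambda>y vs. \<eta> (L y + c) (map L vs))"
  unfolding smooth_form_def
proof (intro conjI ballI allI)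
  have "continuous_on UNIV (\<lambda>y. L y + c)"
    by (intro continuous_intros bounded_linear.continuous_on[OF L])
  then show op: "open {y. L y + c \<in> U}"
    using open_vimage[OF smooth_formD(1)[OF \<eta>]] by (simp add: vimage_def)
  show "(\<lambda>vs. \<eta> (L y + c) (map L vs)) \<in> alt_forms UNIV" if "y \<in> {y. L y + c \<in> U}" for y
    using pull_alt_alt[OF bounded_linear.linear[OF L] smooth_formD(2)[OF \<eta>, of "L y + c"], of UNIV] that
    by (simp add: pull_alt_def[abs_def])
  show "smooth_on {y. L y + c \<in> U} (\<lambda>y. \<eta> (L y + c) (map L vs))" for vs
    by (rule smooth_on_compose_affine[OF smooth_formD(1)[OF \<eta>] op L _ smooth_formD(3)[OF \<eta>]]) simp
qed

lemma flat_ext_deriv_affine: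
  assumes \<eta>: "smooth_form U \<eta>" and L: "bounded_linear L" and x: "L x + c \<in> U"
  shows "flat_ext_deriv (\<lambda>y vs. \<eta> (L y + c) (map L vs)) x vs = flat_ext_deriv \<eta> (L x + c) (map L vs)"
proof -
  have "frechet_derivative (\<lambda>y. \<eta> (L y + c) us) (at x) v = along \<eta> (L x + c) (L v) us" for us v
  proof -
    have D: "((\<lambda>x. L x + c) has_derivative L) (at x)"
      using has_derivative_add_const[OF bounded_linear_imp_has_derivative[OF L]] by blast
    show ?thesis
      by (rule frechet_derivative_eqI[OF has_derivative_compose[OF D smooth_formD(4)[OF \<eta> x]]])
  qed
  then show ?thesis by (simp add: flat_ext_deriv_def take_map drop_map flip: map_append)
qed


section \<open>Tangential vanishing\<close>

text \<open>
  The part of a Lie derivative which comes from the action of the flow on the arguments: the sum of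
  the values of \<open>f\<close> with one argument replaced by its image under \<open>L\<close>.
\<close>

fun lie_term :: "('a list \<Rightarrow> real) \<Rightarrow> ('a \<Rightarrow> 'a) \<Rightarrow> 'a list \<Rightarrow> real" where
  "lie_term f L [] = 0"
| "lie_term f L (v # vs) = f (L v # vs) + lie_term (contract v f) L vs"

lemma lie_term_sum:
  "lie_term (\<lambda>vs. \<Sum>b\<in>B. c b * f b vs) L vs = (\<Sum>b\<in>B. c b * lie_term (f b) L vs)"
proof (induction vs arbitrary: f)
  case (Cons v vs)
  have "contract v (\<lambda>vs. \<Sum>b\<in>B. c b * f b vs) = (\<lambda>vs. \<Sum>b\<in>B. c b * contract v (f b) vs)"
    by (simp add: fun_eq_iff contract_def)
  then show ?case using Cons by (simp add: sum.distrib algebra_simps)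
qed simp

lemma alt_cons_euclidean:
  fixes v :: "'a::euclidean_space"
  assumes "f \<in> alt_forms UNIV"
  shows "f (v # vs) = (\<Sum>b\<in>Basis. (v \<bullet> b) * f (b # vs))"
proof -
  have "f ((\<Sum>b\<in>Basis. (v \<bullet> b) *\<^sub>R b) # vs) = (\<Sum>b\<in>Basis. f (((v \<bullet> b) *\<^sub>R b) # vs))"
    by (rule alt_cons_sum[OF assms]) auto
  then show ?thesis
    by (simp add: euclidean_representation alt_cons_scale[OF assms])
qed

text \<open>
  The product rule for \<open>E\<^sub>t (K\<^sub>t v\<^sub>1, K\<^sub>t v\<^sub>2, \<dots>)\<close>. The arguments are expanded in a basis one after the
  other, so that only coefficients are differentiated.
\<close>

lemma has_derivative_alt_map:
  fixes K :: "real \<Rightarrow> 'a::euclidean_space \<Rightarrow> 'a"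
  assumes K: "\<And>y. ((\<lambda>t. K t y) has_vector_derivative K' y) (at 0)" and K0: "\<And>y. K 0 y = y"
    and "\<And>t. E t \<in> alt_forms UNIV" and "\<And>vs. ((\<lambda>t. E t vs) has_real_derivative E' vs) (at 0)"
  shows "((\<lambda>t. E t (map (K t) vs)) has_real_derivative E' vs + lie_term (E 0) K' vs) (at 0)"
  using assms(3,4)
proof (induction vs arbitrary: E E')
  case (Cons v vs)
  have Kb: "((\<lambda>t. K t v \<bullet> b) has_real_derivative K' v \<bullet> b) (at 0)" for b
    using bounded_linear.has_vector_derivative[OF bounded_linear_inner_left K]
    by (simp add: has_real_derivative_iff_has_vector_derivative)
  have IH: "((\<lambda>t. E t (b # map (K t) vs)) has_real_derivative E' (b # vs) + lie_term (contract b (E 0)) K' vs) (at 0)" for b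
    using Cons.IH[of "\<lambda>t. contract b (E t)" "contract b E'"] Cons.prems
    by (simp add: contract_alt) (simp add: contract_def)
  have D: "((\<lambda>t. \<Sum>b\<in>Basis. (K t v \<bullet> b) * E t (b # map (K t) vs)) has_real_derivative
     (\<Sum>b\<in>Basis. (K' v \<bullet> b) * E 0 (b # map (K 0) vs) +
        (E' (b # vs) + lie_term (contract b (E 0)) K' vs) * (K 0 v \<bullet> b))) (at 0)"
    by (intro DERIV_sum DERIV_mult Kb IH)
  have "((\<lambda>t. \<Sum>b\<in>Basis. (v \<bullet> b) * E t (b # vs)) has_real_derivative
     (\<Sum>b\<in>Basis. (v \<bullet> b) * E' (b # vs))) (at 0)"
    by (intro DERIV_sum DERIV_cmult Cons.prems(2))
  moreover have "(\<lambda>t. \<Sum>b\<in>Basis. (v \<bullet> b) * E t (b # vs)) = (\<lambda>t. E t (v # vs))"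
    by (rule ext) (rule alt_cons_euclidean[OF Cons.prems(1), symmetric])
  ultimately have E': "(\<Sum>b\<in>Basis. (v \<bullet> b) * E' (b # vs)) = E' (v # vs)"
    using DERIV_unique[OF _ Cons.prems(2)[of "v # vs"]] by (simp only:)
  have "contract v (E 0) = (\<lambda>vs. \<Sum>b\<in>Basis. (v \<bullet> b) * contract b (E 0) vs)"
    using alt_cons_euclidean[OF Cons.prems(1)[of 0], of v] by (auto simp: fun_eq_iff contract_def)
  then have L: "lie_term (contract v (E 0)) K' vs = (\<Sum>b\<in>Basis. (v \<bullet> b) * lie_term (contract b (E 0)) K' vs)"
    by (simp add: lie_term_sum)
  have "map (K 0) vs = vs" by (simp add: K0 map_idI)
  then have "(\<Sum>b\<in>Basis. (K' v \<bullet> b) * E 0 (b # map (K 0) vs) +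
        (E' (b # vs) + lie_term (contract b (E 0)) K' vs) * (K 0 v \<bullet> b)) =
      E' (v # vs) + lie_term (E 0) K' (v # vs)"
    using alt_cons_euclidean[OF Cons.prems(1)[of 0], of "K' v" vs]
    by (simp add: K0 sum.distrib L flip: E') (simp add: algebra_simps sum.distrib)
  moreover have "(\<lambda>t. E t (map (K t) (v # vs))) =
      (\<lambda>t. \<Sum>b\<in>Basis. (K t v \<bullet> b) * E t (b # map (K t) vs))"
    unfolding list.map by (rule ext) (rule alt_cons_euclidean[OF Cons.prems(1)])
  ultimately show ?case using D by simp
qed simp

lemma smooth_form_contract_field:
  assumes \<eta>: "smooth_form U \<eta>" and V: "bounded_linear V"
  shows "smooth_form U (\<lambda>y. contract (V y + k) (\<eta> y))"
proof -
  have "smooth_on U (\<lambda>y. \<eta> y ((V y + k) # vs))" for vs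
  proof (rule smooth_on_cong[OF smooth_formD(1)[OF \<eta>]])
    show "smooth_on U (\<lambda>y. \<Sum>b\<in>Basis. ((V y + k) \<bullet> b) * \<eta> y (b # vs))"
      by (intro smooth_on_sum smooth_on_mult smooth_on_bounded_linear[where L = "\<lambda>y. y \<bullet> _"]
          bounded_linear_inner_left smooth_on_add smooth_on_const smooth_on_linear_map[OF _ V]
          smooth_formD[OF \<eta>])
    show "(\<Sum>b\<in>Basis. ((V y + k) \<bullet> b) * \<eta> y (b # vs)) = \<eta> y ((V y + k) # vs)" if "y \<in> U" for y
      using alt_cons_euclidean[OF smooth_formD(2)[OF \<eta> that], of "V y + k" vs] by simp
  qed
  moreover have "contract (V y + k) (\<eta> y) \<in> alt_forms UNIV" if "y \<in> U" for y
    using contract_alt[OF smooth_formD(2)[OF \<eta> that]] by simp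
  ultimately show ?thesis
    using smooth_formD(1)[OF \<eta>] unfolding smooth_form_def by (simp add: contract_def)
qed

text \<open>
  Compared with the constant field that has the same value at \<open>x\<close>, an affine field \<open>V\<close> is differentiated as
  well. Its derivative, which is inserted as the first argument, is brought to the
  place of the direction of differentiation, and the signs cancel.
\<close>

lemma flat_ext_deriv_contract_field:
  assumes \<eta>: "smooth_form U \<eta>" and V: "bounded_linear V" and x: "x \<in> U"
  shows "flat_ext_deriv (\<lambda>y. contract (V y + k) (\<eta> y)) x vs =
     flat_ext_deriv (\<lambda>y. contract (V x + k) (\<eta> y)) x vs + lie_term (\<eta> x) V vs"
  using \<eta>
proof (induction vs arbitrary: \<eta>)
  case (Cons w ws)
  note U = smooth_formD(1)[OF \<eta>]
  note c = smooth_form_contract[OF Cons.prems, of w]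
  have swap: "contract w (contract u (\<eta> y)) = - contract u (contract w (\<eta> y))" if "y \<in> U" for y u
    using alt_swap[OF smooth_formD(2)[OF Cons.prems that] subspace_UNIV, of u w]
    by (simp add: fun_eq_iff contract_def)
  have 1: "flat_ext_deriv (\<lambda>y. contract w (contract (V y + k) (\<eta> y))) x ws =
      - flat_ext_deriv (\<lambda>y. contract (V y + k) (contract w (\<eta> y))) x ws"
    unfolding flat_ext_deriv_uminus[OF smooth_form_contract_field[OF c V] x, symmetric]
    by (rule flat_ext_deriv_cong[OF U x]) (simp add: swap)
  have 2: "flat_ext_deriv (\<lambda>y. contract w (contract (V x + k) (\<eta> y))) x ws =
      - flat_ext_deriv (\<lambda>y. contract (V x + k) (contract w (\<eta> y))) x ws"
    unfolding flat_ext_deriv_uminus[OF smooth_form_contract[OF c] x, symmetric]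
    by (rule flat_ext_deriv_cong[OF U x]) (simp add: swap)
  \<comment> \<open>The field is expanded in the standard basis; the product rule then differentiates \<open>V\<close> as well.\<close>
  have 3: "along (\<lambda>y. contract (V y + k) (\<eta> y)) x w ws =
     along (\<lambda>y. contract (V x + k) (\<eta> y)) x w ws + \<eta> x (V w # ws)"
  proof -
    have "along (\<lambda>y. contract (V y + k) (\<eta> y)) x w ws =
       frechet_derivative (\<lambda>y. \<Sum>b\<in>Basis. ((V y + k) \<bullet> b) * \<eta> y (b # ws)) (at x) w"
      by (rule arg_cong[where f = "\<lambda>f. f w"], rule frechet_derivative_cong_open[OF U x])
        (use alt_cons_euclidean[OF smooth_formD(2)[OF Cons.prems], of _ _ ws] in \<open>simp add: contract_def\<close>)
    also have "\<dots> = (\<Sum>b\<in>Basis. ((V x + k) \<bullet> b) * along \<eta> x w (b # ws) + (V w \<bullet> b) * \<eta> x (b # ws))"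
    proof -
      have "((\<lambda>y. \<Sum>b\<in>Basis. ((V y + k) \<bullet> b) * \<eta> y (b # ws)) has_derivative
        (\<lambda>w. \<Sum>b\<in>Basis. ((V x + k) \<bullet> b) * along \<eta> x w (b # ws) + (V w \<bullet> b) * \<eta> x (b # ws))) (at x)"
        using bounded_linear_imp_has_derivative[OF V] x
        by (auto intro!: derivative_eq_intros smooth_formD[OF Cons.prems] simp: algebra_simps inner_add_left)
      then show ?thesis by (rule frechet_derivative_eqI)
    qed
    also have "\<dots> = (\<Sum>b\<in>Basis. ((V x + k) \<bullet> b) * along \<eta> x w (b # ws)) + \<eta> x (V w # ws)"
      using alt_cons_euclidean[OF smooth_formD(2)[OF Cons.prems x], of "V w" ws] by (simp add: sum.distrib)
    also have "(\<Sum>b\<in>Basis. ((V x + k) \<bullet> b) * along \<eta> x w (b # ws)) =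
       along (\<lambda>y. contract (V x + k) (\<eta> y)) x w ws"
    proof -
      have "along (\<lambda>y. contract (V x + k) (\<eta> y)) x w ws =
        frechet_derivative (\<lambda>y. \<Sum>b\<in>Basis. ((V x + k) \<bullet> b) * \<eta> y (b # ws)) (at x) w"
        by (rule arg_cong[where f = "\<lambda>f. f w"], rule frechet_derivative_cong_open[OF U x])
          (use alt_cons_euclidean[OF smooth_formD(2)[OF Cons.prems], of _ "V x + k" ws] in \<open>simp add: contract_def\<close>)
      also have "((\<lambda>y. \<Sum>b\<in>Basis. ((V x + k) \<bullet> b) * \<eta> y (b # ws)) has_derivative
        (\<lambda>w. \<Sum>b\<in>Basis. ((V x + k) \<bullet> b) * along \<eta> x w (b # ws))) (at x)"
        using x by (auto intro!: derivative_eq_intros smooth_formD[OF Cons.prems])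
      note frechet_derivative_eqI[OF this]
      finally show ?thesis by (rule sym)
    qed
    finally show ?thesis .
  qed
  show ?case
    using Cons.IH[OF c] by (simp add: flat_ext_deriv_Cons 1 2 3)
qed simp

lemma tangent_space_affine:
  assumes L: "bounded_linear L" and MN: "\<And>y. y \<in> M \<Longrightarrow> L y + c \<in> N" and v: "v \<in> tangent_space M x"
  shows "L v \<in> tangent_space N (L x + c)"
proof -
  from v obtain \<epsilon> \<gamma> where g: "\<epsilon> > 0" "smooth_on {-\<epsilon><..<\<epsilon>} \<gamma>" "\<gamma> ` {-\<epsilon><..<\<epsilon>} \<subseteq> M" "\<gamma> 0 = x"
    "(\<gamma> has_vector_derivative v) (at 0)"
    by (auto simp: tangent_space_def)
  have "smooth_on {-\<epsilon><..<\<epsilon>} (\<lambda>t. L (\<gamma> t) + c)"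
    by (rule smooth_on_add[OF _ smooth_on_bounded_linear[OF _ L g(2)] smooth_on_const]) simp_all
  moreover have "((\<lambda>t. L (\<gamma> t) + c) has_vector_derivative L v) (at 0)"
    using has_vector_derivative_add[OF bounded_linear.has_vector_derivative[OF L g(5)]
        has_vector_derivative_const, of c] by simp
  ultimately show ?thesis
    using g MN unfolding tangent_space_def
    by (intro CollectI exI[of _ \<epsilon>] conjI exI[of _ "\<lambda>t. L (\<gamma> t) + c"]) auto
qed

text \<open>
  A one-parameter family of affine maps \<open>\<Phi>\<^sub>t y = K t y + k t\<close> of \<open>M\<close> into itself, and its infinitesimal
  generator, the affine vector field \<open>K' y + k'\<close>, which is the velocity of the family at \<open>t = 0\<close>.
\<close>

definition affine_flow ::
  "'a::euclidean_space set \<Rightarrow> (real \<Rightarrow> 'a \<Rightarrow> 'a) \<Rightarrow> (real \<Rightarrow> 'a) \<Rightarrow> ('a \<Rightarrow> 'a) \<Rightarrow> 'a \<Rightarrow> bool" where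
  "affine_flow M K k K' k' \<longleftrightarrow>
     (\<forall>t. bounded_linear (K t)) \<and> bounded_linear K' \<and> (\<forall>y. K 0 y = y) \<and> k 0 = 0 \<and>
     (\<forall>t. \<forall>y\<in>M. K t y + k t \<in> M) \<and>
     (\<forall>y. ((\<lambda>t. K t y) has_vector_derivative K' y) (at 0)) \<and> (k has_vector_derivative k') (at 0) \<and>
     (\<forall>y\<in>M. K' y + k' \<in> tangent_space M y)"

definition affine_homogeneous :: "'a::euclidean_space set \<Rightarrow> bool" where
  "affine_homogeneous M \<longleftrightarrow>
     (\<forall>x\<in>M. subspace (tangent_space M x)) \<and>
     (\<forall>x\<in>M. \<forall>v\<in>tangent_space M x. \<exists>K k K' k'. affine_flow M K k K' k' \<and> K' x + k' = v)"

text \<open>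
  The infinitesimal generator of an affine flow \<open>\<Phi>\<^sub>t\<close> of \<open>M\<close> is an affine vector field \<open>V\<close>, and
  Cartan's formula \<open>\<iota>\<^sub>V d\<eta> = L\<^sub>V \<eta> - d \<iota>\<^sub>V \<eta>\<close> reduces the number of arguments: \<open>\<iota>\<^sub>V \<eta>\<close> vanishes on
  tangent vectors, and so does \<open>\<Phi>\<^sub>t\<^sup>* \<eta>\<close> for small \<open>t\<close>, hence also \<open>L\<^sub>V \<eta>\<close>.
\<close>

lemma flat_ext_deriv_tangential:
  assumes M: "affine_homogeneous M" and \<eta>: "smooth_form U \<eta>" and x: "x \<in> U" "x \<in> M"
    and van: "\<And>y vs. y \<in> U \<Longrightarrow> y \<in> M \<Longrightarrow> set vs \<subseteq> tangent_space M y \<Longrightarrow> \<eta> y vs = 0"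
    and vs: "set vs \<subseteq> tangent_space M x"
  shows "flat_ext_deriv \<eta> x vs = 0"
  using \<eta> van vs
proof (induction vs arbitrary: \<eta>)
  case (Cons v vs)
  have "v \<in> tangent_space M x" using Cons.prems by simp
  then obtain K k K' k' where flow: "affine_flow M K k K' k'" and v: "K' x + k' = v"
    using M x unfolding affine_homogeneous_def by blast
  have K: "\<And>t. bounded_linear (K t)" "bounded_linear K'" "\<And>y. K 0 y = y" "k 0 = 0"
      "\<And>t y. y \<in> M \<Longrightarrow> K t y + k t \<in> M"
    and dK: "\<And>y. ((\<lambda>t. K t y) has_vector_derivative K' y) (at 0)"
    and dk: "(k has_vector_derivative k') (at 0)"
    and tan: "\<And>y. y \<in> M \<Longrightarrow> K' y + k' \<in> tangent_space M y"
    using flow unfolding affine_flow_def by blast+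
  note U = smooth_formD(1)[OF \<eta>]
  have "flat_ext_deriv (\<lambda>y. contract (K' y + k') (\<eta> y)) x vs = 0"
  proof (rule Cons.IH)
    show "smooth_form U (\<lambda>y. contract (K' y + k') (\<eta> y))"
      by (rule smooth_form_contract_field[OF Cons.prems(1) K(2)])
    show "contract (K' y + k') (\<eta> y) ws = 0" if "y \<in> U" "y \<in> M" "set ws \<subseteq> tangent_space M y" for y ws
      using Cons.prems(2)[of y "(K' y + k') # ws"] tan[of y] that by (simp add: contract_def)
  qed (use Cons.prems in auto)
  then have 1: "flat_ext_deriv (\<lambda>y. contract v (\<eta> y)) x vs = - lie_term (\<eta> x) K' vs"
    using flat_ext_deriv_contract_field[OF Cons.prems(1) K(2) x(1), of k' vs] v by simp
  \<comment> \<open>\<open>E t (map (K t) vs)\<close> is \<open>\<Phi>\<^sub>t\<^sup>* \<eta>\<close> at \<open>x\<close>. It is \<open>0\<close> for all \<open>t\<close>, and its derivative at \<open>0\<close> is \<open>L\<^sub>V \<eta>\<close>.\<close>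
  define E where "E t = (if K t x + k t \<in> U then \<eta> (K t x + k t) else (\<lambda>vs. 0))" for t
  have \<Phi>: "((\<lambda>t. K t x + k t) has_vector_derivative v) (at 0)"
    using has_vector_derivative_add[OF dK[of x] dk] v by simp
  have \<Phi>0: "K 0 x + k 0 = x" by (simp add: K)
  have ev: "eventually (\<lambda>t. K t x + k t \<in> U) (nhds 0)"
  proof -
    have "isCont (\<lambda>t. K t x + k t) 0" using has_vector_derivative_continuous[OF \<Phi>] .
    then have "((\<lambda>t. K t x + k t) \<longlongrightarrow> x) (at 0)"
      using \<Phi>0 by (simp add: continuous_at)
    then have "eventually (\<lambda>t. K t x + k t \<in> U) (at 0)" using U x(1) by (auto simp: tendsto_def)
    then show ?thesis using \<Phi>0 x(1) by (simp add: eventually_nhds_conv_at)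
  qed
  have "((\<lambda>t. E t us) has_real_derivative along \<eta> x v us) (at 0)" for us
  proof -
    have "((\<lambda>y. \<eta> y us) has_derivative (\<lambda>v. along \<eta> x v us)) (at (K 0 x + k 0))"
      using smooth_formD(4)[OF Cons.prems(1) x(1)] \<Phi>0 by simp
    from has_derivative_compose[OF \<Phi>[unfolded has_vector_derivative_def] this]
    have "((\<lambda>t. \<eta> (K t x + k t) us) has_real_derivative along \<eta> x v us) (at 0)"
      unfolding has_field_derivative_def
      using linear_scale[OF has_derivative_linear[OF smooth_formD(4)[OF Cons.prems(1) x(1)]]]
      by (simp add: mult_commute_abs)
    moreover have ev': "eventually (\<lambda>t. E t us = \<eta> (K t x + k t) us) (nhds 0)"
      using ev by eventually_elim (simp add: E_def)
    ultimately show ?thesis using DERIV_cong_ev[OF refl ev' refl] by simp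
  qed
  moreover have "E t \<in> alt_forms UNIV" for t
    using smooth_formD(2)[OF Cons.prems(1)] by (simp add: E_def alt_zero)
  ultimately have "((\<lambda>t. E t (map (K t) vs)) has_real_derivative
      along \<eta> x v vs + lie_term (E 0) K' vs) (at 0)"
    by (intro has_derivative_alt_map dK K) auto
  moreover have "E t (map (K t) vs) = 0" for t
  proof (cases "K t x + k t \<in> U")
    case True
    have "set (map (K t) vs) \<subseteq> tangent_space M (K t x + k t)"
      using tangent_space_affine[of "K t" M "k t" M _ x, OF K(1) K(5)] Cons.prems(3) by auto
    then show ?thesis using Cons.prems(2)[OF True K(5)[OF x(2)]] by (simp add: E_def True)
  qed (simp add: E_def)
  ultimately have "along \<eta> x v vs + lie_term (E 0) K' vs = 0"
    using DERIV_unique[OF _ DERIV_const] by fastforce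
  moreover have "E 0 = \<eta> x" using \<Phi>0 x by (simp add: E_def)
  ultimately show ?case using 1 by (simp add: flat_ext_deriv_Cons)
qed simp


section \<open>The exterior derivative on a submanifold\<close>

lemma local_extension_iff:
  "local_extension M \<omega> x U \<eta> \<longleftrightarrow> smooth_form U \<eta> \<and> x \<in> U \<and>
     (\<forall>y\<in>U \<inter> M. \<forall>vs. set vs \<subseteq> tangent_space M y \<longrightarrow> \<eta> y vs = \<omega> y vs)"
  by (auto simp: local_extension_def smooth_form_def)

text \<open>
  The difference of two extensions vanishes on tangent vectors, and hence so does its derivative.
\<close>

lemma ext_deriv_eq:
  assumes M: "affine_homogeneous M" and ext: "local_extension M \<omega> x U \<eta>"
    and y: "y \<in> U" "y \<in> M" and vs: "set vs \<subseteq> tangent_space M y"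
  shows "ext_deriv M \<omega> y vs = flat_ext_deriv \<eta> y vs"
proof -
  let ?\<zeta> = "SOME \<eta>. \<exists>U. local_extension M \<omega> y U \<eta>"
  have \<eta>: "local_extension M \<omega> y U \<eta>" using ext y by (simp add: local_extension_def)
  then obtain V where \<zeta>: "local_extension M \<omega> y V ?\<zeta>"
    using someI[of "\<lambda>\<eta>. \<exists>U. local_extension M \<omega> y U \<eta>"] by blast
  have sf: "smooth_form (U \<inter> V) \<eta>" "smooth_form (U \<inter> V) ?\<zeta>"
    using \<eta> \<zeta> smooth_formD(1) unfolding local_extension_iff by (meson smooth_form_subset open_Int inf_le1 inf_le2)+
  have yUV: "y \<in> U \<inter> V" using \<eta> \<zeta> by (simp add: local_extension_def)
  have "flat_ext_deriv (\<lambda>z us. 1 * ?\<zeta> z us + (-1) * \<eta> z us) y vs = 0"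
  proof (rule flat_ext_deriv_tangential[OF M smooth_form_linear[OF sf(2,1)] yUV y(2) _ vs])
    fix z us assume "z \<in> U \<inter> V" "z \<in> M" "set us \<subseteq> tangent_space M z"
    then show "1 * ?\<zeta> z us + (-1) * \<eta> z us = 0"
      using \<eta> \<zeta> by (simp add: local_extension_iff)
  qed
  then have "flat_ext_deriv ?\<zeta> y vs = flat_ext_deriv \<eta> y vs"
    unfolding flat_ext_deriv_linear[OF sf(2,1) yUV] by simp
  then show ?thesis using y vs by (simp add: ext_deriv_def)
qed

lemma forms_off: "\<omega> \<in> forms M \<Longrightarrow> \<not> (x \<in> M \<and> set vs \<subseteq> tangent_space M x) \<Longrightarrow> \<omega> x vs = 0"
  unfolding forms_def using alt_formsD_off by fastforce

lemma forms_alt: "\<omega> \<in> forms M \<Longrightarrow> x \<in> M \<Longrightarrow> \<omega> x \<in> alt_forms (tangent_space M x)"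
  unfolding forms_def by simp

lemma forms_extension: "\<omega> \<in> forms M \<Longrightarrow> x \<in> M \<Longrightarrow> \<exists>U \<eta>. local_extension M \<omega> x U \<eta>"
  unfolding forms_def by simp

lemma ext_deriv_off: "\<not> (x \<in> M \<and> set vs \<subseteq> tangent_space M x) \<Longrightarrow> ext_deriv M \<omega> x vs = 0"
  unfolding ext_deriv_def by auto

lemma forms_common_extension:
  assumes "\<omega> \<in> forms M" "\<zeta> \<in> forms M" "x \<in> M"
  obtains U \<eta> \<xi> where "local_extension M \<omega> x U \<eta>" "local_extension M \<zeta> x U \<xi>"
proof -
  from assms obtain U \<eta> V \<xi> where *: "local_extension M \<omega> x U \<eta>" "local_extension M \<zeta> x V \<xi>"
    using forms_extension by metis
  then have "open (U \<inter> V)" by (auto simp: local_extension_def)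
  then have "local_extension M \<omega> x (U \<inter> V) \<eta>" "local_extension M \<zeta> x (U \<inter> V) \<xi>"
    using * smooth_form_subset[of U _ "U \<inter> V"] smooth_form_subset[of V _ "U \<inter> V"]
    unfolding local_extension_iff by auto
  then show thesis by (rule that)
qed

lemma ext_deriv_linear:
  assumes M: "affine_homogeneous M" and f: "\<omega> \<in> forms M" "\<zeta> \<in> forms M"
  shows "ext_deriv M (\<lambda>x vs. a * \<omega> x vs + b * \<zeta> x vs) x vs = a * ext_deriv M \<omega> x vs + b * ext_deriv M \<zeta> x vs"
proof (cases "x \<in> M \<and> set vs \<subseteq> tangent_space M x")
  case True
  then obtain U \<eta> \<xi> where *: "local_extension M \<omega> x U \<eta>" "local_extension M \<zeta> x U \<xi>"
    using forms_common_extension[OF f] by blast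
  then have "local_extension M (\<lambda>x vs. a * \<omega> x vs + b * \<zeta> x vs) x U (\<lambda>x vs. a * \<eta> x vs + b * \<xi> x vs)"
    by (simp add: local_extension_iff smooth_form_linear)
  from ext_deriv_eq[OF M this, of x vs] ext_deriv_eq[OF M *(1), of x vs] ext_deriv_eq[OF M *(2), of x vs]
  show ?thesis
    using * True flat_ext_deriv_linear[of U \<eta> \<xi> x a b vs] by (simp add: local_extension_iff)
qed (simp add: ext_deriv_off)

lemma ext_deriv_restrict:
  assumes M: "affine_homogeneous M" and ext: "local_extension M \<omega> x U \<eta>" and y: "y \<in> U" "y \<in> M"
  shows "ext_deriv M \<omega> y = pull_alt (tangent_space M y) id (flat_ext_deriv \<eta> y)"
  using ext_deriv_eq[OF M ext y] y by (auto simp: fun_eq_iff pull_alt_def ext_deriv_def)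

lemma ext_deriv_forms:
  assumes M: "affine_homogeneous M" and \<omega>: "\<omega> \<in> forms M"
  shows "ext_deriv M \<omega> \<in> forms M"
proof -
  have "ext_deriv M \<omega> x \<in> alt_forms (tangent_space M x) \<and> (\<exists>U \<eta>. local_extension M (ext_deriv M \<omega>) x U \<eta>)"
    if x: "x \<in> M" for x
  proof -
    obtain U \<eta> where *: "local_extension M \<omega> x U \<eta>" using forms_extension[OF \<omega> x] by blast
    then have sf: "smooth_form U (flat_ext_deriv \<eta>)" and xU: "x \<in> U"
      by (auto simp: local_extension_iff smooth_form_flat_ext_deriv)
    have "local_extension M (ext_deriv M \<omega>) x U (flat_ext_deriv \<eta>)"
      using sf xU ext_deriv_eq[OF M *] by (auto simp: local_extension_iff)
    moreover have "subspace (tangent_space M x)" using M x by (simp add: affine_homogeneous_def)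
    then have "ext_deriv M \<omega> x \<in> alt_forms (tangent_space M x)"
      unfolding ext_deriv_restrict[OF M * xU x]
      by (intro pull_alt_alt[OF _ smooth_formD(2)[OF sf xU]]) (auto simp: linear_id)
    ultimately show ?thesis by blast
  qed
  then show ?thesis
    unfolding forms_def using ext_deriv_off[of _ M] by (auto simp: fun_eq_iff)
qed

lemma ext_deriv_wedge:
  assumes M: "affine_homogeneous M" and f: "\<omega> \<in> forms M" "\<zeta> \<in> forms M"
  shows "ext_deriv M (\<omega> \<and>\<^sub>\<real> \<zeta>) = ext_deriv M \<omega> \<and>\<^sub>\<real> \<zeta> + (\<lambda>x. grade (\<omega> x)) \<and>\<^sub>\<real> ext_deriv M \<zeta>"
proof (intro ext)
  fix x vs
  show "ext_deriv M (\<omega> \<and>\<^sub>\<real> \<zeta>) x vs =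
    (ext_deriv M \<omega> \<and>\<^sub>\<real> \<zeta> + (\<lambda>x. grade (\<omega> x)) \<and>\<^sub>\<real> ext_deriv M \<zeta>) x vs"
  proof (cases "x \<in> M")
    case x: True
    let ?T = "tangent_space M x"
    have T: "subspace ?T" using M x by (simp add: affine_homogeneous_def)
    from x obtain U \<eta> \<xi> where *: "local_extension M \<omega> x U \<eta>" "local_extension M \<zeta> x U \<xi>"
      using forms_common_extension[OF f] by blast
    then have sf: "smooth_form U \<eta>" "smooth_form U \<xi>" and xU: "x \<in> U" by (auto simp: local_extension_iff)
    have r: "pull_alt (tangent_space M y) id (\<eta> y) = \<omega> y"
        "pull_alt (tangent_space M y) id (\<xi> y) = \<zeta> y" if "y \<in> U" "y \<in> M" for y
      using * that forms_off[OF f(1), of y] forms_off[OF f(2), of y]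
      by (auto simp: fun_eq_iff pull_alt_def local_extension_iff)
    have p: "pull_alt (tangent_space M y) id (ext_prod (\<eta> y) (\<xi> y)) = (\<omega> \<and>\<^sub>\<real> \<zeta>) y"
      if "y \<in> U" "y \<in> M" for y
      by (simp add: ext_prod_pull_alt r that wedge_eq_ext_prod)
    have "ext_prod (\<eta> y) (\<xi> y) us = (\<omega> \<and>\<^sub>\<real> \<zeta>) y us"
      if "y \<in> U" "y \<in> M" "set us \<subseteq> tangent_space M y" for y us
      using fun_cong[OF p[OF that(1,2)], of us] that(3) by (simp add: pull_alt_def)
    then have "local_extension M (\<omega> \<and>\<^sub>\<real> \<zeta>) x U (\<lambda>y. ext_prod (\<eta> y) (\<xi> y))"
      unfolding local_extension_iff using smooth_form_ext_prod[OF sf] xU by blast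
    from ext_deriv_restrict[OF M this xU x]
    have "ext_deriv M (\<omega> \<and>\<^sub>\<real> \<zeta>) x = pull_alt ?T id (flat_ext_deriv (\<lambda>y. ext_prod (\<eta> y) (\<xi> y)) x)" .
    also have "\<dots> = pull_alt ?T id (ext_prod (flat_ext_deriv \<eta> x) (\<xi> x)) +
       pull_alt ?T id (ext_prod (grade (\<eta> x)) (flat_ext_deriv \<xi> x))"
      by (simp add: fun_eq_iff pull_alt_def flat_ext_deriv_ext_prod[OF sf xU])
    also have "pull_alt ?T id (grade (\<eta> x)) = grade (\<omega> x)"
      unfolding r(1)[OF xU x, symmetric] by (simp add: fun_eq_iff pull_alt_def grade_def)
    ultimately show ?thesis
      using ext_deriv_restrict[OF M *(1) xU x] ext_deriv_restrict[OF M *(2) xU x]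
      by (simp add: ext_prod_pull_alt r[OF xU x] wedge_eq_ext_prod)
  next
    case False
    have *: "ext_deriv M \<kappa> x = (\<lambda>vs. 0)" for \<kappa> using False by (simp add: fun_eq_iff ext_deriv_off)
    show ?thesis by (simp add: * wedge_eq_ext_prod ext_prod_zero_left ext_prod_zero_right)
  qed
qed

lemma pullback_affine:
  assumes L: "bounded_linear L"
  shows "pullback N (\<lambda>y. L y + c) \<omega> x = (if x \<in> N then pull_alt (tangent_space N x) L (\<omega> (L x + c)) else (\<lambda>vs. 0))"
proof -
  have "((\<lambda>y. L y + c) has_derivative L) (at x)"
    using has_derivative_add_const[OF bounded_linear_imp_has_derivative[OF L]] by blast
  from frechet_derivative_at[OF this] have "frechet_derivative (\<lambda>y. L y + c) (at x) = L" by (rule sym)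
  then show ?thesis by (intro ext) (simp add: pullback_def pull_alt_def)
qed

lemma local_extension_pullback:
  assumes L: "bounded_linear L" and NM: "\<And>y. y \<in> N \<Longrightarrow> L y + c \<in> M"
    and x: "x \<in> N" and ext: "local_extension M \<omega> (L x + c) U \<eta>"
  shows "local_extension N (pullback N (\<lambda>y. L y + c) \<omega>) x {y. L y + c \<in> U} (\<lambda>y vs. \<eta> (L y + c) (map L vs))"
proof -
  have "set (map L vs) \<subseteq> tangent_space M (L y + c)" if "y \<in> N" "set vs \<subseteq> tangent_space N y" for y vs
    using tangent_space_affine[of L N c M _ y] L NM that by auto
  then show ?thesis
    using ext NM smooth_form_affine[OF _ L]
    unfolding local_extension_iff by (auto simp: pullback_affine[OF L] pull_alt_def)
qed

lemma ext_deriv_pullback: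
  assumes N: "affine_homogeneous N" and M: "affine_homogeneous M" and L: "bounded_linear L"
    and NM: "\<And>y. y \<in> N \<Longrightarrow> L y + c \<in> M" and \<omega>: "\<omega> \<in> forms M"
  shows "ext_deriv N (pullback N (\<lambda>y. L y + c) \<omega>) = pullback N (\<lambda>y. L y + c) (ext_deriv M \<omega>)"
proof (intro ext)
  fix x vs
  show "ext_deriv N (pullback N (\<lambda>y. L y + c) \<omega>) x vs = pullback N (\<lambda>y. L y + c) (ext_deriv M \<omega>) x vs"
  proof (cases "x \<in> N \<and> set vs \<subseteq> tangent_space N x")
    case True
    then have x: "x \<in> N" by simp
    obtain U \<eta> where ext: "local_extension M \<omega> (L x + c) U \<eta>"
      using forms_extension[OF \<omega> NM[OF x]] by blast
    then have sf: "smooth_form U \<eta>" and xU: "L x + c \<in> U" by (auto simp: local_extension_iff)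
    have t: "set (map L vs) \<subseteq> tangent_space M (L x + c)"
      using tangent_space_affine[of L N c M _ x] L NM True by auto
    show ?thesis
      using ext_deriv_eq[OF N local_extension_pullback[OF L NM x ext], of x vs] True xU
        ext_deriv_eq[OF M ext xU NM[OF x] t] flat_ext_deriv_affine[OF sf L xU, of vs]
      by (simp add: pullback_affine[OF L] pull_alt_def)
  next
    case False
    then show ?thesis by (auto simp: ext_deriv_off pullback_affine[OF L] pull_alt_def)
  qed
qed

lemma smooth_on_alt_map:
  fixes \<kappa> :: "'a::real_normed_vector \<Rightarrow> 'b::real_vector \<Rightarrow> 'c::euclidean_space"
  assumes U: "open U" and \<kappa>: "\<And>w. smooth_on U (\<lambda>y. \<kappa> y w)" and f: "f \<in> alt_forms UNIV"
  shows "smooth_on U (\<lambda>y. f (map (\<kappa> y) vs))"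
  using f
proof (induction vs arbitrary: f)
  case (Cons v vs)
  have "smooth_on U (\<lambda>y. \<Sum>b\<in>Basis. (\<kappa> y v \<bullet> b) * contract b f (map (\<kappa> y) vs))"
    by (intro smooth_on_sum smooth_on_mult U Cons.IH contract_alt Cons.prems UNIV_I
        smooth_on_bounded_linear[OF U bounded_linear_inner_left \<kappa>])
  moreover have "(\<lambda>y. \<Sum>b\<in>Basis. (\<kappa> y v \<bullet> b) * contract b f (map (\<kappa> y) vs)) =
      (\<lambda>y. f (map (\<kappa> y) (v # vs)))"
    unfolding list.map contract_def by (rule ext) (rule alt_cons_euclidean[OF Cons.prems, symmetric])
  ultimately show ?case by simp
qed (simp add: smooth_on_const)

text \<open>
  A form which is obtained from one alternating form by a smooth family of linear identifications
  of the tangent spaces is smooth: precomposition with a linear projection onto \<open>T\<close> extends the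
  alternating form to the whole space.
\<close>

lemma forms_of_frame:
  fixes f :: "'b::euclidean_space list \<Rightarrow> real"
  assumes off: "\<And>x vs. \<not> (x \<in> M \<and> set vs \<subseteq> tangent_space M x) \<Longrightarrow> \<omega> x vs = 0"
    and f: "f \<in> alt_forms T" and T: "subspace T" and M: "\<And>x. x \<in> M \<Longrightarrow> subspace (tangent_space M x)"
    and frame: "\<And>x. x \<in> M \<Longrightarrow> \<exists>U \<kappa>. open U \<and> x \<in> U \<and> (\<forall>y\<in>U. linear (\<kappa> y)) \<and>
      (\<forall>w. smooth_on U (\<lambda>y. \<kappa> y w)) \<and> (\<forall>y\<in>U \<inter> M. \<kappa> y ` tangent_space M y \<subseteq> T) \<and>
      (\<forall>y\<in>U \<inter> M. \<forall>vs. set vs \<subseteq> tangent_space M y \<longrightarrow> \<omega> y vs = f (map (\<kappa> y) vs))"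
  shows "\<omega> \<in> forms M"
proof -
  obtain P :: "'b \<Rightarrow> 'b" where P: "linear P" "range P \<subseteq> T" "\<And>v. v \<in> T \<Longrightarrow> P v = v"
    using linear_exists_left_inverse_on[OF linear_id T, unfolded id_def, OF inj_on_id2] by blast
  define f' where "f' = pull_alt UNIV P f"
  have f': "f' \<in> alt_forms UNIV"
    unfolding f'_def by (rule pull_alt_alt[OF P(1) f]) (use P in auto)
  have f'T: "f' vs = f vs" if "set vs \<subseteq> T" for vs
    using that P(3) by (simp add: f'_def pull_alt_def map_idI subset_eq)
  have "\<omega> x \<in> alt_forms (tangent_space M x) \<and> (\<exists>U \<eta>. local_extension M \<omega> x U \<eta>)" if x: "x \<in> M" for x
  proof -
    from frame[OF x] obtain U \<kappa> where U: "open U" "x \<in> U" and *: "\<forall>y\<in>U. linear (\<kappa> y)"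
      "\<forall>w. smooth_on U (\<lambda>y. \<kappa> y w)" "\<forall>y\<in>U \<inter> M. \<kappa> y ` tangent_space M y \<subseteq> T"
      "\<forall>y\<in>U \<inter> M. \<forall>vs. set vs \<subseteq> tangent_space M y \<longrightarrow> \<omega> y vs = f (map (\<kappa> y) vs)"
      by - (elim exE conjE, rule that)
    have \<kappa>: "\<And>y. y \<in> U \<Longrightarrow> linear (\<kappa> y)" "\<And>w. smooth_on U (\<lambda>y. \<kappa> y w)"
      "\<And>y. y \<in> U \<Longrightarrow> y \<in> M \<Longrightarrow> \<kappa> y ` tangent_space M y \<subseteq> T"
      "\<And>y vs. y \<in> U \<Longrightarrow> y \<in> M \<Longrightarrow> set vs \<subseteq> tangent_space M y \<Longrightarrow> \<omega> y vs = f (map (\<kappa> y) vs)"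
      using * by simp_all
    have "\<omega> x = pull_alt (tangent_space M x) (\<kappa> x) f"
      by (rule ext) (simp add: pull_alt_def \<kappa>(4)[OF U(2) x] off)
    then have "\<omega> x \<in> alt_forms (tangent_space M x)"
      using pull_alt_alt[OF \<kappa>(1)[OF U(2)] f \<kappa>(3)[OF U(2) x] M[OF x]] by simp
    moreover have "local_extension M \<omega> x U (\<lambda>y vs. f' (map (\<kappa> y) vs))"
      unfolding local_extension_iff smooth_form_def
    proof (intro conjI ballI allI impI U)
      show "(\<lambda>vs. f' (map (\<kappa> y) vs)) \<in> alt_forms UNIV" if "y \<in> U" for y
        using pull_alt_alt[OF \<kappa>(1)[OF that] f', of UNIV] by (simp add: pull_alt_def[abs_def])
      show "smooth_on U (\<lambda>y. f' (map (\<kappa> y) vs))" for vs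
        by (rule smooth_on_alt_map[OF U(1) \<kappa>(2) f'])
      fix y vs assume y: "y \<in> U \<inter> M" and vs: "set vs \<subseteq> tangent_space M y"
      then have "set (map (\<kappa> y) vs) \<subseteq> T" using \<kappa>(3)[of y] by auto
      then show "f' (map (\<kappa> y) vs) = \<omega> y vs" using f'T \<kappa>(4)[of y vs] y vs by simp
    qed
    ultimately show ?thesis by blast
  qed
  then show ?thesis unfolding forms_def using off by (auto simp: fun_eq_iff)
qed


section \<open>Octonions in coordinates\<close>

lemma distinct_8: "distinct [0, 1, 2, 3, 4, 5, 6, 7 :: 8]"
  by (simp add: bit0.Rep_inject_sym bit0.Rep_numeral bit0.Rep_0 bit0.Rep_1)

lemma UNIV_8: "(UNIV :: 8 set) = {0, 1, 2, 3, 4, 5, 6, 7}"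
proof -
  have "card {0, 1, 2, 3, 4, 5, 6, 7 :: 8} = CARD(8)"
    using distinct_card[OF distinct_8] by simp
  then show ?thesis using card_subset_eq[OF finite_class.finite_UNIV subset_UNIV] by metis
qed

lemma sum_8: "sum f (UNIV :: 8 set) = f 0 + f 1 + f 2 + f 3 + f 4 + f 5 + f 6 + f 7"
  using distinct_8 unfolding UNIV_8 by (simp add: add.assoc)

lemma forall_8: "(\<forall>a::8. P a) \<longleftrightarrow> P 0 \<and> P 1 \<and> P 2 \<and> P 3 \<and> P 4 \<and> P 5 \<and> P 6 \<and> P 7"
proof -
  have "(\<forall>a::8. P a) \<longleftrightarrow> (\<forall>a\<in>(UNIV :: 8 set). P a)" by simp
  then show ?thesis unfolding UNIV_8 by simp
qed

text \<open>
  The products of the imaginary basis elements, tabulated once so that the coordinates of an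
  octonionic product can be read off.
\<close>

lemma oct_cyclic_table:
  "oct_cyclic 1 2 k \<longleftrightarrow> k = 4" "oct_cyclic 1 3 k \<longleftrightarrow> k = 7" "oct_cyclic 1 4 k \<longleftrightarrow> False"
  "oct_cyclic 1 5 k \<longleftrightarrow> k = 6" "oct_cyclic 1 6 k \<longleftrightarrow> False" "oct_cyclic 1 7 k \<longleftrightarrow> False"
  "oct_cyclic 2 1 k \<longleftrightarrow> False" "oct_cyclic 2 3 k \<longleftrightarrow> k = 5" "oct_cyclic 2 4 k \<longleftrightarrow> k = 1"
  "oct_cyclic 2 5 k \<longleftrightarrow> False" "oct_cyclic 2 6 k \<longleftrightarrow> k = 7" "oct_cyclic 2 7 k \<longleftrightarrow> False"
  "oct_cyclic 3 1 k \<longleftrightarrow> False" "oct_cyclic 3 2 k \<longleftrightarrow> False" "oct_cyclic 3 4 k \<longleftrightarrow> k = 6"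
  "oct_cyclic 3 5 k \<longleftrightarrow> k = 2" "oct_cyclic 3 6 k \<longleftrightarrow> False" "oct_cyclic 3 7 k \<longleftrightarrow> k = 1"
  "oct_cyclic 4 1 k \<longleftrightarrow> k = 2" "oct_cyclic 4 2 k \<longleftrightarrow> False" "oct_cyclic 4 3 k \<longleftrightarrow> False"
  "oct_cyclic 4 5 k \<longleftrightarrow> k = 7" "oct_cyclic 4 6 k \<longleftrightarrow> k = 3" "oct_cyclic 4 7 k \<longleftrightarrow> False"
  "oct_cyclic 5 1 k \<longleftrightarrow> False" "oct_cyclic 5 2 k \<longleftrightarrow> k = 3" "oct_cyclic 5 3 k \<longleftrightarrow> False"
  "oct_cyclic 5 4 k \<longleftrightarrow> False" "oct_cyclic 5 6 k \<longleftrightarrow> k = 1" "oct_cyclic 5 7 k \<longleftrightarrow> k = 4"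
  "oct_cyclic 6 1 k \<longleftrightarrow> k = 5" "oct_cyclic 6 2 k \<longleftrightarrow> False" "oct_cyclic 6 3 k \<longleftrightarrow> k = 4"
  "oct_cyclic 6 4 k \<longleftrightarrow> False" "oct_cyclic 6 5 k \<longleftrightarrow> False" "oct_cyclic 6 7 k \<longleftrightarrow> k = 2"
  "oct_cyclic 7 1 k \<longleftrightarrow> k = 3" "oct_cyclic 7 2 k \<longleftrightarrow> k = 6" "oct_cyclic 7 3 k \<longleftrightarrow> False"
  "oct_cyclic 7 4 k \<longleftrightarrow> k = 5" "oct_cyclic 7 5 k \<longleftrightarrow> False" "oct_cyclic 7 6 k \<longleftrightarrow> False"
  by (simp_all add: oct_cyclic_def oct_triples_def)

lemma oct_mult_nth:
  "oct_mult x y $ 0 = x$0*y$0 - x$1*y$1 - x$2*y$2 - x$3*y$3 - x$4*y$4 - x$5*y$5 - x$6*y$6 - x$7*y$7"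
  "oct_mult x y $ 1 = x$0*y$1 + x$1*y$0 + x$2*y$4 - x$4*y$2 + x$3*y$7 - x$7*y$3 + x$5*y$6 - x$6*y$5"
  "oct_mult x y $ 2 = x$0*y$2 + x$2*y$0 + x$3*y$5 - x$5*y$3 + x$4*y$1 - x$1*y$4 + x$6*y$7 - x$7*y$6"
  "oct_mult x y $ 3 = x$0*y$3 + x$3*y$0 + x$4*y$6 - x$6*y$4 + x$5*y$2 - x$2*y$5 + x$7*y$1 - x$1*y$7"
  "oct_mult x y $ 4 = x$0*y$4 + x$4*y$0 + x$5*y$7 - x$7*y$5 + x$6*y$3 - x$3*y$6 + x$1*y$2 - x$2*y$1"
  "oct_mult x y $ 5 = x$0*y$5 + x$5*y$0 + x$6*y$1 - x$1*y$6 + x$7*y$4 - x$4*y$7 + x$2*y$3 - x$3*y$2"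
  "oct_mult x y $ 6 = x$0*y$6 + x$6*y$0 + x$7*y$2 - x$2*y$7 + x$1*y$5 - x$5*y$1 + x$3*y$4 - x$4*y$3"
  "oct_mult x y $ 7 = x$0*y$7 + x$7*y$0 + x$1*y$3 - x$3*y$1 + x$2*y$6 - x$6*y$2 + x$4*y$5 - x$5*y$4"
  by (simp_all add: oct_mult_def sum_8 oct_coeff_def oct_cyclic_table)


lemma oct_eqI:
  fixes x y :: octonion
  assumes "x$0 = y$0" "x$1 = y$1" "x$2 = y$2" "x$3 = y$3" "x$4 = y$4" "x$5 = y$5" "x$6 = y$6" "x$7 = y$7"
  shows "x = y"
  using assms by (simp add: vec_eq_iff forall_8)

lemma oct_inner: "x \<bullet> y = x$0*y$0 + x$1*y$1 + x$2*y$2 + x$3*y$3 + x$4*y$4 + x$5*y$5 + x$6*y$6 + x$7*y$7"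
  for x y :: octonion
  by (simp add: inner_vec_def sum_8)

lemma oct_cnj_nth:
  "oct_cnj x $ 0 = x$0" "oct_cnj x $ 1 = - x$1" "oct_cnj x $ 2 = - x$2" "oct_cnj x $ 3 = - x$3"
  "oct_cnj x $ 4 = - x$4" "oct_cnj x $ 5 = - x$5" "oct_cnj x $ 6 = - x$6" "oct_cnj x $ 7 = - x$7"
  using distinct_8 by (simp_all add: oct_cnj_def)

lemma bilinear_oct_mult: "bilinear oct_mult"
  unfolding bilinear_def linear_iff
  by (simp add: oct_mult_def vec_eq_iff sum.distrib sum_distrib_left algebra_simps)

lemma bounded_bilinear_oct_mult: "bounded_bilinear oct_mult"
  using bilinear_oct_mult by (simp add: bilinear_conv_bounded_bilinear)

interpretation oct_mult: bounded_bilinear oct_mult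
  by (rule bounded_bilinear_oct_mult)

lemma linear_oct_cnj: "linear oct_cnj"
  by (auto simp: linear_iff oct_cnj_def vec_eq_iff)

lemma bounded_linear_oct_cnj: "bounded_linear oct_cnj"
  using linear_oct_cnj by (simp add: linear_conv_bounded_linear)

lemmas oct_cnj_linear = linear_add[OF linear_oct_cnj] linear_diff[OF linear_oct_cnj]
  linear_scale[OF linear_oct_cnj] linear_neg[OF linear_oct_cnj] linear_0[OF linear_oct_cnj]

lemma oct_cnj_cnj [simp]: "oct_cnj (oct_cnj x) = x"
  by (simp add: oct_cnj_def vec_eq_iff)

lemma oct_mult_one [simp]: "oct_mult (oct_basis 0) x = x" "oct_mult x (oct_basis 0) = x"
proof -
  have b: "oct_basis 0 $ a = (if a = 0 then 1 else 0)" for a :: 8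
    by (simp add: axis_def)
  have n: "1 \<noteq> (0::8)" "2 \<noteq> (0::8)" "3 \<noteq> (0::8)" "4 \<noteq> (0::8)" "5 \<noteq> (0::8)" "6 \<noteq> (0::8)" "7 \<noteq> (0::8)"
    using distinct_8 by auto
  show "oct_mult (oct_basis 0) x = x" "oct_mult x (oct_basis 0) = x"
    by (rule oct_eqI; simp add: oct_mult_nth b n)+
qed

lemma oct_cnj_inner: "oct_cnj x \<bullet> oct_cnj y = x \<bullet> y"
  by (simp add: oct_inner oct_cnj_nth)

lemma oct_mult_cnj_right: "oct_mult (oct_mult y x) (oct_cnj x) = (x \<bullet> x) *\<^sub>R y"
  by (rule oct_eqI; simp only: oct_mult_nth oct_cnj_nth oct_inner vector_scaleR_component real_scaleR_def; algebra)

lemma oct_mult_inner_right: "oct_mult y x \<bullet> z = y \<bullet> oct_mult z (oct_cnj x)"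
  by (simp only: oct_mult_nth oct_cnj_nth oct_inner; algebra)

lemma oct_mult_inner_left: "oct_mult x y \<bullet> z = y \<bullet> oct_mult (oct_cnj x) z"
  by (simp only: oct_mult_nth oct_cnj_nth oct_inner; algebra)

text \<open>
  Alternativity in the form of an infinitesimal triality: left multiplication by \<open>w\<close>, applied to a
  product \<open>y x\<close>, acts by \<open>L\<^sub>w + R\<^sub>w\<close> on \<open>y\<close> and by \<open>-L\<^sub>w\<close> on \<open>x\<close>.
\<close>

lemma oct_left_triality:
  "oct_mult w (oct_mult y x) = oct_mult (oct_mult w y + oct_mult y w) x - oct_mult y (oct_mult w x)"
  by (rule oct_eqI; simp only: oct_mult_nth vector_add_component vector_minus_component; algebra)


text \<open>
  The companion of the previous identity for \<open>L\<^sub>w + R\<^sub>w\<close>, a linearised Moufang identity.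
\<close>

lemma oct_middle_triality:
  "oct_mult w (oct_mult y x) + oct_mult (oct_mult y x) w = oct_mult (oct_mult w y) x + oct_mult y (oct_mult x w)"
  by (rule oct_eqI; simp only: oct_mult_nth vector_add_component; algebra)

lemma oct_cnj_mult: "oct_cnj (oct_mult x y) = oct_mult (oct_cnj y) (oct_cnj x)"
  by (rule oct_eqI; simp only: oct_mult_nth oct_cnj_nth; algebra)

lemma oct_mult_cnj_polar:
  "oct_mult (oct_mult y x) (oct_cnj z) + oct_mult (oct_mult y z) (oct_cnj x) = (2 * (x \<bullet> z)) *\<^sub>R y"
proof -
  have "oct_mult (oct_mult y (x + z)) (oct_cnj (x + z)) = ((x + z) \<bullet> (x + z)) *\<^sub>R y"
    by (rule oct_mult_cnj_right)
  then show ?thesis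
    using oct_mult_cnj_right[of y x] oct_mult_cnj_right[of y z]
    by (simp add: oct_cnj_linear oct_mult.add_left oct_mult.add_right inner_add_left inner_add_right
        inner_commute algebra_simps scaleR_2)
qed

lemma oct_basis_nth: "oct_basis a $ b = (if a = b then 1 else 0)"
  by (simp add: axis_def)

text \<open>
  Two basis elements generate a copy of the quaternions, and their associator with a
  basis element outside of this copy does not vanish. The three pairs exclude all imaginary
  coordinates.
\<close>

lemma oct_left_nucleus:
  assumes "\<And>x y. oct_mult (oct_mult c y) x = oct_mult c (oct_mult y x)"
  shows "c = (c $ 0) *\<^sub>R oct_basis 0"
proof -
  note e = oct_mult_nth oct_basis_nth
  have 1: "oct_mult (oct_mult c (oct_basis 1)) (oct_basis 2) $ k = oct_mult c (oct_mult (oct_basis 1) (oct_basis 2)) $ k"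
    and 2: "oct_mult (oct_mult c (oct_basis 2)) (oct_basis 3) $ k = oct_mult c (oct_mult (oct_basis 2) (oct_basis 3)) $ k"
    and 3: "oct_mult (oct_mult c (oct_basis 3)) (oct_basis 4) $ k = oct_mult c (oct_mult (oct_basis 3) (oct_basis 4)) $ k" for k
    using assms by simp_all
  have "c $ 3 = 0" "c $ 5 = 0" "c $ 6 = 0" "c $ 7 = 0"
    using 1[of 5] 1[of 3] 1[of 7] 1[of 6] by (simp_all add: e)
  moreover have "c $ 1 = 0" "c $ 4 = 0"
    using 2[of 1] 2[of 4] 2[of 6] 2[of 7] by (simp_all add: e)
  moreover have "c $ 2 = 0"
    using 3[of 1] 3[of 2] 3[of 5] 3[of 7] by (simp_all add: e)
  ultimately show ?thesis by (intro oct_eqI) (simp_all add: oct_basis_nth)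
qed

lemma oct_right_nucleus:
  assumes "\<And>x y. oct_mult (oct_mult y x) c = oct_mult y (oct_mult x c)"
  shows "c = (c $ 0) *\<^sub>R oct_basis 0"
proof -
  have "oct_mult (oct_mult (oct_cnj c) y) x = oct_mult (oct_cnj c) (oct_mult y x)" for x y
  proof -
    have "oct_cnj (oct_mult (oct_mult (oct_cnj x) (oct_cnj y)) c) =
        oct_cnj (oct_mult (oct_cnj x) (oct_mult (oct_cnj y) c))"
      using assms by simp
    then show ?thesis by (simp add: oct_cnj_mult)
  qed
  then have "oct_cnj c = (oct_cnj c $ 0) *\<^sub>R oct_basis 0" by (rule oct_left_nucleus)
  then have "oct_cnj (oct_cnj c) = oct_cnj ((oct_cnj c $ 0) *\<^sub>R oct_basis 0)" by simp
  moreover have "oct_cnj (oct_basis 0) = oct_basis 0"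
    by (rule oct_eqI) (simp_all add: oct_cnj_nth oct_basis_nth)
  ultimately show ?thesis by (simp add: oct_cnj_linear oct_cnj_nth)
qed


section \<open>The octonionic plane and its matrices\<close>

(* Indices in 2 \<times> 8 and parameters in \<real> \<times> \<O> are treated as single variables. *)
declare split_paired_Ex [simp del] split_paired_All [simp del]

lemma forall_2_8: "(\<forall>i::2 \<times> 8. P i) \<longleftrightarrow> (\<forall>a. P (0, a)) \<and> (\<forall>a. P (1, a))"
proof -
  have "k = 0 \<or> k = 1" for k :: 2 using exhaust_2[of k] by auto
  then show ?thesis by (metis prod.exhaust)
qed

lemma sum_2_8: "sum f (UNIV :: (2 \<times> 8) set) = (\<Sum>a\<in>UNIV. f (0, a)) + (\<Sum>a\<in>UNIV. f (1, a))"
proof -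
  have "k \<in> {0, 1}" for k :: 2 using exhaust_2[of k] by auto
  then have "(UNIV :: 2 set) = {0, 1}" by blast
  then have "sum f (UNIV :: (2 \<times> 8) set) = (\<Sum>k\<in>{0, 1}. \<Sum>a\<in>UNIV. f (k, a))"
    by (simp add: sum.cartesian_product' flip: UNIV_Times_UNIV)
  then show ?thesis by simp
qed

lemma oct_comp_pair [simp]: "oct_comp 0 (oct_pair a b) = a" "oct_comp 1 (oct_pair a b) = b"
  by (simp_all add: oct_comp_def oct_pair_def vec_eq_iff)

lemma oct_pair_comp [simp]: "oct_pair (oct_comp 0 y) (oct_comp 1 y) = y"
  by (simp add: oct_comp_def oct_pair_def vec_eq_iff forall_2_8)

lemma oct_pair_nth [simp]: "oct_pair a b $ (0, i) = a $ i" "oct_pair a b $ (1, i) = b $ i"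
  by (simp_all add: oct_pair_def)

lemma oct_pair_eq_iff [simp]: "oct_pair a b = oct_pair c d \<longleftrightarrow> a = c \<and> b = d"
  by (metis oct_comp_pair)

lemma oct_pair_zero [simp]: "oct_pair 0 0 = 0"
  by (simp add: vec_eq_iff forall_2_8)

lemma oct_pair_linear:
  "oct_pair a b + oct_pair c d = oct_pair (a + c) (b + d)"
  "oct_pair a b - oct_pair c d = oct_pair (a - c) (b - d)"
  "- oct_pair a b = oct_pair (- a) (- b)"
  "r *\<^sub>R oct_pair a b = oct_pair (r *\<^sub>R a) (r *\<^sub>R b)"
  by (simp_all add: vec_eq_iff forall_2_8)

lemma oct_comp_linear:
  "oct_comp k (x + y) = oct_comp k x + oct_comp k y" "oct_comp k (x - y) = oct_comp k x - oct_comp k y"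
  "oct_comp k (- x) = - oct_comp k x" "oct_comp k (r *\<^sub>R x) = r *\<^sub>R oct_comp k x"
  by (simp_all add: vec_eq_iff oct_comp_def)

lemma oct_pair_inner: "oct_pair a b \<bullet> oct_pair c d = a \<bullet> c + b \<bullet> d"
  by (simp add: inner_vec_def sum_2_8)

lemma oct_pair_exists: "\<exists>a b. y = oct_pair a b"
  by (metis oct_pair_comp)

lemma oct_matrix_eqI:
  fixes A B :: oct_matrix
  assumes "\<And>a b. A *v oct_pair a b = B *v oct_pair a b"
  shows "A = B"
  using assms oct_pair_exists unfolding matrix_eq by metis

lemma bounded_bilinear_matrix_mult: "bounded_bilinear ((**) :: oct_matrix \<Rightarrow> oct_matrix \<Rightarrow> oct_matrix)"
proof -
  have "bilinear ((**) :: oct_matrix \<Rightarrow> oct_matrix \<Rightarrow> oct_matrix)"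
    unfolding bilinear_def linear_iff
    by (simp add: matrix_matrix_mult_def vec_eq_iff sum.distrib sum_distrib_left algebra_simps)
  then show ?thesis by (simp add: bilinear_conv_bounded_bilinear)
qed

interpretation mm: bounded_bilinear "(**) :: oct_matrix \<Rightarrow> oct_matrix \<Rightarrow> oct_matrix"
  by (rule bounded_bilinear_matrix_mult)

lemma bounded_bilinear_matrix_vector: "bounded_bilinear ((*v) :: oct_matrix \<Rightarrow> oct_plane \<Rightarrow> oct_plane)"
proof -
  have "bilinear ((*v) :: oct_matrix \<Rightarrow> oct_plane \<Rightarrow> oct_plane)"
    unfolding bilinear_def linear_iff
    by (simp add: matrix_vector_mult_def vec_eq_iff sum.distrib sum_distrib_left algebra_simps)
  then show ?thesis by (simp add: bilinear_conv_bounded_bilinear)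
qed

interpretation mv: bounded_bilinear "(*v) :: oct_matrix \<Rightarrow> oct_plane \<Rightarrow> oct_plane"
  by (rule bounded_bilinear_matrix_vector)

lemma linear_transpose: "linear (transpose :: oct_matrix \<Rightarrow> oct_matrix)"
  by (simp add: linear_iff transpose_def vec_eq_iff)

lemmas transpose_linear = linear_add[OF linear_transpose] linear_diff[OF linear_transpose]
  linear_scale[OF linear_transpose] linear_neg[OF linear_transpose] linear_0[OF linear_transpose]
  linear_sum[OF linear_transpose]

lemma transpose_inner: "(transpose A *v x) \<bullet> y = x \<bullet> (A *v y)" for A :: oct_matrix
  by (simp add: dot_lmul_matrix)

lemma transpose_eqI:
  fixes A B :: oct_matrix
  assumes "\<And>x y. (A *v x) \<bullet> y = x \<bullet> (B *v y)"
  shows "transpose B = A"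
proof -
  have "(transpose B *v x) \<bullet> y = (A *v x) \<bullet> y" for x y
    by (simp only: transpose_inner assms)
  then show ?thesis unfolding matrix_eq by (metis vector_eq_rdot)
qed


section \<open>The Clifford relations\<close>

text \<open>
  The generators of the group span a nine-dimensional space of symmetric matrices, indexed linearly
  by \<open>\<real> \<times> \<O>\<close>, whose elements satisfy the relations of a Clifford algebra.
\<close>

definition spin9_gen :: "real \<times> octonion \<Rightarrow> oct_matrix" where
  "spin9_gen p = spin9_generator (fst p) (snd p)"

lemma linear_matrix_apply: "linear f \<Longrightarrow> matrix f *v x = f x" for f :: "oct_plane \<Rightarrow> oct_plane"
  using fun_cong[OF matrix_vector_mul(2)[of f]] by simp

lemma spin9_gen_apply:
  "spin9_gen p *v oct_pair a b =
     oct_pair (fst p *\<^sub>R a + oct_mult b (snd p)) (oct_mult a (oct_cnj (snd p)) - fst p *\<^sub>R b)"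
proof -
  have "linear (\<lambda>y. oct_pair (fst p *\<^sub>R oct_comp 0 y + oct_mult (oct_comp 1 y) (snd p))
              (oct_mult (oct_comp 0 y) (oct_cnj (snd p)) - fst p *\<^sub>R oct_comp 1 y))"
    by (rule linearI) (simp_all add: oct_comp_linear oct_pair_linear oct_mult.add_left oct_mult.scaleR_left
        algebra_simps)
  then show ?thesis
    unfolding spin9_gen_def spin9_generator_def by (simp add: linear_matrix_apply)
qed

lemma linear_spin9_gen: "linear spin9_gen"
  by (rule linearI; rule oct_matrix_eqI)
    (simp_all add: mv.add_left mv.scaleR_left spin9_gen_apply oct_pair_linear oct_cnj_linear
      oct_mult.add_right oct_mult.scaleR_right algebra_simps)

lemmas spin9_gen_linear = linear_add[OF linear_spin9_gen] linear_diff[OF linear_spin9_gen]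
  linear_scale[OF linear_spin9_gen] linear_neg[OF linear_spin9_gen] linear_0[OF linear_spin9_gen]
  linear_sum[OF linear_spin9_gen]

lemma transpose_spin9_gen [simp]: "transpose (spin9_gen p) = spin9_gen p"
proof (rule transpose_eqI)
  fix x y :: oct_plane
  obtain a b c d where "x = oct_pair a b" "y = oct_pair c d" using oct_pair_exists by metis
  then show "(spin9_gen p *v x) \<bullet> y = x \<bullet> (spin9_gen p *v y)"
    using oct_mult_inner_right[of b "snd p" c] oct_mult_inner_right[of a "oct_cnj (snd p)" d]
    by (simp add: spin9_gen_apply oct_pair_inner inner_add_left inner_add_right inner_diff_left
        inner_diff_right)
qed

lemma clifford: "spin9_gen p ** spin9_gen q + spin9_gen q ** spin9_gen p = (2 * (p \<bullet> q)) *\<^sub>R mat 1"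
proof (rule oct_matrix_eqI)
  fix a b
  obtain r x s y where pq: "p = (r, x)" "q = (s, y)" by fastforce
  have 1: "oct_mult (oct_mult a (oct_cnj y)) x + oct_mult (oct_mult a (oct_cnj x)) y = (2 * (x \<bullet> y)) *\<^sub>R a"
    using oct_mult_cnj_polar[of a "oct_cnj y" "oct_cnj x"] by (simp add: oct_cnj_inner inner_commute)
  have 2: "oct_mult (oct_mult b y) (oct_cnj x) + oct_mult (oct_mult b x) (oct_cnj y) = (2 * (x \<bullet> y)) *\<^sub>R b"
    using oct_mult_cnj_polar[of b y x] by (simp add: inner_commute)
  have "(spin9_gen p ** spin9_gen q + spin9_gen q ** spin9_gen p) *v oct_pair a b =
    oct_pair ((r * s) *\<^sub>R a + (s * r) *\<^sub>R a + (oct_mult (oct_mult a (oct_cnj y)) x + oct_mult (oct_mult a (oct_cnj x)) y))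
       ((oct_mult (oct_mult b y) (oct_cnj x) + oct_mult (oct_mult b x) (oct_cnj y)) + ((r * s) *\<^sub>R b + (s * r) *\<^sub>R b))"
    by (simp add: pq mv.add_left spin9_gen_apply oct_pair_linear oct_mult.add_left oct_mult.diff_left
        oct_mult.scaleR_left scaleR_add_right scaleR_diff_right algebra_simps
        flip: matrix_vector_mul_assoc)
  then show "(spin9_gen p ** spin9_gen q + spin9_gen q ** spin9_gen p) *v oct_pair a b =
      ((2 * (p \<bullet> q)) *\<^sub>R mat 1) *v oct_pair a b"
    unfolding 1 2 by (simp add: pq mv.scaleR_left oct_pair_linear mult.commute[of s r] distrib_left flip: scaleR_add_left)
qed

lemma spin9_gen_square: "spin9_gen p ** spin9_gen p = (p \<bullet> p) *\<^sub>R mat 1"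
  using clifford[of p p] by (simp add: scaleR_2[symmetric] flip: scaleR_scaleR)

text \<open>
  Commuting with the generator \<open>(1, 0)\<close> makes the matrix block diagonal, and commuting with \<open>(0, 1)\<close> makes
  its two blocks equal. Since the block commutes with all right multiplications, it is left
  multiplication by an octonion of the left nucleus, which is real.
\<close>

lemma commutant_spin9_gen:
  assumes "\<And>p. A ** spin9_gen p = spin9_gen p ** A"
  shows "\<exists>c. A = c *\<^sub>R mat 1"
proof -
  have comm: "A *v (spin9_gen p *v x) = spin9_gen p *v (A *v x)" for p x
    using assms by (simp add: matrix_vector_mul_assoc)
  define B where "B a = oct_comp 0 (A *v oct_pair a 0)" for a
  have A0: "A *v oct_pair a 0 = oct_pair (B a) 0" for a
  proof -
    obtain v where v: "A *v oct_pair a 0 = oct_pair (B a) v"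
      unfolding B_def by (metis oct_pair_comp)
    have "oct_pair (B a) v = oct_pair (B a) (- v)"
      using comm[of "(1, 0)" "oct_pair a 0"] v by (simp add: spin9_gen_apply oct_cnj_linear oct_mult.zero_right)
    then have "v + v = 0" by (simp add: eq_neg_iff_add_eq_0)
    then have "2 *\<^sub>R v = 0" by (simp only: scaleR_2)
    then show ?thesis using v by simp
  qed
  have A1': "A *v oct_pair 0 (oct_mult a (oct_cnj x)) = oct_pair 0 (oct_mult (B a) (oct_cnj x))" for a x
    using comm[of "(0, x)" "oct_pair a 0"] A0 by (simp add: spin9_gen_apply oct_mult.zero_left)
  have c0: "oct_cnj (oct_basis 0) = oct_basis 0"
    by (rule oct_eqI) (simp_all add: oct_cnj_nth oct_basis_nth)
  have A1: "A *v oct_pair 0 a = oct_pair 0 (B a)" for a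
    using A1'[of a "oct_basis 0"] by (simp add: c0)
  have B: "B (oct_mult a x) = oct_mult (B a) x" for a x
    using A1'[of a "oct_cnj x"] A1 by simp
  define c where "c = B (oct_basis 0)"
  have Bc: "B a = oct_mult c a" for a using B[of "oct_basis 0" a] by (simp add: c_def)
  have "c = (c $ 0) *\<^sub>R oct_basis 0"
    by (rule oct_left_nucleus) (use B Bc in auto)
  then obtain r where r: "c = r *\<^sub>R oct_basis 0" by blast
  have "A = r *\<^sub>R mat 1"
  proof (rule oct_matrix_eqI)
    fix a b
    have "oct_pair a b = oct_pair a 0 + oct_pair 0 b" by (simp add: oct_pair_linear)
    then have "A *v oct_pair a b = A *v oct_pair a 0 + A *v oct_pair 0 b" by (simp only: mv.add_right)
    also have "\<dots> = oct_pair (r *\<^sub>R a) (r *\<^sub>R b)"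
      unfolding A0 A1 Bc r oct_mult.scaleR_left oct_mult_one by (simp add: oct_pair_linear)
    also have "\<dots> = (r *\<^sub>R mat 1) *v oct_pair a b" by (simp add: mv.scaleR_left oct_pair_linear)
    finally show "A *v oct_pair a b = (r *\<^sub>R mat 1) *v oct_pair a b" .
  qed
  then show ?thesis by blast
qed


section \<open>The Lie algebra\<close>

definition bracket :: "oct_matrix \<Rightarrow> oct_matrix \<Rightarrow> oct_matrix" where
  "bracket A B = A ** B - B ** A"

text \<open>
  The skew matrices which normalize the space of the generators. These linear conditions hold for
  the velocities of curves in the group by differentiation; that each such matrix is a velocity is
  proved below.
\<close>

definition spin9_algebra :: "oct_matrix set" where
  "spin9_algebra = {A. transpose A = - A \<and> (\<forall>p. \<exists>q. bracket A (spin9_gen p) = spin9_gen q)}"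

lemma bracket_linear:
  "bracket (A + A') B = bracket A B + bracket A' B" "bracket (r *\<^sub>R A) B = r *\<^sub>R bracket A B"
  "bracket (A - A') B = bracket A B - bracket A' B"
  "bracket A (B + B') = bracket A B + bracket A B'" "bracket A (r *\<^sub>R B) = r *\<^sub>R bracket A B"
  by (simp_all add: bracket_def mm.add_left mm.add_right mm.scaleR_left mm.scaleR_right mm.diff_left mm.diff_right
      scaleR_diff_right)

lemma subspace_spin9_algebra: "subspace spin9_algebra"
proof (rule subspaceI)
  have "bracket 0 (spin9_gen p) = spin9_gen 0" for p
    by (simp add: bracket_def spin9_gen_linear mm.zero_left mm.zero_right)
  then show "0 \<in> spin9_algebra" unfolding spin9_algebra_def by (auto simp: transpose_linear)
next
  fix A B assume A: "A \<in> spin9_algebra" and B: "B \<in> spin9_algebra"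
  have "\<exists>q. bracket (A + B) (spin9_gen p) = spin9_gen q" for p
  proof -
    obtain q q' where "bracket A (spin9_gen p) = spin9_gen q" "bracket B (spin9_gen p) = spin9_gen q'"
      using A B unfolding spin9_algebra_def by blast
    then have "bracket (A + B) (spin9_gen p) = spin9_gen (q + q')"
      by (simp add: bracket_linear spin9_gen_linear)
    then show ?thesis by blast
  qed
  then show "A + B \<in> spin9_algebra" using A B by (simp add: spin9_algebra_def transpose_linear)
next
  fix A and r :: real assume A: "A \<in> spin9_algebra"
  have "\<exists>q. bracket (r *\<^sub>R A) (spin9_gen p) = spin9_gen q" for p
  proof -
    obtain q where "bracket A (spin9_gen p) = spin9_gen q"
      using A unfolding spin9_algebra_def by blast
    then have "bracket (r *\<^sub>R A) (spin9_gen p) = spin9_gen (r *\<^sub>R q)"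
      by (simp add: bracket_linear spin9_gen_linear)
    then show ?thesis by blast
  qed
  then show "r *\<^sub>R A \<in> spin9_algebra" using A by (simp add: spin9_algebra_def transpose_linear)
qed

lemma bracket_spin9_algebra:
  assumes A: "A \<in> spin9_algebra" and B: "B \<in> spin9_algebra"
  shows "bracket A B \<in> spin9_algebra"
proof -
  have "transpose (bracket A B) = - bracket A B"
    using A B by (simp add: spin9_algebra_def bracket_def transpose_linear matrix_transpose_mul
        mm.minus_left mm.minus_right)
  moreover have "\<exists>q. bracket (bracket A B) (spin9_gen p) = spin9_gen q" for p
  proof -
    obtain q r where q: "bracket A (spin9_gen p) = spin9_gen q" and r: "bracket B (spin9_gen p) = spin9_gen r"
      using A B unfolding spin9_algebra_def by blast
    obtain q' r' where q': "bracket B (spin9_gen q) = spin9_gen q'" and r': "bracket A (spin9_gen r) = spin9_gen r'"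
      using A B unfolding spin9_algebra_def by blast
    have "bracket (bracket A B) (spin9_gen p) = bracket A (bracket B (spin9_gen p)) - bracket B (bracket A (spin9_gen p))"
      by (simp add: bracket_def mm.diff_left mm.diff_right matrix_mul_assoc)
    also have "\<dots> = spin9_gen (r' - q')" by (simp add: q r q' r' spin9_gen_linear)
    finally show ?thesis by blast
  qed
  ultimately show ?thesis by (simp add: spin9_algebra_def)
qed

lemma bracket_gen_gen:
  "bracket (spin9_gen u ** spin9_gen v) (spin9_gen p) =
     spin9_gen ((2 * (v \<bullet> p)) *\<^sub>R u - (2 * (u \<bullet> p)) *\<^sub>R v)"
proof -
  have "bracket (spin9_gen u ** spin9_gen v) (spin9_gen p) =
      spin9_gen u ** (spin9_gen v ** spin9_gen p + spin9_gen p ** spin9_gen v) -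
      (spin9_gen u ** spin9_gen p + spin9_gen p ** spin9_gen u) ** spin9_gen v"
    by (simp add: bracket_def mm.add_left mm.add_right matrix_mul_assoc)
  then show ?thesis
    by (simp add: clifford mm.scaleR_left mm.scaleR_right spin9_gen_linear)
qed

lemma gen_gen_spin9_algebra:
  assumes "u \<bullet> v = 0"
  shows "spin9_gen u ** spin9_gen v \<in> spin9_algebra"
proof -
  have "spin9_gen v ** spin9_gen u = - (spin9_gen u ** spin9_gen v)"
    using clifford[of u v] assms by (simp add: eq_neg_iff_add_eq_0 add.commute)
  then show ?thesis
    unfolding spin9_algebra_def by (auto simp: bracket_gen_gen matrix_transpose_mul)
qed

text \<open>
  An element of the Lie algebra acts on the nine-dimensional space by a skew map \<open>B\<close>. The element
  \<open>(1/4) \<Sum>\<^sub>b B b \<cdot> b\<close> of the Clifford algebra acts in the same way, and the difference of both is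
  skew and commutes with all generators.
\<close>

lemma spin9_algebra_clifford:
  assumes A: "A \<in> spin9_algebra"
  shows "\<exists>B. (\<forall>b. B b \<bullet> b = 0) \<and> A = (\<Sum>b\<in>Basis. (1/4) *\<^sub>R (spin9_gen (B b) ** spin9_gen b))"
proof -
  obtain B where B: "\<And>p. bracket A (spin9_gen p) = spin9_gen (B p)"
    using A unfolding spin9_algebra_def mem_Collect_eq by metis
  have skew: "B p \<bullet> q + B q \<bullet> p = 0" for p q
  proof -
    have "(2 * (B p \<bullet> q)) *\<^sub>R mat 1 + (2 * (B q \<bullet> p)) *\<^sub>R (mat 1 :: oct_matrix) =
      bracket A (spin9_gen p) ** spin9_gen q + spin9_gen q ** bracket A (spin9_gen p) +
      (bracket A (spin9_gen q) ** spin9_gen p + spin9_gen p ** bracket A (spin9_gen q))"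
      by (simp only: B clifford)
    also have "\<dots> = bracket A (spin9_gen p ** spin9_gen q + spin9_gen q ** spin9_gen p)"
      by (simp add: bracket_def mm.add_left mm.add_right mm.diff_left mm.diff_right matrix_mul_assoc)
    also have "\<dots> = 0" unfolding clifford bracket_linear by (simp add: bracket_def)
    finally have "(2 * (B p \<bullet> q + B q \<bullet> p)) *\<^sub>R (mat 1 :: oct_matrix) = 0"
      by (simp add: algebra_simps)
    moreover have "(mat 1 :: oct_matrix) \<noteq> 0" by (simp add: mat_def vec_eq_iff)
    ultimately show ?thesis by simp
  qed
  have skew': "B p \<bullet> q = - (B q \<bullet> p)" for p q using skew[of p q] by simp
  have diag: "B b \<bullet> b = 0" for b using skew[of b b] by simp
  \<comment> \<open>The bracket of \<open>M u M v\<close> with \<open>M p\<close> is \<open>2 (v \<bullet> p) M u - 2 (u \<bullet> p) M v\<close>. Since \<open>B\<close> is skew, both terms have the same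
      sum over \<open>u = B b\<close>, \<open>v = b\<close>, which makes up for the factor \<open>1/4\<close>.\<close>
  define C where "C = (\<Sum>b\<in>Basis. (1/4) *\<^sub>R (spin9_gen (B b) ** spin9_gen b))"
  have C: "C \<in> spin9_algebra"
    unfolding C_def using diag
    by (intro subspace_sum subspace_scale subspace_spin9_algebra gen_gen_spin9_algebra) auto
  have br: "bracket (sum f S) D = (\<Sum>b\<in>S. bracket (f b) D)" for f :: "real \<times> octonion \<Rightarrow> oct_matrix" and S D
    by (simp add: bracket_def mm.sum_left mm.sum_right sum_subtractf)
  have "bracket C (spin9_gen p) = spin9_gen (B p)" for p
  proof -
    have "bracket C (spin9_gen p) = spin9_gen (\<Sum>b\<in>Basis. (1/2) *\<^sub>R ((b \<bullet> p) *\<^sub>R B b - (B b \<bullet> p) *\<^sub>R b))"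
      unfolding C_def br bracket_linear bracket_gen_gen spin9_gen_linear(6)
      by (simp add: scaleR_diff_right spin9_gen_linear)
    also have "(\<Sum>b\<in>Basis. (1/2) *\<^sub>R ((b \<bullet> p) *\<^sub>R B b - (B b \<bullet> p) *\<^sub>R b)) = B p"
    proof -
      have eq: "B p \<bullet> q = (\<Sum>b\<in>Basis. (1/2) *\<^sub>R ((b \<bullet> p) *\<^sub>R B b - (B b \<bullet> p) *\<^sub>R b)) \<bullet> q" for q
      proof -
        have 1: "(\<Sum>b\<in>Basis. (b \<bullet> p) * (B b \<bullet> q)) = B p \<bullet> q"
        proof -
          have "(\<Sum>b\<in>Basis. (b \<bullet> p) * (B b \<bullet> q)) = - (\<Sum>b\<in>Basis. (B q \<bullet> b) * (p \<bullet> b))"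
            unfolding sum_negf[symmetric]
          proof (rule sum.cong)
            show "(b \<bullet> p) * (B b \<bullet> q) = - ((B q \<bullet> b) * (p \<bullet> b))" for b
              unfolding skew'[of b q] by (simp add: inner_commute)
          qed simp
          also have "\<dots> = - (B q \<bullet> p)" by (simp only: euclidean_inner[of "B q" p])
          finally show ?thesis using skew[of p q] by simp
        qed
        have 2: "(\<Sum>b\<in>Basis. (B b \<bullet> p) * (b \<bullet> q)) = - (B p \<bullet> q)"
        proof -
          have "(\<Sum>b\<in>Basis. (B b \<bullet> p) * (b \<bullet> q)) = - (\<Sum>b\<in>Basis. (B p \<bullet> b) * (q \<bullet> b))"
            unfolding sum_negf[symmetric]
          proof (rule sum.cong)
            show "(B b \<bullet> p) * (b \<bullet> q) = - ((B p \<bullet> b) * (q \<bullet> b))" for b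
              unfolding skew'[of b p] by (simp add: inner_commute)
          qed simp
          also have "\<dots> = - (B p \<bullet> q)" by (simp only: euclidean_inner[of "B p" q])
          finally show ?thesis .
        qed
        have "(\<Sum>b\<in>Basis. (1/2) *\<^sub>R ((b \<bullet> p) *\<^sub>R B b - (B b \<bullet> p) *\<^sub>R b)) \<bullet> q =
            (\<Sum>b\<in>Basis. 1/2 * ((b \<bullet> p) * (B b \<bullet> q) - (B b \<bullet> p) * (b \<bullet> q)))"
          by (simp only: inner_sum_left inner_scaleR_left inner_diff_left)
        also have "\<dots> = 1/2 * ((\<Sum>b\<in>Basis. (b \<bullet> p) * (B b \<bullet> q)) - (\<Sum>b\<in>Basis. (B b \<bullet> p) * (b \<bullet> q)))"
          by (simp only: sum_subtractf flip: sum_distrib_left)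
        finally show ?thesis unfolding 1 2 by simp
      qed
      show ?thesis by (rule vector_eq_rdot[THEN iffD1, OF allI], rule eq[symmetric])
    qed
    finally show ?thesis .
  qed
  then have "(A - C) ** spin9_gen p = spin9_gen p ** (A - C)" for p
    using B[of p] bracket_linear(3)[of A C "spin9_gen p"] by (simp add: bracket_def mm.diff_left mm.diff_right)
  then obtain c where c: "A - C = c *\<^sub>R mat 1" using commutant_spin9_gen by blast
  have "transpose (A - C) = - (A - C)" using A C by (simp add: spin9_algebra_def transpose_linear)
  then have "(2 * c) *\<^sub>R (mat 1 :: oct_matrix) = 0"
    unfolding c by (simp add: transpose_linear transpose_mat scaleR_2 eq_neg_iff_add_eq_0 flip: scaleR_scaleR)
  moreover have "(mat 1 :: oct_matrix) \<noteq> 0" by (simp add: mat_def vec_eq_iff)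
  ultimately have "A = C" using c by simp
  then show ?thesis using diag unfolding C_def by blast
qed


section \<open>Coordinates on the Lie algebra\<close>

text \<open>
  The entries in these formulas are the ones in the four differentiation rules: \<open>w\<close> and \<open>z\<close> are
  the values of \<open>\<phi>\<^sub>0\<close> and \<open>\<phi>\<^sub>1\<close>, and \<open>(L\<^sub>w, L\<^sub>w + R\<^sub>w)\<close> is the infinitesimal triality which belongs to
  left multiplication by \<open>w\<close>.
\<close>

definition hor_map :: "octonion \<Rightarrow> octonion \<Rightarrow> oct_plane \<Rightarrow> oct_plane" where
  "hor_map w z y = oct_pair (oct_mult w (oct_comp 0 y) - oct_mult (oct_comp 1 y) (oct_cnj z))
     (oct_mult (oct_comp 0 y) z + (oct_mult w (oct_comp 1 y) + oct_mult (oct_comp 1 y) w))"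

definition hor_matrix :: "octonion \<Rightarrow> octonion \<Rightarrow> oct_matrix" where
  "hor_matrix w z = matrix (hor_map w z)"

lemma hor_matrix_apply:
  "hor_matrix w z *v oct_pair a b =
     oct_pair (oct_mult w a - oct_mult b (oct_cnj z)) (oct_mult a z + (oct_mult w b + oct_mult b w))"
proof -
  have "linear (hor_map w z)"
    by (rule linearI) (simp_all add: hor_map_def oct_comp_linear oct_pair_linear oct_mult.add_left
        oct_mult.add_right oct_mult.scaleR_left oct_mult.scaleR_right algebra_simps)
  then show ?thesis by (simp add: hor_matrix_def linear_matrix_apply hor_map_def)
qed

lemma hor_matrix_linear:
  "hor_matrix (w + w') (z + z') = hor_matrix w z + hor_matrix w' z'"
  "hor_matrix (r *\<^sub>R w) (r *\<^sub>R z) = r *\<^sub>R hor_matrix w z"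
  by (rule oct_matrix_eqI; simp add: hor_matrix_apply mv.add_left mv.scaleR_left oct_pair_linear oct_cnj_linear
      oct_mult.add_left oct_mult.add_right oct_mult.scaleR_left oct_mult.scaleR_right algebra_simps)+

lemma oct_cnj_imaginary: "w $ 0 = 0 \<Longrightarrow> oct_cnj w = - w"
  by (rule oct_eqI) (simp_all add: oct_cnj_nth)

lemma hor_matrix_left_algebra:
  assumes w: "w $ 0 = 0"
  shows "hor_matrix w 0 \<in> spin9_algebra"
proof -
  note cw = oct_cnj_imaginary[OF w]
  have "transpose (hor_matrix w 0) = - hor_matrix w 0"
  proof (rule transpose_eqI)
    fix x y :: oct_plane
    obtain a b c d where "x = oct_pair a b" "y = oct_pair c d" using oct_pair_exists by metis
    then show "(- hor_matrix w 0 *v x) \<bullet> y = x \<bullet> (hor_matrix w 0 *v y)"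
      using oct_mult_inner_left[of w a c] oct_mult_inner_left[of w b d] oct_mult_inner_right[of b w d]
      by (simp add: mv.minus_left hor_matrix_apply oct_pair_inner cw oct_cnj_linear oct_mult.zero_right
          oct_mult.minus_left oct_mult.minus_right inner_add_left inner_add_right)
  qed
  moreover have "bracket (hor_matrix w 0) (spin9_gen p) = spin9_gen (0, - oct_mult w (snd p))" for p
  proof (rule oct_matrix_eqI)
    fix a b
    show "bracket (hor_matrix w 0) (spin9_gen p) *v oct_pair a b = spin9_gen (0, - oct_mult w (snd p)) *v oct_pair a b"
      using oct_left_triality[of w b "snd p"] oct_middle_triality[of w a "oct_cnj (snd p)"]
      by (simp add: bracket_def mv.diff_left hor_matrix_apply spin9_gen_apply oct_pair_linear cw oct_cnj_linear
          oct_cnj_mult oct_mult.zero_right oct_mult.add_left oct_mult.add_right oct_mult.diff_left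
          oct_mult.diff_right oct_mult.scaleR_left oct_mult.scaleR_right oct_mult.minus_left oct_mult.minus_right
          flip: matrix_vector_mul_assoc) (simp add: algebra_simps)
  qed
  ultimately show ?thesis unfolding spin9_algebra_def by blast
qed

lemma hor_matrix_right_algebra: "hor_matrix 0 z \<in> spin9_algebra"
proof -
  have "hor_matrix 0 z = spin9_gen (1, 0) ** spin9_gen (0, - oct_cnj z)"
    by (rule oct_matrix_eqI) (simp add: hor_matrix_apply spin9_gen_apply oct_cnj_linear oct_mult.zero_left
        oct_mult.zero_right oct_mult.minus_left oct_mult.minus_right flip: matrix_vector_mul_assoc)
  then show ?thesis by (simp add: gen_gen_spin9_algebra inner_Pair)
qed

lemma hor_matrix_algebra: "w $ 0 = 0 \<Longrightarrow> hor_matrix w z \<in> spin9_algebra"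
  using subspace_add[OF subspace_spin9_algebra hor_matrix_left_algebra hor_matrix_right_algebra, of w z]
  by (simp flip: hor_matrix_linear(1))

lemma E0_eq: "E0 = oct_pair (oct_basis 0) 0"
  by (simp add: E0_def)

lemma hor_matrix_E0: "hor_matrix w z *v E0 = oct_pair w z"
  by (simp add: E0_eq hor_matrix_apply oct_mult.zero_left oct_mult.zero_right)

lemma matrix_entry: "A $ i $ j = (A *v axis j 1) $ i" for A :: oct_matrix
  by (simp add: matrix_vector_mul_component inner_axis)

lemma axis_pair: "axis (0, a) 1 = oct_pair (oct_basis a) 0" "axis (1, a) 1 = oct_pair 0 (oct_basis a)"
  by (simp_all add: vec_eq_iff forall_2_8 axis_def)

lemma column_E0: "A $ i $ (0, 0) = (A *v E0) $ i" for A :: oct_matrix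
  by (simp add: matrix_entry axis_pair E0_eq)

lemma skew_entry: "A \<in> spin9_algebra \<Longrightarrow> A $ i $ j = - A $ j $ i"
proof -
  assume "A \<in> spin9_algebra"
  then have "transpose A $ j $ i = (- A) $ j $ i" by (simp add: spin9_algebra_def)
  then show ?thesis by (simp add: transpose_def)
qed

lemma skew_inner: "A \<in> spin9_algebra \<Longrightarrow> (A *v x) \<bullet> y = - (x \<bullet> (A *v y))"
  using transpose_inner[of A x y] by (simp add: spin9_algebra_def mv.minus_left)

lemma E0_orthogonal: "A \<in> spin9_algebra \<Longrightarrow> (A *v E0) \<bullet> E0 = 0"
  using skew_inner[of A E0 E0] by (simp add: inner_commute)

text \<open>
  The first column and the entries between imaginary coordinates of the second copy determine an
  element of the Lie algebra. If the first column vanishes then the element is a pair \<open>(A\<^sub>0, A\<^sub>1)\<close> of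
  maps of the two copies. If the other entries vanish as well then \<open>A\<^sub>1 = L\<^sub>w + R\<^sub>w\<close> for an imaginary
  \<open>w\<close>, and \<open>A\<^sub>0 - L\<^sub>w\<close> is multiplication by an element of the nucleus.
\<close>

lemma spin9_algebra_eq_0:
  assumes A: "A \<in> spin9_algebra" and AE: "A *v E0 = 0"
    and im: "\<And>a b. a \<noteq> 0 \<Longrightarrow> b \<noteq> 0 \<Longrightarrow> A $ (1, a) $ (1, b) = 0"
  shows "A = 0"
proof -
  define A0 where "A0 a = oct_comp 0 (A *v oct_pair a 0)" for a
  define A1 where "A1 b = oct_comp 1 (A *v oct_pair 0 b)" for b
  obtain p where p: "bracket A (spin9_gen (1, 0)) = spin9_gen p"
    using A unfolding spin9_algebra_def by blast
  have A0: "A *v oct_pair a 0 = oct_pair (A0 a) 0" for a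
  proof -
    \<comment> \<open>The generator \<open>(1, 0)\<close> distinguishes the two copies, so the bracket with it is twice the part of \<open>A\<close> exchanging them.\<close>
    have *: "oct_comp 1 (A *v oct_pair a 0) + oct_comp 1 (A *v oct_pair a 0) = oct_mult a (oct_cnj (snd p))" for a
    proof -
      obtain u v where uv: "A *v oct_pair a 0 = oct_pair u v" using oct_pair_exists by blast
      have "bracket A (spin9_gen (1, 0)) *v oct_pair a 0 = spin9_gen p *v oct_pair a 0"
        by (simp add: p)
      then show ?thesis
        by (simp add: bracket_def mv.diff_left spin9_gen_apply uv oct_pair_linear oct_cnj_linear
            oct_mult.zero_right oct_mult.zero_left flip: matrix_vector_mul_assoc)
    qed
    have "oct_comp 1 (0 :: oct_plane) = 0" by (simp add: oct_comp_def vec_eq_iff)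
    then have "oct_cnj (snd p) = 0" using *[of "oct_basis 0"] AE by (simp add: E0_eq)
    then have "2 *\<^sub>R oct_comp 1 (A *v oct_pair a 0) = 0"
      unfolding scaleR_2 * by (simp add: oct_mult.zero_right)
    then have "oct_comp 1 (A *v oct_pair a 0) = 0" by simp
    then show ?thesis unfolding A0_def by (metis oct_pair_comp)
  qed
  have A1: "A *v oct_pair 0 b = oct_pair 0 (A1 b)" for b
  proof -
    obtain u where u: "A *v oct_pair 0 b = oct_pair u (A1 b)" unfolding A1_def by (metis oct_pair_comp)
    have "u \<bullet> u = 0"
      using skew_inner[OF A, of "oct_pair 0 b" "oct_pair u 0"] by (simp add: u A0 oct_pair_inner)
    then show ?thesis using u by simp
  qed
  have lin0: "A0 (r *\<^sub>R a + b) = r *\<^sub>R A0 a + A0 b" for r a b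
  proof -
    have "A *v oct_pair (r *\<^sub>R a + b) 0 = r *\<^sub>R (A *v oct_pair a 0) + A *v oct_pair b 0"
      by (simp add: oct_pair_linear flip: mv.scaleR_right mv.add_right)
    then show ?thesis by (simp add: A0 oct_pair_linear)
  qed
  have e0: "A0 (oct_basis 0) = 0" using A0[of "oct_basis 0"] AE by (simp add: E0_eq flip: oct_pair_zero)
  have ent: "(A1 b) $ a = (\<Sum>c\<in>UNIV. A $ (1, a) $ (1, c) * b $ c)" for a b
  proof -
    have "(A1 b) $ a = (A *v oct_pair 0 b) $ (1, a)" by (simp add: A1)
    also have "\<dots> = (\<Sum>c\<in>UNIV. A $ (1, a) $ (1, c) * b $ c)"
      by (simp add: matrix_vector_mult_def sum_2_8)
    finally show ?thesis .
  qed
  define w :: octonion where "w = (\<chi> a. A $ (1, a) $ (1, 0) / 2)"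
  have w0: "w $ 0 = 0" using skew_entry[OF A, of "(1, 0)" "(1, 0)"] by (simp add: w_def)
  have A1w: "A1 b = oct_mult w b + oct_mult b w" for b
  proof -
    have 1: "A $ (1, a) $ (1, 0) = 2 * w $ a" for a by (simp add: w_def)
    have 2: "A $ (1, 0) $ (1, a) = - (2 * w $ a)" for a
      using skew_entry[OF A, of "(1, 0)" "(1, a)"] by (simp add: 1)
    show ?thesis
      by (rule oct_eqI) (simp_all add: ent sum_8 1 2 im w0 oct_mult_nth algebra_simps)
  qed
  \<comment> \<open>The first component of the bracket with the generator \<open>(0, x)\<close>, evaluated at \<open>(0, b)\<close>.\<close>
  have "\<exists>y. \<forall>b. A0 (oct_mult b x) = oct_mult (A1 b) x + oct_mult b y" for x
  proof -
    obtain q where q: "bracket A (spin9_gen (0, x)) = spin9_gen q"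
      using A unfolding spin9_algebra_def by blast
    have "A0 (oct_mult b x) = oct_mult (A1 b) x + oct_mult b (snd q)" for b
    proof -
      have "bracket A (spin9_gen (0, x)) *v oct_pair 0 b = spin9_gen q *v oct_pair 0 b" by (simp add: q)
      then show ?thesis
        by (simp add: bracket_def mv.diff_left spin9_gen_apply A0 A1 oct_pair_linear
            oct_mult.zero_left algebra_simps flip: matrix_vector_mul_assoc)
    qed
    then show ?thesis by blast
  qed
  then obtain Y where Y: "\<And>b x. A0 (oct_mult b x) = oct_mult (A1 b) x + oct_mult b (Y x)" by metis
  \<comment> \<open>Subtracting the triality identity of \<open>w\<close> leaves a map with \<open>D (b x) = b D x\<close>, and hence \<open>D b = - b w\<close>.\<close>
  define D where "D a = A0 a - oct_mult w a" for a
  have D: "D (oct_mult b x) = oct_mult b (Y x + oct_mult w x)" for b x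
    using Y[of b x] oct_left_triality[of w b x] by (simp add: D_def A1w oct_mult.add_right)
  have D1: "D x = Y x + oct_mult w x" for x using D[of "oct_basis 0" x] by simp
  have "Y (oct_basis 0) + oct_mult w (oct_basis 0) = - w"
    using D1[of "oct_basis 0"] unfolding D_def e0 by simp
  then have Db: "D b = oct_mult b (- w)" for b
    using D[of b "oct_basis 0"] by (simp only: oct_mult_one)
  have "- w = (- w $ 0) *\<^sub>R oct_basis 0"
    using oct_right_nucleus[of "- w"] D D1 Db by simp
  then have "w = 0" using w0 by simp
  then have "A0 a = 0" "A1 a = 0" for a
    using Db[of a] A1w[of a] by (simp_all add: D_def oct_mult.zero_left oct_mult.zero_right)
  then have "A *v oct_pair a 0 = 0" "A *v oct_pair 0 b = 0" for a b by (simp_all add: A0 A1)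
  then have "A *v oct_pair a b = 0 *v oct_pair a b" for a b
    using mv.add_right[of A "oct_pair a 0" "oct_pair 0 b"] by (simp add: oct_pair_linear mv.zero_left)
  then show ?thesis by (rule oct_matrix_eqI)
qed

text \<open>
  The remaining directions are commutators of elements of the first kind: \<open>L\<^sub>w + R\<^sub>w\<close> exchanges
  \<open>1\<close> and the imaginary \<open>w\<close> up to a factor, and the commutator of two of these maps is a rotation in
  the plane of two imaginary octonions.
\<close>

definition ver_matrix :: "8 \<Rightarrow> 8 \<Rightarrow> oct_matrix" where
  "ver_matrix a b = (1/4) *\<^sub>R (bracket (hor_matrix (oct_basis b) 0) (hor_matrix (oct_basis a) 0) -
     hor_matrix (oct_mult (oct_basis b) (oct_basis a) - oct_mult (oct_basis a) (oct_basis b)) 0)"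

lemma ver_matrix_algebra:
  assumes "a \<noteq> 0" "b \<noteq> 0"
  shows "ver_matrix a b \<in> spin9_algebra"
proof -
  have "oct_mult x y $ 0 = oct_mult y x $ 0" for x y by (simp add: oct_mult_nth algebra_simps)
  then show ?thesis
    unfolding ver_matrix_def using assms
    by (intro subspace_scale subspace_diff subspace_spin9_algebra bracket_spin9_algebra hor_matrix_algebra)
      (simp_all add: oct_basis_nth)
qed

lemma ver_matrix_E0: "ver_matrix a b *v E0 = 0"
  by (simp add: ver_matrix_def mv.scaleR_left mv.diff_left bracket_def hor_matrix_E0 hor_matrix_apply
      oct_mult.zero_left oct_mult.zero_right oct_cnj_linear oct_pair_linear flip: matrix_vector_mul_assoc)

lemma imaginary_anticommutator:
  assumes "w $ 0 = 0"
  shows "oct_mult w y + oct_mult y w = 2 *\<^sub>R (y $ 0 *\<^sub>R w - (w \<bullet> y) *\<^sub>R oct_basis 0)"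
  by (rule oct_eqI) (simp_all add: oct_mult_nth oct_inner oct_basis_nth assms algebra_simps)

lemma ver_matrix_entry:
  assumes "a \<noteq> 0" "b \<noteq> 0" "c \<noteq> 0" "d \<noteq> 0"
  shows "ver_matrix a b $ (1, c) $ (1, d) =
     (if c = a \<and> d = b then 1 else 0) - (if c = b \<and> d = a then 1 else 0)"
proof -
  define t where "t w y = 2 *\<^sub>R (y $ 0 *\<^sub>R w - (w \<bullet> y) *\<^sub>R oct_basis 0)" for w y :: octonion
  have T: "hor_matrix w 0 *v oct_pair 0 y = oct_pair 0 (t w y)" if "w $ 0 = 0" for w y
    by (simp only: hor_matrix_apply imaginary_anticommutator[OF that] t_def)
      (simp add: oct_cnj_linear oct_mult.zero_left oct_mult.zero_right)
  have t0: "t w y $ 0 = - 2 * (w \<bullet> y)" if "w $ 0 = 0" for w y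
    using that by (simp add: t_def oct_basis_nth)
  have tc: "t w y $ c = 2 * (y $ 0 * w $ c)" for w y
    using assms(3) by (simp add: t_def oct_basis_nth)
  have i: "oct_basis a $ 0 = 0" "oct_basis b $ 0 = 0" "oct_basis d $ 0 = 0"
    using assms by (simp_all add: oct_basis_nth)
  have v: "(oct_mult (oct_basis b) (oct_basis a) - oct_mult (oct_basis a) (oct_basis b)) $ 0 = 0"
    by (simp add: oct_mult_nth algebra_simps)
  have ib: "oct_basis e \<bullet> y = y $ e" for e :: 8 and y by (simp add: inner_axis')
  have "ver_matrix a b $ (1, c) $ (1, d) = (ver_matrix a b *v oct_pair 0 (oct_basis d)) $ (1, c)"
    by (simp add: matrix_entry axis_pair)
  also have "ver_matrix a b *v oct_pair 0 (oct_basis d) =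
      (1/4) *\<^sub>R (oct_pair 0 (t (oct_basis b) (t (oct_basis a) (oct_basis d))) -
        oct_pair 0 (t (oct_basis a) (t (oct_basis b) (oct_basis d))) -
        oct_pair 0 (t (oct_mult (oct_basis b) (oct_basis a) - oct_mult (oct_basis a) (oct_basis b)) (oct_basis d)))"
    by (simp only: ver_matrix_def mv.scaleR_left mv.diff_left bracket_def matrix_vector_mul_assoc[symmetric]
        T[OF v] T[OF i(1)] T[OF i(2)])
  also have "\<dots> $ (1, c) = (if d = b then 1 else 0) * (if a = c then 1 else 0)
      - (if d = a then 1 else 0) * (if b = c then 1 else 0)"
    by (simp only: oct_pair_linear vector_scaleR_component oct_pair_nth vector_minus_component tc t0[OF i(1)]
        t0[OF i(2)] ib i(3)) (simp add: oct_basis_nth)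
  also have "\<dots> = (if c = a \<and> d = b then 1 else 0) - (if c = b \<and> d = a then 1 else 0)"
  proof -
    have "(if Q then 1 else 0) * (if P then 1 else 0) - (if S then 1 else 0) * (if R then 1 else 0) =
        (if P \<and> Q then 1 else 0) - (if R \<and> S then 1 else (0 :: real))" for P Q R S
      by (cases P; cases Q; cases R; cases S) simp_all
    then show ?thesis unfolding eq_commute[of a c] eq_commute[of b c] .
  qed
  finally show ?thesis .
qed


section \<open>The group\<close>

lemma monoid_GL16: "monoid GL16"
proof (rule monoidI)
  show "x \<otimes>\<^bsub>GL16\<^esub> y \<in> carrier GL16" if "x \<in> carrier GL16" "y \<in> carrier GL16" for x y
    using that by (simp add: GL16_def invertible_mult)
  show "\<one>\<^bsub>GL16\<^esub> \<in> carrier GL16"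
    by (auto simp: GL16_def invertible_def intro!: exI[of _ "mat 1"])
qed (simp_all add: GL16_def matrix_mul_assoc)

lemma Spin9_one: "mat 1 \<in> Spin9"
  using generate.one[of GL16] by (simp add: Spin9_def GL16_def)

lemma Spin9_mult: "g \<in> Spin9 \<Longrightarrow> h \<in> Spin9 \<Longrightarrow> g ** h \<in> Spin9"
  using generate.eng[of g GL16 _ h] by (simp add: Spin9_def GL16_def)

lemma Spin9_generators: "{spin9_generator r x | r x. r\<^sup>2 + (norm x)\<^sup>2 = 1} = {spin9_gen p | p. p \<bullet> p = 1}"
proof -
  have n: "r\<^sup>2 + (norm x)\<^sup>2 = (r, x) \<bullet> (r, x)" for r and x :: octonion
    unfolding power2_norm_eq_inner inner_Pair by (simp add: power2_eq_square)
  show ?thesis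
  proof (intro equalityI subsetI)
    fix A assume "A \<in> {spin9_generator r x | r x. r\<^sup>2 + (norm x)\<^sup>2 = 1}"
    then obtain r x where "A = spin9_gen (r, x)" "(r, x) \<bullet> (r, x) = 1"
      unfolding n by (auto simp: spin9_gen_def)
    then show "A \<in> {spin9_gen p | p. p \<bullet> p = 1}" by blast
  next
    fix A assume "A \<in> {spin9_gen p | p. p \<bullet> p = 1}"
    then obtain p where "A = spin9_generator (fst p) (snd p)" "p \<bullet> p = 1"
      by (auto simp: spin9_gen_def)
    then show "A \<in> {spin9_generator r x | r x. r\<^sup>2 + (norm x)\<^sup>2 = 1}"
      unfolding n by (intro CollectI exI conjI) (simp_all add: inner_prod_def)
  qed
qed

lemma Spin9_gen: "p \<bullet> p = 1 \<Longrightarrow> spin9_gen p \<in> Spin9"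
  unfolding Spin9_def Spin9_generators by (auto intro!: generate.incl)

lemma Spin9_induct [consumes 1, case_names one gen mult]:
  assumes g: "g \<in> Spin9" and one: "P (mat 1)" and gen: "\<And>p. p \<bullet> p = 1 \<Longrightarrow> P (spin9_gen p)"
    and mult: "\<And>g h. g \<in> Spin9 \<Longrightarrow> h \<in> Spin9 \<Longrightarrow> P g \<Longrightarrow> P h \<Longrightarrow> P (g ** h)"
  shows "P g"
  using g[unfolded Spin9_def]
proof (induction g rule: generate.induct)
  case (inv h)
  then obtain p where p: "h = spin9_gen p" "p \<bullet> p = 1" unfolding Spin9_generators by blast
  have sq: "spin9_gen p ** spin9_gen p = mat 1" by (simp add: spin9_gen_square p)
  then have "invertible (spin9_gen p)" unfolding invertible_def by blast
  then have "inv\<^bsub>GL16\<^esub> (spin9_gen p) = spin9_gen p"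
    using sq by (intro monoid.inv_unique'[OF monoid_GL16, symmetric]) (simp_all add: GL16_def)
  then show ?case using p gen by simp
next
  case (eng g h)
  then show ?case using mult[of g h] by (simp add: Spin9_def GL16_def)
next
  case (incl h)
  then show ?case unfolding Spin9_generators using gen by blast
qed (use one in \<open>simp add: GL16_def\<close>)

lemma gen_gen_gen:
  "spin9_gen p ** spin9_gen q ** spin9_gen p = spin9_gen ((2 * (p \<bullet> q)) *\<^sub>R p - (p \<bullet> p) *\<^sub>R q)"
proof -
  have "spin9_gen p ** spin9_gen q ** spin9_gen p =
      (spin9_gen p ** spin9_gen q + spin9_gen q ** spin9_gen p) ** spin9_gen p - spin9_gen q ** (spin9_gen p ** spin9_gen p)"
    by (simp add: mm.add_left matrix_mul_assoc)
  then show ?thesis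
    by (simp add: clifford spin9_gen_square mm.scaleR_left mm.scaleR_right spin9_gen_linear)
qed

text \<open>
  The generators are symmetric involutions which act on the nine-dimensional space as negative
  reflections (\<open>gen_gen_gen\<close>), and all these properties are preserved by products.
\<close>

lemma Spin9_properties:
  assumes "g \<in> Spin9"
  shows "g ** transpose g = mat 1 \<and> transpose g ** g = mat 1 \<and> transpose g \<in> Spin9 \<and>
     (\<forall>p. \<exists>q. g ** spin9_gen p ** transpose g = spin9_gen q)"
  using assms
proof (induction g rule: Spin9_induct)
  case one
  then show ?case by (auto simp: transpose_mat Spin9_one)
next
  case (gen p)
  then show ?case by (auto simp: spin9_gen_square Spin9_gen gen_gen_gen)
next
  case (mult g h)
  have "(g ** h) ** transpose (g ** h) = g ** (h ** transpose h) ** transpose g"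
    by (simp add: matrix_transpose_mul matrix_mul_assoc)
  moreover have "transpose (g ** h) ** (g ** h) = transpose h ** (transpose g ** g) ** h"
    by (simp add: matrix_transpose_mul matrix_mul_assoc)
  moreover have "transpose (g ** h) \<in> Spin9" using mult by (simp add: matrix_transpose_mul Spin9_mult)
  moreover have "\<exists>q. g ** h ** spin9_gen p ** transpose (g ** h) = spin9_gen q" for p
  proof -
    obtain q where q: "h ** spin9_gen p ** transpose h = spin9_gen q" using mult by blast
    obtain r where r: "g ** spin9_gen q ** transpose g = spin9_gen r" using mult by blast
    have "g ** h ** spin9_gen p ** transpose (g ** h) = g ** (h ** spin9_gen p ** transpose h) ** transpose g"
      by (simp add: matrix_transpose_mul matrix_mul_assoc)
    then show ?thesis using q r by auto
  qed
  ultimately show ?case using mult by simp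
qed

lemma Spin9_transpose: "g \<in> Spin9 \<Longrightarrow> transpose g \<in> Spin9"
  and Spin9_orthogonal: "g \<in> Spin9 \<Longrightarrow> g ** transpose g = mat 1" "g \<in> Spin9 \<Longrightarrow> transpose g ** g = mat 1"
  and Spin9_conjugate: "g \<in> Spin9 \<Longrightarrow> \<exists>q. g ** spin9_gen p ** transpose g = spin9_gen q"
  using Spin9_properties by blast+

lemma Spin9_cancel [simp]:
  assumes "g \<in> Spin9"
  shows "transpose g ** (g ** A) = A" "g ** (transpose g ** A) = A"
    "transpose g *v (g *v x) = x" "g *v (transpose g *v x) = x"
  using Spin9_orthogonal[OF assms] by (simp_all add: matrix_mul_assoc matrix_vector_mul_assoc
      del: transpose_matrix_vector)

lemma Spin9_matrix_inv: "g \<in> Spin9 \<Longrightarrow> matrix_inv g = transpose g"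
proof -
  assume g: "g \<in> Spin9"
  have "\<exists>h. g ** h = mat 1 \<and> h ** g = mat 1" using Spin9_orthogonal[OF g] by blast
  then have "g ** matrix_inv g = mat 1" unfolding matrix_inv_def by (rule someI2_ex) blast
  then have "transpose g ** (g ** matrix_inv g) = transpose g" by simp
  then show ?thesis using g by simp
qed

lemma Spin9_inner: "g \<in> Spin9 \<Longrightarrow> (g *v x) \<bullet> (g *v y) = x \<bullet> y"
  using transpose_inner[of g "g *v x" y] Spin9_cancel(3)[of g x] by simp

lemma Ad_spin9_algebra:
  assumes g: "g \<in> Spin9" and A: "A \<in> spin9_algebra"
  shows "g ** A ** transpose g \<in> spin9_algebra"
proof -
  have "transpose (g ** A ** transpose g) = - (g ** A ** transpose g)"
    using A by (simp add: spin9_algebra_def matrix_transpose_mul mm.minus_left mm.minus_right matrix_mul_assoc)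
  moreover have "\<exists>q. bracket (g ** A ** transpose g) (spin9_gen p) = spin9_gen q" for p
  proof -
    obtain q where q: "transpose g ** spin9_gen p ** g = spin9_gen q"
      using Spin9_conjugate[OF Spin9_transpose[OF g], of p] by auto
    obtain r where r: "bracket A (spin9_gen q) = spin9_gen r" using A unfolding spin9_algebra_def by blast
    obtain s where s: "g ** spin9_gen r ** transpose g = spin9_gen s" using Spin9_conjugate[OF g] by blast
    have p: "spin9_gen p = g ** spin9_gen q ** transpose g"
      using g by (simp add: q[symmetric] matrix_mul_assoc[symmetric] Spin9_orthogonal)
    have "bracket (g ** A ** transpose g) (spin9_gen p) = g ** bracket A (spin9_gen q) ** transpose g"
      unfolding p bracket_def mm.diff_left mm.diff_right
      using g by (simp add: matrix_mul_assoc[symmetric])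
    then show ?thesis using r s by auto
  qed
  ultimately show ?thesis by (simp add: spin9_algebra_def)
qed


section \<open>Curves in the group\<close>

definition spin9_curve :: "(real \<Rightarrow> oct_matrix) \<Rightarrow> oct_matrix \<Rightarrow> bool" where
  "spin9_curve c A \<longleftrightarrow> smooth_on UNIV c \<and> (\<forall>t. c t \<in> Spin9) \<and> c 0 = mat 1 \<and> (c has_vector_derivative A) (at 0)"

lemma spin9_curve_apply:
  assumes "spin9_curve c A"
  shows "((\<lambda>t. c t ** h) has_vector_derivative A ** h) (at 0)"
    "((\<lambda>t. c t *v v) has_vector_derivative A *v v) (at 0)"
    "((\<lambda>t. h ** c t) has_vector_derivative h ** A) (at 0)"
proof -
  have D: "(c has_vector_derivative A) (at 0)" using assms by (simp add: spin9_curve_def)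
  show "((\<lambda>t. c t ** h) has_vector_derivative A ** h) (at 0)"
    by (rule bounded_linear.has_vector_derivative[OF mm.bounded_linear_left D])
  show "((\<lambda>t. c t *v v) has_vector_derivative A *v v) (at 0)"
    by (rule bounded_linear.has_vector_derivative[OF mv.bounded_linear_left D])
  show "((\<lambda>t. h ** c t) has_vector_derivative h ** A) (at 0)"
    by (rule bounded_linear.has_vector_derivative[OF mm.bounded_linear_right D])
qed

lemma spin9_curve_zero: "spin9_curve (\<lambda>t. mat 1) 0"
  by (simp add: spin9_curve_def smooth_on_const Spin9_one)

lemma spin9_curve_add:
  assumes "spin9_curve c A" "spin9_curve d B"
  shows "spin9_curve (\<lambda>t. c t ** d t) (A + B)"
proof -
  have "((\<lambda>t. c t ** d t) has_vector_derivative c 0 ** B + A ** d 0) (at 0)"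
    using mm.has_vector_derivative[of c A 0 UNIV d B] assms by (simp add: spin9_curve_def)
  then show ?thesis
    using assms by (simp add: spin9_curve_def smooth_on_bilinear[OF _ bounded_bilinear_matrix_mult] Spin9_mult add.commute)
qed

lemma spin9_curve_scale:
  assumes c: "spin9_curve c A"
  shows "spin9_curve (\<lambda>t. c (r * t)) (r *\<^sub>R A)"
proof -
  have "((\<lambda>t. r * t) has_vector_derivative r) (at 0)"
    by (auto intro!: derivative_eq_intros)
  moreover have "(c has_vector_derivative A) (at (r * 0))" using c by (simp add: spin9_curve_def)
  ultimately have "((c \<circ> (\<lambda>t. r * t)) has_vector_derivative r *\<^sub>R A) (at 0)"
    by (rule vector_diff_chain_at)
  moreover have "smooth_on UNIV (\<lambda>t. c (r * t + 0))"
    using c by (intro smooth_on_compose_affine[where S = UNIV] bounded_linear_mult_right) (auto simp: spin9_curve_def)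
  ultimately show ?thesis using c by (simp add: spin9_curve_def o_def)
qed

text \<open>
  The generators in the plane of two orthogonal unit vectors \<open>u\<close> and \<open>v\<close> form a circle; multiplied by
  the generator of \<open>v\<close> it starts at the identity.
\<close>

lemma spin9_curve_rotation:
  assumes uv: "u \<bullet> v = 0" and u: "u \<bullet> u = 1" and v: "v \<bullet> v = 1"
  shows "spin9_curve (\<lambda>t. spin9_gen (cos t *\<^sub>R v + sin t *\<^sub>R u) ** spin9_gen v) (spin9_gen u ** spin9_gen v)"
  unfolding spin9_curve_def
proof (intro conjI allI)
  have bl: "bounded_linear (\<lambda>x :: oct_matrix. x ** spin9_gen v)" by (rule mm.bounded_linear_left)
  have bg: "bounded_linear spin9_gen" using linear_spin9_gen by (simp add: linear_conv_bounded_linear)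
  have "smooth_on UNIV (\<lambda>t. cos t *\<^sub>R v + sin t *\<^sub>R u)"
    by (intro smooth_on_add smooth_on_bilinear[OF _ bounded_bilinear_scaleR] smooth_on_cos_sin smooth_on_const open_UNIV)
  then show "smooth_on UNIV (\<lambda>t. spin9_gen (cos t *\<^sub>R v + sin t *\<^sub>R u) ** spin9_gen v)"
    by (intro smooth_on_bounded_linear[OF _ bl] smooth_on_bounded_linear[OF _ bg] open_UNIV)
  show "spin9_gen (cos t *\<^sub>R v + sin t *\<^sub>R u) ** spin9_gen v \<in> Spin9" for t
  proof (intro Spin9_mult Spin9_gen v)
    have "(cos t *\<^sub>R v + sin t *\<^sub>R u) \<bullet> (cos t *\<^sub>R v + sin t *\<^sub>R u) = (cos t)\<^sup>2 + (sin t)\<^sup>2"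
      using uv u v by (simp add: inner_add_left inner_add_right inner_commute power2_eq_square)
    then show "(cos t *\<^sub>R v + sin t *\<^sub>R u) \<bullet> (cos t *\<^sub>R v + sin t *\<^sub>R u) = 1" by simp
  qed
  show "spin9_gen (cos 0 *\<^sub>R v + sin 0 *\<^sub>R u) ** spin9_gen v = mat 1" by (simp add: spin9_gen_square v)
  have "((\<lambda>t. cos t *\<^sub>R v + sin t *\<^sub>R u) has_vector_derivative u) (at 0)"
    by (auto intro!: derivative_eq_intros)
  from bounded_linear.has_vector_derivative[OF bl bounded_linear.has_vector_derivative[OF bg this]]
  show "((\<lambda>t. spin9_gen (cos t *\<^sub>R v + sin t *\<^sub>R u) ** spin9_gen v) has_vector_derivative
      spin9_gen u ** spin9_gen v) (at 0)" .
qed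

lemma spin9_curve_exists:
  assumes "A \<in> spin9_algebra"
  shows "\<exists>c. spin9_curve c A"
proof -
  obtain B where B: "\<And>b. B b \<bullet> b = 0" and A: "A = (\<Sum>b\<in>Basis. (1/4) *\<^sub>R (spin9_gen (B b) ** spin9_gen b))"
    using spin9_algebra_clifford[OF assms] by blast
  have 1: "\<exists>c. spin9_curve c ((1/4) *\<^sub>R (spin9_gen (B b) ** spin9_gen b))" if b: "b \<in> Basis" for b
  proof (cases "B b = 0")
    case True
    then show ?thesis using spin9_curve_zero by (auto simp: spin9_gen_linear mm.zero_left)
  next
    case False
    define u where "u = (1 / norm (B b)) *\<^sub>R B b"
    have "u \<bullet> b = 0" "u \<bullet> u = 1" "b \<bullet> b = 1"
      using False B b by (simp_all add: u_def dot_square_norm power2_eq_square inner_Basis)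
    from spin9_curve_scale[OF spin9_curve_rotation[OF this], of "norm (B b) / 4"]
    have "\<exists>c. spin9_curve c ((norm (B b) / 4) *\<^sub>R (spin9_gen u ** spin9_gen b))" by blast
    moreover have "(norm (B b) / 4) *\<^sub>R (spin9_gen u ** spin9_gen b) = (1/4) *\<^sub>R (spin9_gen (B b) ** spin9_gen b)"
      using False by (simp add: u_def spin9_gen_linear mm.scaleR_left)
    ultimately show ?thesis by simp
  qed
  have "\<exists>c. spin9_curve c (\<Sum>b\<in>S. (1/4) *\<^sub>R (spin9_gen (B b) ** spin9_gen b))" if "finite S" "S \<subseteq> Basis" for S
    using that
  proof (induction S rule: finite_induct)
    case empty
    then show ?case using spin9_curve_zero by auto
  next
    case (insert b S)
    then show ?case using 1[of b] spin9_curve_add by (simp, blast)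
  qed
  from this[of Basis] show ?thesis unfolding A by simp
qed

text \<open>
  The curve equals its image under a linear projection onto the subspace.
\<close>

lemma derivative_in_subspace:
  fixes \<gamma> :: "real \<Rightarrow> 'a::euclidean_space"
  assumes S: "subspace S" and "open U" "t \<in> U" and \<gamma>: "\<And>s. s \<in> U \<Longrightarrow> \<gamma> s \<in> S"
    and D: "(\<gamma> has_vector_derivative v) (at t)"
  shows "v \<in> S"
proof -
  obtain P :: "'a \<Rightarrow> 'a" where P: "linear P" "range P \<subseteq> S" "\<And>v. v \<in> S \<Longrightarrow> P v = v"
    using linear_exists_left_inverse_on[OF linear_id S, unfolded id_def, OF inj_on_id2] by blast
  have "((\<lambda>s. P (\<gamma> s)) has_vector_derivative P v) (at t)"
    by (rule bounded_linear.has_vector_derivative[OF P(1)[unfolded linear_conv_bounded_linear] D])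
  then have "(\<gamma> has_vector_derivative P v) (at t)"
    by (rule has_vector_derivative_transform_within_open) (use assms P in auto)
  then have "v = P v" using D vector_derivative_unique_at by blast
  then show ?thesis using P(2) by auto
qed

lemma Spin9_velocity:
  assumes \<epsilon>: "\<epsilon> > 0" and \<gamma>: "\<And>t. t \<in> {-\<epsilon><..<\<epsilon>} \<Longrightarrow> \<gamma> t \<in> Spin9" and D: "(\<gamma> has_vector_derivative v) (at 0)"
  shows "transpose (\<gamma> 0) ** v \<in> spin9_algebra"
proof -
  have g: "\<gamma> 0 \<in> Spin9" using \<gamma>[of 0] \<epsilon> by simp
  define c where "c t = transpose (\<gamma> 0) ** \<gamma> t" for t
  define A where "A = transpose (\<gamma> 0) ** v"
  have c: "c t \<in> Spin9" if "t \<in> {-\<epsilon><..<\<epsilon>}" for t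
    using g \<gamma>[OF that] by (simp add: c_def Spin9_mult Spin9_transpose)
  have c0: "c 0 = mat 1" using g by (simp add: c_def Spin9_orthogonal)
  have cD: "(c has_vector_derivative A) (at 0)"
    unfolding c_def A_def by (rule bounded_linear.has_vector_derivative[OF mm.bounded_linear_right D])
  have cT: "((\<lambda>t. transpose (c t)) has_vector_derivative transpose A) (at 0)"
    by (rule bounded_linear.has_vector_derivative[OF linear_transpose[unfolded linear_conv_bounded_linear] cD])
  have U: "open {-\<epsilon><..<\<epsilon>}" "0 \<in> {-\<epsilon><..<\<epsilon>}" using \<epsilon> by auto
  have "((\<lambda>t. c t ** transpose (c t)) has_vector_derivative c 0 ** transpose A + A ** transpose (c 0)) (at 0)"
    by (rule mm.has_vector_derivative[OF cD cT])
  then have "((\<lambda>t. mat 1) has_vector_derivative c 0 ** transpose A + A ** transpose (c 0)) (at 0)"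
    by (rule has_vector_derivative_transform_within_open[OF _ U]) (rule Spin9_orthogonal(1)[OF c])
  from vector_derivative_unique_at[OF this has_vector_derivative_const]
  have sk: "transpose A = - A" by (simp add: c0 transpose_mat eq_neg_iff_add_eq_0)
  moreover have "\<exists>q. bracket A (spin9_gen p) = spin9_gen q" for p
  proof -
    have "((\<lambda>t. c t ** spin9_gen p ** transpose (c t)) has_vector_derivative
        c 0 ** spin9_gen p ** transpose A + A ** spin9_gen p ** transpose (c 0)) (at 0)"
      by (rule mm.has_vector_derivative[OF bounded_linear.has_vector_derivative[OF mm.bounded_linear_left cD] cT])
    then have d: "((\<lambda>t. c t ** spin9_gen p ** transpose (c t)) has_vector_derivative bracket A (spin9_gen p)) (at 0)"
      by (simp add: c0 sk bracket_def mm.minus_right transpose_mat)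
    have "subspace (range spin9_gen)"
      using linear_subspace_image[OF linear_spin9_gen subspace_UNIV] .
    moreover have "c t ** spin9_gen p ** transpose (c t) \<in> range spin9_gen" if "t \<in> {-\<epsilon><..<\<epsilon>}" for t
      using Spin9_conjugate[OF c[OF that], of p] by auto
    ultimately have "bracket A (spin9_gen p) \<in> range spin9_gen"
      by (rule derivative_in_subspace[OF _ U _ d])
    then show ?thesis by blast
  qed
  ultimately show ?thesis unfolding A_def[symmetric] spin9_algebra_def by blast
qed


section \<open>Sections of the sphere\<close>

text \<open>
  The generators move \<open>E\<^sub>0\<close> to the points \<open>(r, y)\<close> of the sphere with real \<open>r\<close>, and the product of
  the generators \<open>(0, x)\<close> and \<open>(0, 1)\<close> is right multiplication by \<open>x\<close> on the first copy and by the
  conjugate of \<open>x\<close> on the second one. With \<open>x = a / |a|\<close> and \<open>r = |a|\<close> this reaches the points \<open>(a, b)\<close> with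
  \<open>a \<noteq> 0\<close>. Collecting the factors, only \<open>|a|\<^sup>2\<close> remains, so that the section is a rational function.
\<close>

definition sphere_section :: "octonion \<Rightarrow> octonion \<Rightarrow> oct_matrix" where
  "sphere_section a b = inverse (a \<bullet> a) *\<^sub>R
     (spin9_gen (0, a) ** spin9_gen (0, oct_basis 0) ** spin9_gen (a \<bullet> a, oct_cnj (oct_mult b a)))"

lemma oct_cnj_one: "oct_cnj (oct_basis 0) = oct_basis 0"
  by (rule oct_eqI) (simp_all add: oct_cnj_nth oct_basis_nth)

lemma oct_mult_inner_same: "oct_mult b a \<bullet> oct_mult b a = (a \<bullet> a) * (b \<bullet> b)"
  unfolding oct_mult_inner_right oct_mult_cnj_right by simp

lemma sphere_section_E0: "a \<noteq> 0 \<Longrightarrow> sphere_section a b *v E0 = oct_pair a b"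
  by (simp add: sphere_section_def E0_eq mv.scaleR_left spin9_gen_apply oct_pair_linear oct_cnj_linear oct_cnj_one
      oct_mult.zero_left oct_mult.zero_right oct_mult.scaleR_left oct_mult_cnj_right flip: matrix_vector_mul_assoc)

lemma sphere_section_Spin9:
  assumes a: "a \<noteq> 0" and ab: "a \<bullet> a + b \<bullet> b = 1"
  shows "sphere_section a b \<in> Spin9"
proof -
  define n where "n = norm a"
  have n: "n > 0" "a \<bullet> a = n * n" using a by (simp_all add: n_def dot_square_norm power2_eq_square)
  have "sphere_section a b = spin9_gen (inverse n *\<^sub>R (0, a)) ** spin9_gen (0, oct_basis 0) **
      spin9_gen (inverse n *\<^sub>R (a \<bullet> a, oct_cnj (oct_mult b a)))"
    by (simp only: sphere_section_def spin9_gen_linear mm.scaleR_left mm.scaleR_right n(2)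
        inverse_mult_distrib scaleR_scaleR)
  moreover have "(inverse n *\<^sub>R (0::real, a)) \<bullet> (inverse n *\<^sub>R (0, a)) = 1"
    using n by (simp add: inner_Pair field_simps)
  moreover have "(0::real, oct_basis 0) \<bullet> (0, oct_basis 0) = 1" by (simp add: inner_Pair inner_axis_axis)
  moreover have "(inverse n *\<^sub>R (a \<bullet> a, oct_cnj (oct_mult b a))) \<bullet> (inverse n *\<^sub>R (a \<bullet> a, oct_cnj (oct_mult b a))) = 1"
  proof -
    have "(inverse n *\<^sub>R (a \<bullet> a, oct_cnj (oct_mult b a))) \<bullet> (inverse n *\<^sub>R (a \<bullet> a, oct_cnj (oct_mult b a))) =
        (a \<bullet> a) + (b \<bullet> b)"
      using n by (simp add: inner_Pair oct_cnj_inner oct_mult_inner_same field_simps)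
    then show ?thesis using ab by simp
  qed
  ultimately show ?thesis by (simp only: Spin9_mult Spin9_gen)
qed

text \<open>
  The points with \<open>a = 0\<close> are reached by exchanging the two copies with the generator \<open>(0, 1)\<close>.
\<close>

lemma sphere_local_section:
  assumes v: "v \<in> sphere (0 :: oct_plane) 1"
  shows "\<exists>U s. open U \<and> v \<in> U \<and> smooth_on U s \<and> (\<forall>y\<in>U \<inter> sphere 0 1. s y \<in> Spin9 \<and> s y *v E0 = y)"
proof -
  have bc: "bounded_linear (oct_comp k)" for k
  proof -
    have "linear (oct_comp k)" by (rule linearI) (simp_all add: oct_comp_linear)
    then show ?thesis by (simp add: linear_conv_bounded_linear)
  qed
  have bg: "bounded_linear spin9_gen" using linear_spin9_gen by (simp add: linear_conv_bounded_linear)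
  have op: "open {y. oct_comp k y \<noteq> 0}" for k
    using open_vimage[OF open_delete[OF open_UNIV, of "0 :: octonion"] bounded_linear.continuous_on[OF bc[of k] continuous_on_id]]
    by (simp add: vimage_def)
  have sm: "smooth_on {y. oct_comp k y \<noteq> 0} (\<lambda>y. sphere_section (oct_comp k y) (oct_comp l y))" for k l
  proof -
    let ?U = "{y. oct_comp k y \<noteq> 0}"
    note c = smooth_on_linear_map[OF op bc]
    have i: "smooth_on ?U (\<lambda>y. oct_comp k y \<bullet> oct_comp k y)"
      by (rule smooth_on_bilinear[OF op bounded_bilinear_inner c c])
    note g = smooth_on_bounded_linear[OF op bg]
    have 1: "smooth_on ?U (\<lambda>y. spin9_gen (0, oct_comp k y))"
      by (rule g[OF smooth_on_Pair[OF op smooth_on_const c]])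
    have 2: "smooth_on ?U (\<lambda>y. spin9_gen (oct_comp k y \<bullet> oct_comp k y, oct_cnj (oct_mult (oct_comp l y) (oct_comp k y))))"
      by (rule g[OF smooth_on_Pair[OF op i smooth_on_bounded_linear[OF op bounded_linear_oct_cnj
              smooth_on_bilinear[OF op bounded_bilinear_oct_mult c c]]]])
    note m = smooth_on_bilinear[OF op bounded_bilinear_matrix_mult]
    show ?thesis
      unfolding sphere_section_def
      by (rule smooth_on_bilinear[OF op bounded_bilinear_scaleR smooth_on_inverse[OF op i] m[OF m[OF 1 smooth_on_const] 2]]) simp
  qed
  have unit: "oct_comp 0 y \<bullet> oct_comp 0 y + oct_comp 1 y \<bullet> oct_comp 1 y = 1" if "y \<in> sphere 0 1" for y
  proof -
    have "y \<bullet> y = 1" using that by (simp add: dot_square_norm)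
    then show ?thesis using oct_pair_inner[of "oct_comp 0 y" "oct_comp 1 y" "oct_comp 0 y" "oct_comp 1 y"] by simp
  qed
  show ?thesis
  proof (cases "oct_comp 0 v = 0")
    case False
    show ?thesis
      by (rule exI[of _ "{y. oct_comp 0 y \<noteq> 0}"], rule exI[of _ "\<lambda>y. sphere_section (oct_comp 0 y) (oct_comp 1 y)"])
        (use False op sm unit sphere_section_Spin9 sphere_section_E0 in auto)
  next
    case True
    then have b: "oct_comp 1 v \<noteq> 0" using unit[OF v] by auto
    let ?J = "spin9_gen (0, oct_basis 0)"
    have J: "?J \<in> Spin9" by (rule Spin9_gen) (simp add: inner_Pair inner_axis_axis)
    have sJ: "smooth_on {y. oct_comp 1 y \<noteq> 0} (\<lambda>y. ?J ** sphere_section (oct_comp 1 y) (oct_comp 0 y))"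
      by (rule smooth_on_bilinear[OF op bounded_bilinear_matrix_mult smooth_on_const sm])
    have "?J ** sphere_section (oct_comp 1 y) (oct_comp 0 y) \<in> Spin9 \<and>
        (?J ** sphere_section (oct_comp 1 y) (oct_comp 0 y)) *v E0 = y"
      if "oct_comp 1 y \<noteq> 0" "y \<in> sphere 0 1" for y
      using that unit[OF that(2)] J
      by (auto intro!: Spin9_mult sphere_section_Spin9 simp: sphere_section_E0 spin9_gen_apply oct_cnj_one add.commute
          simp flip: matrix_vector_mul_assoc)
    then show ?thesis using sJ op b by blast
  qed
qed

lemma Spin9_transitive:
  assumes "v \<in> sphere (0 :: oct_plane) 1"
  obtains g where "g \<in> Spin9" "g *v E0 = v"
  using sphere_local_section[OF assms] assms by blast

lemma E0_sphere: "E0 \<in> sphere 0 1"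
  by (simp add: norm_eq_1 E0_eq oct_pair_inner inner_axis_axis)

lemma Spin9_sphere: "g \<in> Spin9 \<Longrightarrow> v \<in> sphere 0 1 \<Longrightarrow> g *v v \<in> sphere 0 1"
  by (simp add: norm_eq_1 Spin9_inner)


section \<open>Tangent spaces\<close>

lemma tangent_spaceI:
  assumes "smooth_on UNIV \<gamma>" "\<And>t. \<gamma> t \<in> M" "\<gamma> 0 = x" "(\<gamma> has_vector_derivative v) (at 0)"
  shows "v \<in> tangent_space M x"
  unfolding tangent_space_def using assms smooth_on_subset[OF assms(1) subset_UNIV]
  by (intro CollectI exI[of _ 1] conjI exI[of _ \<gamma>]) auto

lemma tangent_space_G:
  assumes g: "g \<in> Spin9"
  shows "tangent_space G (g, x) = {(g ** A, u) | A u. A \<in> spin9_algebra}"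
proof (intro equalityI subsetI)
  fix v assume "v \<in> tangent_space G (g, x)"
  then obtain \<epsilon> \<gamma> where \<epsilon>: "\<epsilon> > 0" and \<gamma>: "\<gamma> ` {-\<epsilon><..<\<epsilon>} \<subseteq> G" "\<gamma> 0 = (g, x)"
    "(\<gamma> has_vector_derivative v) (at 0)" by (auto simp: tangent_space_def)
  have "transpose (fst (\<gamma> 0)) ** fst v \<in> spin9_algebra"
  proof (rule Spin9_velocity[OF \<epsilon>])
    show "fst (\<gamma> t) \<in> Spin9" if "t \<in> {-\<epsilon><..<\<epsilon>}" for t
      using subsetD[OF \<gamma>(1) imageI[OF that]] by (simp add: G_def mem_Times_iff)
    show "((\<lambda>t. fst (\<gamma> t)) has_vector_derivative fst v) (at 0)"
      by (rule bounded_linear.has_vector_derivative[OF bounded_linear_fst \<gamma>(3)])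
  qed
  moreover have "v = (g ** (transpose g ** fst v), snd v)" using g by simp
  ultimately show "v \<in> {(g ** A, u) | A u. A \<in> spin9_algebra}" using \<gamma>(2) by fastforce
next
  fix v assume "v \<in> {(g ** A, u :: oct_plane) | A u. A \<in> spin9_algebra}"
  then obtain A u where v: "v = (g ** A, u)" and "A \<in> spin9_algebra" by blast
  then obtain c where c: "spin9_curve c A" using spin9_curve_exists by blast
  show "v \<in> tangent_space G (g, x)"
  proof (rule tangent_spaceI[of "\<lambda>t. (g ** c t, x + t *\<^sub>R u)"])
    show "smooth_on UNIV (\<lambda>t. (g ** c t, x + t *\<^sub>R u))"
      using c by (intro smooth_on_Pair smooth_on_bilinear[OF _ bounded_bilinear_matrix_mult] smooth_on_add
          smooth_on_const smooth_on_linear_map[OF _ bounded_linear_scaleR_left] open_UNIV) (simp add: spin9_curve_def)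
    show "(g ** c t, x + t *\<^sub>R u) \<in> G" for t using c g by (simp add: G_def spin9_curve_def Spin9_mult)
    show "(g ** c 0, x + 0 *\<^sub>R u) = (g, x)" using c by (simp add: spin9_curve_def)
    have "((\<lambda>t. g ** c t) has_vector_derivative g ** A) (at 0)"
      by (rule spin9_curve_apply[OF c])
    moreover have "((\<lambda>t. x + t *\<^sub>R u) has_vector_derivative u) (at 0)"
      by (auto intro!: derivative_eq_intros)
    ultimately show "((\<lambda>t. (g ** c t, x + t *\<^sub>R u)) has_vector_derivative v) (at 0)"
      unfolding v by (rule has_vector_derivative_Pair)
  qed
qed

text \<open>
  Moved to \<open>E\<^sub>0\<close>, the direction becomes the first column of a matrix \<open>hor_matrix a b\<close>.
\<close>

lemma tangent_direction_sphere:
  assumes v: "v \<in> sphere 0 1" and w: "w \<bullet> v = 0"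
  shows "\<exists>B\<in>spin9_algebra. B *v v = w"
proof -
  obtain g where g: "g \<in> Spin9" "g *v E0 = v" using Spin9_transitive[OF v] .
  obtain a b where ab: "transpose g *v w = oct_pair a b" using oct_pair_exists by blast
  have "(transpose g *v w) \<bullet> E0 = 0" using w g by (simp only: transpose_inner)
  then have "a $ 0 = 0" by (simp add: ab E0_eq oct_pair_inner inner_axis del: transpose_matrix_vector)
  then have "g ** hor_matrix a b ** transpose g \<in> spin9_algebra"
    by (intro Ad_spin9_algebra g hor_matrix_algebra)
  moreover have "(g ** hor_matrix a b ** transpose g) *v v = w"
  proof -
    have "(g ** hor_matrix a b ** transpose g) *v v = g *v (hor_matrix a b *v (transpose g *v (g *v E0)))"
      by (simp only: matrix_vector_mul_assoc g(2)[symmetric] matrix_mul_assoc)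
    also have "\<dots> = g *v (transpose g *v w)" by (simp only: Spin9_cancel(3)[OF g(1)] hor_matrix_E0 ab)
    finally show ?thesis by (simp only: Spin9_cancel(4)[OF g(1)])
  qed
  ultimately show ?thesis by blast
qed

lemma tangent_space_sphere_bundle:
  assumes v: "v \<in> sphere 0 1"
  shows "tangent_space sphere_bundle (y, v) = {(u, w). w \<bullet> v = 0}"
proof (intro equalityI subsetI)
  fix p assume "p \<in> tangent_space sphere_bundle (y, v)"
  then obtain \<epsilon> \<gamma> where \<epsilon>: "\<epsilon> > 0" and \<gamma>: "\<gamma> ` {-\<epsilon><..<\<epsilon>} \<subseteq> sphere_bundle" "\<gamma> 0 = (y, v)"
    "(\<gamma> has_vector_derivative p) (at 0)" by (auto simp: tangent_space_def)
  have D: "((\<lambda>t. snd (\<gamma> t)) has_vector_derivative snd p) (at 0)"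
    by (rule bounded_linear.has_vector_derivative[OF bounded_linear_snd \<gamma>(3)])
  have U: "open {-\<epsilon><..<\<epsilon>}" "0 \<in> {-\<epsilon><..<\<epsilon>}" using \<epsilon> by auto
  have "((\<lambda>t. snd (\<gamma> t) \<bullet> snd (\<gamma> t)) has_vector_derivative snd (\<gamma> 0) \<bullet> snd p + snd p \<bullet> snd (\<gamma> 0)) (at 0)"
    by (rule bounded_bilinear.has_vector_derivative[OF bounded_bilinear_inner D D])
  moreover have "snd (\<gamma> t) \<bullet> snd (\<gamma> t) = 1" if "t \<in> {-\<epsilon><..<\<epsilon>}" for t
    using subsetD[OF \<gamma>(1) imageI[OF that]] by (simp add: sphere_bundle_def mem_Times_iff dot_square_norm)
  ultimately have "((\<lambda>t. 1) has_vector_derivative snd (\<gamma> 0) \<bullet> snd p + snd p \<bullet> snd (\<gamma> 0)) (at 0)"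
    by (rule has_vector_derivative_transform_within_open[OF _ U])
  from vector_derivative_unique_at[OF this has_vector_derivative_const]
  have "snd (\<gamma> 0) \<bullet> snd p + snd p \<bullet> snd (\<gamma> 0) = 0" .
  then show "p \<in> {(u, w). w \<bullet> v = 0}" using \<gamma>(2) by (auto simp: inner_commute split_beta)
next
  fix p assume "p \<in> {(u :: oct_plane, w). w \<bullet> v = 0}"
  then obtain u w where p: "p = (u, w)" and "w \<bullet> v = 0" by blast
  then obtain B where "B \<in> spin9_algebra" and B: "B *v v = w" using tangent_direction_sphere[OF v] by blast
  then obtain c where c: "spin9_curve c B" using spin9_curve_exists by blast
  show "p \<in> tangent_space sphere_bundle (y, v)"
  proof (rule tangent_spaceI[of "\<lambda>t. (y + t *\<^sub>R u, c t *v v)"])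
    show "smooth_on UNIV (\<lambda>t. (y + t *\<^sub>R u, c t *v v))"
      using c by (intro smooth_on_Pair smooth_on_bilinear[OF _ bounded_bilinear_matrix_vector] smooth_on_add
          smooth_on_const smooth_on_linear_map[OF _ bounded_linear_scaleR_left] open_UNIV) (simp add: spin9_curve_def)
    show "(y + t *\<^sub>R u, c t *v v) \<in> sphere_bundle" for t
      using c Spin9_sphere[OF _ v, of "c t"] by (simp add: sphere_bundle_def spin9_curve_def)
    show "(y + 0 *\<^sub>R u, c 0 *v v) = (y, v)" using c by (simp add: spin9_curve_def)
    have "((\<lambda>t. c t *v v) has_vector_derivative B *v v) (at 0)"
      by (rule spin9_curve_apply[OF c])
    moreover have "((\<lambda>t. y + t *\<^sub>R u) has_vector_derivative u) (at 0)"
      by (auto intro!: derivative_eq_intros)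
    ultimately show "((\<lambda>t. (y + t *\<^sub>R u, c t *v v)) has_vector_derivative p) (at 0)"
      unfolding p B[symmetric] using has_vector_derivative_Pair by blast
  qed
qed

text \<open>
  A curve \<open>c\<close> in \<open>Spin9\<close> through the identity and a translation act from the left. The translation
  part is corrected by \<open>- B y\<close>, because the linear part moves the point \<open>y\<close> as well.
\<close>

lemma affine_homogeneous_G: "affine_homogeneous G"
  unfolding affine_homogeneous_def
proof (intro conjI ballI)
  fix x assume "x \<in> G"
  then obtain g y where x: "x = (g, y)" and g: "g \<in> Spin9" by (auto simp: G_def)
  show "subspace (tangent_space G x)"
    unfolding x tangent_space_G[OF g]
    using subspace_spin9_algebra
    by (auto intro!: subspaceI simp: zero_prod_def subspace_0 subspace_add subspace_scale)
      (metis mm.zero_right subspace_0, metis mm.add_right subspace_add, metis mm.scaleR_right subspace_scale)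
  fix v assume "v \<in> tangent_space G x"
  then obtain A u where v: "v = (g ** A, u)" and A: "A \<in> spin9_algebra"
    unfolding x tangent_space_G[OF g] by blast
  define B where "B = g ** A ** transpose g"
  have B: "B \<in> spin9_algebra" unfolding B_def by (rule Ad_spin9_algebra[OF g A])
  then obtain c where c: "spin9_curve c B" using spin9_curve_exists by blast
  have Bg: "B ** g = g ** A" using g by (simp add: B_def Spin9_orthogonal flip: matrix_mul_assoc)
  have bl: "bounded_linear (\<lambda>(h :: oct_matrix, z :: oct_plane). (C ** h, C *v z))" for C :: oct_matrix
    unfolding split_beta
    by (intro bounded_linear_Pair bounded_linear_compose[OF mm.bounded_linear_right bounded_linear_fst]
        bounded_linear_compose[OF mv.bounded_linear_right bounded_linear_snd])
  have "affine_flow G (\<lambda>t (h, z). (c t ** h, c t *v z)) (\<lambda>t. (0, t *\<^sub>R (u - B *v y)))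
      (\<lambda>(h, z). (B ** h, B *v z)) (0, u - B *v y)"
    unfolding affine_flow_def
  proof (intro conjI allI ballI bl)
    show "(case z of (h, z) \<Rightarrow> (c t ** h, c t *v z)) + (0, t *\<^sub>R (u - B *v y)) \<in> G" if "z \<in> G" for t z
      using that c by (auto simp: G_def spin9_curve_def Spin9_mult)
    show "((\<lambda>t. case z of (h, z) \<Rightarrow> (c t ** h, c t *v z)) has_vector_derivative (case z of (h, z) \<Rightarrow> (B ** h, B *v z))) (at 0)"
      for z :: "oct_matrix \<times> oct_plane"
      unfolding split_beta by (rule has_vector_derivative_Pair[OF spin9_curve_apply(1)[OF c] spin9_curve_apply(2)[OF c]])
    show "((\<lambda>t. (0, t *\<^sub>R (u - B *v y))) has_vector_derivative (0, u - B *v y)) (at 0)"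
      by (intro has_vector_derivative_Pair) (auto intro!: derivative_eq_intros)
    show "(case z of (h, z) \<Rightarrow> (B ** h, B *v z)) + (0, u - B *v y) \<in> tangent_space G z" if "z \<in> G" for z
    proof -
      obtain h s where z: "z = (h, s)" and h: "h \<in> Spin9" using \<open>z \<in> G\<close> by (auto simp: G_def)
      have "transpose h ** B ** h \<in> spin9_algebra"
        using Ad_spin9_algebra[OF Spin9_transpose[OF h] B] by simp
      moreover have "B ** h = h ** (transpose h ** B ** h)"
        using h by (simp flip: matrix_mul_assoc)
      ultimately show ?thesis unfolding z tangent_space_G[OF h] by auto
    qed
  qed (use c in \<open>auto simp: spin9_curve_def zero_prod_def\<close>)
  moreover have "(case x of (h, z) \<Rightarrow> (B ** h, B *v z)) + (0, u - B *v y) = v"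
    by (simp add: x v Bg)
  ultimately show "\<exists>K k K' k'. affine_flow G K k K' k' \<and> K' x + k' = v" by blast
qed

lemma affine_homogeneous_sphere_bundle: "affine_homogeneous sphere_bundle"
  unfolding affine_homogeneous_def
proof (intro conjI ballI)
  fix x assume "x \<in> sphere_bundle"
  then obtain y v where x: "x = (y, v)" and v: "v \<in> sphere 0 1" by (auto simp: sphere_bundle_def)
  show "subspace (tangent_space sphere_bundle x)"
    unfolding x tangent_space_sphere_bundle[OF v]
    by (auto intro!: subspaceI simp: inner_add_left zero_prod_def)
  fix p assume "p \<in> tangent_space sphere_bundle x"
  then obtain u w where p: "p = (u, w)" and w: "w \<bullet> v = 0"
    unfolding x tangent_space_sphere_bundle[OF v] by blast
  obtain B where B: "B \<in> spin9_algebra" and Bv: "B *v v = w" using tangent_direction_sphere[OF v w] by blast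
  obtain c where c: "spin9_curve c B" using spin9_curve_exists[OF B] by blast
  have bl: "bounded_linear (\<lambda>(z :: oct_plane, s :: oct_plane). (C *v z, C *v s))" for C :: oct_matrix
    unfolding split_beta
    by (intro bounded_linear_Pair bounded_linear_compose[OF mv.bounded_linear_right bounded_linear_fst]
        bounded_linear_compose[OF mv.bounded_linear_right bounded_linear_snd])
  have "affine_flow sphere_bundle (\<lambda>t (z, s). (c t *v z, c t *v s)) (\<lambda>t. (t *\<^sub>R (u - B *v y), 0))
      (\<lambda>(z, s). (B *v z, B *v s)) (u - B *v y, 0)"
    unfolding affine_flow_def
  proof (intro conjI allI ballI bl)
    show "(case z of (z, s) \<Rightarrow> (c t *v z, c t *v s)) + (t *\<^sub>R (u - B *v y), 0) \<in> sphere_bundle" if "z \<in> sphere_bundle" for t z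
      using that c Spin9_sphere[of "c t"] by (auto simp: sphere_bundle_def spin9_curve_def)
    show "((\<lambda>t. case z of (z, s) \<Rightarrow> (c t *v z, c t *v s)) has_vector_derivative (case z of (z, s) \<Rightarrow> (B *v z, B *v s))) (at 0)" for z
      unfolding split_beta by (rule has_vector_derivative_Pair[OF spin9_curve_apply(2)[OF c] spin9_curve_apply(2)[OF c]])
    show "((\<lambda>t. (t *\<^sub>R (u - B *v y), 0)) has_vector_derivative (u - B *v y, 0)) (at 0)"
      by (intro has_vector_derivative_Pair) (auto intro!: derivative_eq_intros)
    show "(case z of (z, s) \<Rightarrow> (B *v z, B *v s)) + (u - B *v y, 0) \<in> tangent_space sphere_bundle z" if "z \<in> sphere_bundle" for z
    proof -
      obtain r s where z: "z = (r, s)" and s: "s \<in> sphere 0 1" using \<open>z \<in> sphere_bundle\<close> by (auto simp: sphere_bundle_def)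
      have "(B *v s) \<bullet> s = 0" using skew_inner[OF B, of s s] by (simp add: inner_commute)
      then show ?thesis unfolding z tangent_space_sphere_bundle[OF s] by simp
    qed
  qed (use c in \<open>auto simp: spin9_curve_def zero_prod_def\<close>)
  moreover have "(case x of (z, s) \<Rightarrow> (B *v z, B *v s)) + (u - B *v y, 0) = p"
    by (simp add: x p Bv)
  ultimately show "\<exists>K k K' k'. affine_flow sphere_bundle K k K' k' \<and> K' x + k' = p" by blast
qed


section \<open>Left-invariant forms\<close>

text \<open>
  The differential of left multiplication by an element with the matrix \<open>g\<close>.
\<close>

definition transl :: "oct_matrix \<Rightarrow> oct_matrix \<times> oct_plane \<Rightarrow> oct_matrix \<times> oct_plane" where
  "transl g v = (g ** fst v, g *v snd v)"

definition lieG :: "(oct_matrix \<times> oct_plane) set" where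
  "lieG = spin9_algebra \<times> UNIV"

lemma bounded_linear_transl: "bounded_linear (transl g)"
  unfolding transl_def[abs_def]
  by (intro bounded_linear_Pair bounded_linear_compose[OF mm.bounded_linear_right bounded_linear_fst]
      bounded_linear_compose[OF mv.bounded_linear_right bounded_linear_snd])

lemma transl_mult: "transl g (transl h v) = transl (g ** h) v"
  by (simp add: transl_def matrix_mul_assoc matrix_vector_mul_assoc)

lemma transl_one [simp]: "transl (mat 1) v = v"
  by (simp add: transl_def)

lemma transl_cancel [simp]:
  assumes "g \<in> Spin9"
  shows "transl (transpose g) (transl g v) = v" "transl g (transl (transpose g) v) = v"
  by (simp_all add: transl_mult Spin9_orthogonal[OF assms])

lemma subspace_lieG: "subspace lieG"
  unfolding lieG_def by (intro subspace_Times subspace_spin9_algebra subspace_UNIV)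

lemma tangent_space_G_iff:
  assumes g: "g \<in> Spin9"
  shows "v \<in> tangent_space G (g, x) \<longleftrightarrow> transl (transpose g) v \<in> lieG"
proof
  assume "v \<in> tangent_space G (g, x)"
  then obtain A u where "v = (g ** A, u)" "A \<in> spin9_algebra" unfolding tangent_space_G[OF g] by blast
  then show "transl (transpose g) v \<in> lieG" using g by (simp add: transl_def lieG_def)
next
  assume "transl (transpose g) v \<in> lieG"
  then have "transpose g ** fst v \<in> spin9_algebra" by (simp add: transl_def lieG_def)
  moreover have "v = (g ** (transpose g ** fst v), snd v)" using g by simp
  ultimately show "v \<in> tangent_space G (g, x)" unfolding tangent_space_G[OF g] by blast
qed

lemma tangent_space_G_one: "tangent_space G (mat 1, 0) = lieG"
  using tangent_space_G_iff[OF Spin9_one, of _ 0] by (auto simp: transpose_mat)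

lemma one_in_G: "(mat 1, 0) \<in> G"
  by (simp add: G_def Spin9_one)

lemma G_mult_affine: "G_mult a = (\<lambda>y. transl (fst a) y + (0, snd a))"
  by (auto simp: G_mult_def transl_def fun_eq_iff split_beta)

lemma G_mult_closed: "a \<in> G \<Longrightarrow> y \<in> G \<Longrightarrow> transl (fst a) y + (0, snd a) \<in> G"
  by (auto simp: G_def transl_def Spin9_mult)

text \<open>
  The form which arises from \<open>f\<close> by left translation to the points of \<open>G\<close>. The inverse of a group
  element is written as its transpose, which extends polynomially to all matrices.
\<close>

definition left_form :: "((oct_matrix \<times> oct_plane) list \<Rightarrow> real) \<Rightarrow> real G_form" where
  "left_form f x = (if x \<in> G then pull_alt (tangent_space G x) (transl (transpose (fst x))) f else (\<lambda>vs. 0))"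

lemma left_form_one: "(\<And>vs. \<not> set vs \<subseteq> lieG \<Longrightarrow> f vs = 0) \<Longrightarrow> left_form f (mat 1, 0) = f"
  by (rule ext) (simp add: left_form_def one_in_G tangent_space_G_one pull_alt_def transpose_mat map_idI)

lemma left_form_cong:
  assumes "\<And>vs. set vs \<subseteq> lieG \<Longrightarrow> f vs = f' vs"
  shows "left_form f = left_form f'"
proof (intro ext)
  fix x vs
  have "set (map (transl (transpose (fst x))) vs) \<subseteq> lieG" if "x \<in> G" "set vs \<subseteq> tangent_space G x"
    using that tangent_space_G_iff[of "fst x" _ "snd x"] by (auto simp: G_def)
  then show "left_form f x vs = left_form f' x vs"
    using assms by (simp add: left_form_def pull_alt_def)
qed

lemma left_form_invariant:
  assumes f: "f \<in> alt_forms lieG"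
  shows "left_form f \<in> left_invariant_forms"
  unfolding invariant_forms_def
proof (intro CollectI conjI ballI)
  show "left_form f \<in> forms G"
  proof (rule forms_of_frame[OF _ f subspace_lieG])
    show "left_form f x vs = 0" if "\<not> (x \<in> G \<and> set vs \<subseteq> tangent_space G x)" for x vs
      using that by (auto simp: left_form_def pull_alt_def)
    show "subspace (tangent_space G x)" if "x \<in> G" for x
      using affine_homogeneous_G that by (simp add: affine_homogeneous_def)
    have bl: "bounded_linear (\<lambda>y :: oct_matrix \<times> oct_plane. transl (transpose (fst y)) w)" for w
    proof -
      have t: "bounded_linear (\<lambda>y :: oct_matrix \<times> oct_plane. transpose (fst y))"
        using bounded_linear_compose[OF linear_transpose[unfolded linear_conv_bounded_linear] bounded_linear_fst] .
      show ?thesis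
        unfolding transl_def
        by (rule bounded_linear_Pair[OF bounded_linear_compose[OF mm.bounded_linear_left t]
              bounded_linear_compose[OF mv.bounded_linear_left t]])
    qed
    have 1: "\<forall>w. smooth_on UNIV (\<lambda>y :: oct_matrix \<times> oct_plane. transl (transpose (fst y)) w)"
      by (intro allI smooth_on_linear_map[OF open_UNIV bl])
    have 2: "\<forall>y\<in>UNIV \<inter> G. transl (transpose (fst y)) ` tangent_space G y \<subseteq> lieG"
      using tangent_space_G_iff by (auto simp: G_def)
    have 3: "\<forall>y\<in>UNIV \<inter> G. \<forall>vs. set vs \<subseteq> tangent_space G y \<longrightarrow>
        left_form f y vs = f (map (transl (transpose (fst y))) vs)"
      by (auto simp: left_form_def pull_alt_def)
    show "\<exists>U \<kappa>. open U \<and> x \<in> U \<and> (\<forall>y\<in>U. linear (\<kappa> y)) \<and> (\<forall>w. smooth_on U (\<lambda>y. \<kappa> y w)) \<and>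
      (\<forall>y\<in>U \<inter> G. \<kappa> y ` tangent_space G y \<subseteq> lieG) \<and>
      (\<forall>y\<in>U \<inter> G. \<forall>vs. set vs \<subseteq> tangent_space G y \<longrightarrow> left_form f y vs = f (map (\<kappa> y) vs))" for x
      by (rule exI[of _ UNIV], rule exI[of _ "\<lambda>y. transl (transpose (fst y))"])
        (intro conjI ballI 1 2 3 open_UNIV UNIV_I bounded_linear.linear[OF bounded_linear_transl])
  qed
  fix a assume a: "a \<in> G"
  then have ga: "fst a \<in> Spin9" by (auto simp: G_def)
  show "pullback G (G_mult a) (left_form f) = left_form f"
  proof (intro ext)
    fix x vs
    show "pullback G (G_mult a) (left_form f) x vs = left_form f x vs"
    proof (cases "x \<in> G \<and> set vs \<subseteq> tangent_space G x")
      case True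
      then have gx: "fst x \<in> Spin9" by (auto simp: G_def)
      have "set (map (transl (fst a)) vs) \<subseteq> tangent_space G (transl (fst a) x + (0, snd a))"
        using tangent_space_affine[where M = G and x = x, OF bounded_linear_transl G_mult_closed[OF a]] True by auto
      moreover have "transl (transpose (fst a ** fst x)) (transl (fst a) v) = transl (transpose (fst x)) v" for v
        using ga by (simp add: matrix_transpose_mul flip: transl_mult)
      then have "map (transl (transpose (fst a ** fst x))) (map (transl (fst a)) vs) = map (transl (transpose (fst x))) vs"
        by simp
      moreover have "fst (transl (fst a) x + (0, snd a)) = fst a ** fst x" by (simp add: transl_def)
      ultimately show ?thesis
        using True G_mult_closed[OF a, of x]
        by (simp add: G_mult_affine pullback_affine[OF bounded_linear_transl] left_form_def pull_alt_def del: map_map)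
    next
      case False
      then show ?thesis
        by (auto simp: G_mult_affine pullback_affine[OF bounded_linear_transl] left_form_def pull_alt_def)
    qed
  qed
qed

lemma left_invariant_alt: "\<omega> \<in> left_invariant_forms \<Longrightarrow> \<omega> (mat 1, 0) \<in> alt_forms lieG"
  using forms_alt[OF _ one_in_G] by (simp add: invariant_forms_def tangent_space_G_one)

lemma left_invariant_eq:
  assumes \<omega>: "\<omega> \<in> left_invariant_forms"
  shows "\<omega> = left_form (\<omega> (mat 1, 0))"
proof (intro ext)
  fix x vs
  show "\<omega> x vs = left_form (\<omega> (mat 1, 0)) x vs"
  proof (cases "x \<in> G")
    case True
    then have gx: "fst x \<in> Spin9" by (auto simp: G_def)
    let ?a = "(transpose (fst x), - (transpose (fst x) *v snd x))"
    have "?a \<in> G" using gx by (simp add: G_def Spin9_transpose)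
    then have "\<omega> = pullback G (G_mult ?a) \<omega>"
      using \<omega> unfolding invariant_forms_def by simp
    from fun_cong[OF this, of x] have "\<omega> x = pullback G (\<lambda>y. transl (fst ?a) y + (0, snd ?a)) \<omega> x"
      unfolding G_mult_affine .
    also have "\<dots> = pull_alt (tangent_space G x) (transl (transpose (fst x)))
        (\<omega> (transl (transpose (fst x)) x + (0, - (transpose (fst x) *v snd x))))"
      using True by (simp only: pullback_affine[OF bounded_linear_transl] if_True fst_conv snd_conv)
    also have "transl (transpose (fst x)) x + (0, - (transpose (fst x) *v snd x)) = (mat 1, 0)"
      using gx by (simp add: transl_def Spin9_orthogonal)
    finally show ?thesis using True by (simp add: left_form_def)
  next
    case False
    then show ?thesis using \<omega> forms_off[of \<omega> G x vs] by (simp add: invariant_forms_def left_form_def)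
  qed
qed

lemma left_form_add: "left_form (f + g) = left_form f + left_form g"
  by (auto simp: fun_eq_iff left_form_def pull_alt_def)

lemma left_form_scale: "left_form (\<lambda>vs. c * f vs) = form_scale c (left_form f)"
  by (auto simp: fun_eq_iff left_form_def pull_alt_def form_scale_def)

lemma left_form_ext_prod: "left_form (ext_prod f g) = left_form f \<and>\<^sub>\<real> left_form g"
  by (rule ext) (auto simp: wedge_eq_ext_prod left_form_def ext_prod_pull_alt ext_prod_zero_left)

lemma left_form_ext_one: "left_form ext_one = unit_form G"
  by (auto simp: fun_eq_iff left_form_def pull_alt_def ext_one_def unit_form_def)

lemma left_invariant_iff: "\<omega> \<in> left_invariant_forms \<longleftrightarrow> (\<exists>f\<in>alt_forms lieG. \<omega> = left_form f)"
  using left_form_invariant left_invariant_eq left_invariant_alt by blast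

lemma left_invariant_closed:
  shows "\<omega> \<in> left_invariant_forms \<Longrightarrow> \<eta> \<in> left_invariant_forms \<Longrightarrow> \<omega> + \<eta> \<in> left_invariant_forms"
    and "\<omega> \<in> left_invariant_forms \<Longrightarrow> form_scale c \<omega> \<in> left_invariant_forms"
    and "\<omega> \<in> left_invariant_forms \<Longrightarrow> \<eta> \<in> left_invariant_forms \<Longrightarrow> \<omega> \<and>\<^sub>\<real> \<eta> \<in> left_invariant_forms"
    and "unit_form G \<in> left_invariant_forms"
proof -
  show "\<omega> + \<eta> \<in> left_invariant_forms" if "\<omega> \<in> left_invariant_forms" "\<eta> \<in> left_invariant_forms"
    using that alt_add unfolding left_invariant_iff by (metis left_form_add)
  show "form_scale c \<omega> \<in> left_invariant_forms" if "\<omega> \<in> left_invariant_forms"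
    using that alt_scale unfolding left_invariant_iff by (metis left_form_scale)
  show "\<omega> \<and>\<^sub>\<real> \<eta> \<in> left_invariant_forms" if "\<omega> \<in> left_invariant_forms" "\<eta> \<in> left_invariant_forms"
    using that ext_prod_alt[OF _ _ subspace_lieG] unfolding left_invariant_iff by (metis left_form_ext_prod)
  show "unit_form G \<in> left_invariant_forms"
    unfolding left_invariant_iff using alt_ext_one left_form_ext_one by metis
qed


section \<open>Coordinates and generation\<close>

text \<open>
  The indices of the forms \<open>\<theta>\<^sub>k\<^sup>a\<close>, of the first column of the Maurer-Cartan form, and of its entries
  \<open>\<phi>\<^sub>1\<^sub>1\<^sup>a\<^sup>b\<close>. The sets \<open>hor_coords\<close> and \<open>ver_coords\<close> below select a basis.
\<close>

datatype coord = Theta "2 \<times> 8" | Phi "2 \<times> 8" | Psi 8 8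

fun coord_fun :: "coord \<Rightarrow> oct_matrix \<times> oct_plane \<Rightarrow> real" where
  "coord_fun (Theta i) v = snd v $ i"
| "coord_fun (Phi i) v = fst v $ i $ (0, 0)"
| "coord_fun (Psi a b) v = fst v $ (1, a) $ (1, b)"

definition hor_of :: "oct_plane \<Rightarrow> oct_matrix" where
  "hor_of y = hor_matrix (oct_comp 0 y) (oct_comp 1 y)"

text \<open>
  A basis of the Lie algebra of \<open>G\<close> which is dual to the coordinates in \<open>hor_coords\<close> and \<open>ver_coords\<close>.
\<close>

fun coord_vec :: "coord \<Rightarrow> oct_matrix \<times> oct_plane" where
  "coord_vec (Theta i) = (0, axis i 1)"
| "coord_vec (Phi i) = (hor_of (axis i 1), 0)"
| "coord_vec (Psi a b) = (ver_matrix a b, 0)"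

definition hor_coords :: "coord set" where
  "hor_coords = range Theta \<union> {Phi i | i. i \<noteq> (0, 0)}"

definition ver_coords :: "coord set" where
  "ver_coords = {Psi a b | a b. 1 \<le> b \<and> b < a}"

definition coord_form :: "coord \<Rightarrow> real G_form" where
  "coord_form c = left_form (alt_one lieG (coord_fun c))"

definition coord_proj :: "coord set \<Rightarrow> oct_matrix \<times> oct_plane \<Rightarrow> oct_matrix \<times> oct_plane" where
  "coord_proj S v = (\<Sum>c\<in>S. coord_fun c v *\<^sub>R coord_vec c)"

text \<open>
  The projection of the Lie algebra along the span of the elements \<open>ver_matrix a b\<close>; on elements of
  the Lie algebra it agrees with \<open>coord_proj hor_coords\<close>.
\<close>

definition hor_proj :: "oct_matrix \<times> oct_plane \<Rightarrow> oct_matrix \<times> oct_plane" where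
  "hor_proj v = (hor_of (fst v *v E0), snd v)"

lemma finite_coords: "finite hor_coords" "finite ver_coords"
proof -
  show "finite hor_coords"
    by (rule finite_subset[of _ "range Theta \<union> range Phi"]) (auto simp: hor_coords_def)
  show "finite ver_coords"
    unfolding ver_coords_def by (rule finite_subset[of _ "(\<lambda>(a, b). Psi a b) ` UNIV"]) auto
qed

lemma linear_hor_of: "linear hor_of"
  by (rule linearI) (simp_all add: hor_of_def oct_comp_linear hor_matrix_linear)

lemma hor_of_E0 [simp]: "hor_of y *v E0 = y"
  by (simp add: hor_of_def hor_matrix_E0)

lemma hor_of_algebra: "y $ (0, 0) = 0 \<Longrightarrow> hor_of y \<in> spin9_algebra"
  unfolding hor_of_def by (rule hor_matrix_algebra) (simp add: oct_comp_def)

lemma linear_hor_proj: "linear hor_proj"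
  by (rule linearI) (simp_all add: hor_proj_def mv.add_left mv.scaleR_left linear_add[OF linear_hor_of]
      linear_scale[OF linear_hor_of])

lemma lieG_E0: "v \<in> lieG \<Longrightarrow> (fst v *v E0) $ (0, 0) = 0"
  using E0_orthogonal[of "fst v"] by (auto simp: lieG_def E0_eq simp flip: axis_pair(1)) (simp add: inner_axis)

lemma hor_proj_lieG: "v \<in> lieG \<Longrightarrow> hor_proj v \<in> lieG"
  using hor_of_algebra[OF lieG_E0] by (simp add: hor_proj_def lieG_def)

lemma hor_proj_idem [simp]: "hor_proj (hor_proj v) = hor_proj v"
  by (simp add: hor_proj_def)

lemma imaginary_index: "1 \<le> b \<Longrightarrow> b \<noteq> 0" "b \<noteq> 0 \<Longrightarrow> 1 \<le> b" "b < a \<Longrightarrow> a \<noteq> 0" for a b :: 8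
proof -
  have nonneg: "0 \<le> Rep_bit0 c" for c :: 8 using bit0.Rep_mod bit0.size0 pos_mod_sign by metis
  show "1 \<le> b \<Longrightarrow> b \<noteq> 0"
    by (auto simp: less_eq_bit0_def bit0.Rep_0 bit0.Rep_1)
  show "b \<noteq> 0 \<Longrightarrow> 1 \<le> b"
    using nonneg[of b] by (auto simp: less_eq_bit0_def bit0.Rep_0 bit0.Rep_1 bit0.Rep_inject_sym)
  show "b < a \<Longrightarrow> a \<noteq> 0"
    using nonneg[of b] by (auto simp: less_bit0_def bit0.Rep_0)
qed

lemma hor_of_entry:
  assumes y: "y $ (0, 0) = 0" and "a \<noteq> 0" "b \<noteq> 0"
  shows "hor_of y $ (1, a) $ (1, b) = 0"
proof -
  have w: "oct_comp 0 y $ 0 = 0" using y by (simp add: oct_comp_def)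
  show ?thesis
    unfolding matrix_entry axis_pair hor_of_def hor_matrix_apply imaginary_anticommutator[OF w]
    using assms by (simp add: oct_mult.zero_left oct_basis_nth)
qed

lemma coord_proj_hor:
  assumes v: "v \<in> lieG"
  shows "coord_proj hor_coords v = hor_proj v"
proof -
  have d: "coord_proj hor_coords v = (\<Sum>c\<in>range Theta. coord_fun c v *\<^sub>R coord_vec c) +
      (\<Sum>c\<in>Phi ` (UNIV - {(0, 0)}). coord_fun c v *\<^sub>R coord_vec c)"
  proof -
    have eq: "hor_coords = range Theta \<union> Phi ` (UNIV - {(0, 0)})" by (auto simp: hor_coords_def)
    show ?thesis unfolding coord_proj_def eq by (rule sum.union_disjoint) auto
  qed
  have ex: "(\<Sum>i\<in>UNIV. y $ i *\<^sub>R axis i 1) = y" for y :: oct_plane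
    using basis_expansion[of y] by (simp add: scalar_mult_eq_scaleR)
  have "(\<Sum>c\<in>range Theta. coord_fun c v *\<^sub>R coord_vec c) = (0, snd v)"
  proof -
    have "(\<Sum>c\<in>range Theta. coord_fun c v *\<^sub>R coord_vec c) = (\<Sum>i\<in>UNIV. (0, snd v $ i *\<^sub>R axis i 1))"
      by (subst sum.reindex) (auto simp: inj_on_def)
    also have "\<dots> = (0, \<Sum>i\<in>UNIV. snd v $ i *\<^sub>R axis i 1)" by (simp add: prod_eq_iff fst_sum snd_sum)
    finally show ?thesis by (simp only: ex)
  qed
  moreover have "(\<Sum>c\<in>Phi ` (UNIV - {(0, 0)}). coord_fun c v *\<^sub>R coord_vec c) = (hor_of (fst v *v E0), 0)"
  proof -
    let ?y = "fst v *v E0"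
    have "(\<Sum>c\<in>Phi ` (UNIV - {(0, 0)}). coord_fun c v *\<^sub>R coord_vec c) =
        (\<Sum>i\<in>UNIV - {(0, 0)}. (?y $ i *\<^sub>R hor_of (axis i 1), 0))"
      by (subst sum.reindex) (auto simp: inj_on_def column_E0)
    also have "\<dots> = (\<Sum>i\<in>UNIV - {(0, 0)}. ?y $ i *\<^sub>R hor_of (axis i 1), 0)"
      by (simp add: prod_eq_iff fst_sum snd_sum)
    also have "(\<Sum>i\<in>UNIV - {(0, 0)}. ?y $ i *\<^sub>R hor_of (axis i 1)) = (\<Sum>i\<in>UNIV. ?y $ i *\<^sub>R hor_of (axis i 1))"
      by (rule sum.mono_neutral_left) (auto simp: lieG_E0[OF v])
    also have "\<dots> = hor_of (\<Sum>i\<in>UNIV. ?y $ i *\<^sub>R axis i 1)"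
      by (simp add: linear_sum[OF linear_hor_of] linear_scale[OF linear_hor_of])
    finally show ?thesis by (simp only: ex)
  qed
  ultimately show ?thesis unfolding d by (simp add: hor_proj_def)
qed

lemma coord_vec_lieG: "c \<in> hor_coords \<union> ver_coords \<Longrightarrow> coord_vec c \<in> lieG"
proof -
  assume c: "c \<in> hor_coords \<union> ver_coords"
  show ?thesis
  proof (cases c)
    case (Theta i)
    then show ?thesis by (simp add: lieG_def subspace_0[OF subspace_spin9_algebra])
  next
    case (Phi i)
    then have "i \<noteq> (0, 0)" using c by (auto simp: hor_coords_def ver_coords_def)
    then show ?thesis using Phi hor_of_algebra[of "axis i 1"] by (simp add: lieG_def axis_def)
  next
    case (Psi a b)
    then have "1 \<le> b \<and> b < a" using c by (auto simp: hor_coords_def ver_coords_def)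
    then show ?thesis using Psi ver_matrix_algebra[of a b] imaginary_index by (auto simp: lieG_def)
  qed
qed

lemma linear_coord_fun: "linear (coord_fun c)"
  by (cases c) (auto intro!: linearI)

lemma linear_coord_proj: "linear (coord_proj S)"
  by (rule linearI) (simp_all add: coord_proj_def linear_add[OF linear_coord_fun] linear_scale[OF linear_coord_fun]
      scaleR_add_left sum.distrib scaleR_sum_right)

lemma coord_proj_lieG: "S \<subseteq> hor_coords \<union> ver_coords \<Longrightarrow> coord_proj S v \<in> lieG"
  unfolding coord_proj_def
  by (intro subspace_sum subspace_scale subspace_lieG coord_vec_lieG) auto

text \<open>
  The difference of both sides has vanishing coordinates, so that \<open>spin9_algebra_eq_0\<close> applies.
\<close>

lemma coord_proj_all:
  assumes v: "v \<in> lieG"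
  shows "coord_proj (hor_coords \<union> ver_coords) v = v"
proof -
  let ?A = "fst v"
  let ?I = "{(a, b). 1 \<le> b \<and> b < a} :: (8 \<times> 8) set"
  have A: "?A \<in> spin9_algebra" using v by (auto simp: lieG_def)
  have "coord_proj (hor_coords \<union> ver_coords) v = hor_proj v + coord_proj ver_coords v"
    unfolding coord_proj_hor[OF v, symmetric] coord_proj_def
    by (rule sum.union_disjoint[OF finite_coords]) (auto simp: hor_coords_def ver_coords_def)
  also have "coord_proj ver_coords v = (\<Sum>(a, b)\<in>?I. ?A $ (1, a) $ (1, b) *\<^sub>R ver_matrix a b, 0)"
  proof -
    have ve: "ver_coords = (\<lambda>(a, b). Psi a b) ` ?I" by (auto simp: ver_coords_def)
    have "coord_proj ver_coords v = (\<Sum>i\<in>?I. case i of (a, b) \<Rightarrow> (?A $ (1, a) $ (1, b) *\<^sub>R ver_matrix a b, 0))"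
      unfolding coord_proj_def ve by (subst sum.reindex) (auto simp: inj_on_def intro!: sum.cong)
    then show ?thesis by (simp add: prod_eq_iff fst_sum snd_sum split_beta)
  qed
  finally have eq: "coord_proj (hor_coords \<union> ver_coords) v =
      (hor_of (?A *v E0) + (\<Sum>(a, b)\<in>?I. ?A $ (1, a) $ (1, b) *\<^sub>R ver_matrix a b), snd v)"
    by (simp add: hor_proj_def)
  define V where "V = (\<Sum>(a, b)\<in>?I. ?A $ (1, a) $ (1, b) *\<^sub>R ver_matrix a b)"
  define B where "B = ?A - hor_of (?A *v E0) - V"
  have Valg: "V \<in> spin9_algebra"
    unfolding V_def using imaginary_index
    by (intro subspace_sum subspace_spin9_algebra) (auto intro!: subspace_scale[OF subspace_spin9_algebra] ver_matrix_algebra)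
  have Balg: "B \<in> spin9_algebra"
    unfolding B_def by (intro subspace_diff subspace_spin9_algebra A Valg hor_of_algebra lieG_E0 v)
  have VE: "V *v E0 = 0"
    unfolding V_def by (simp add: mv.sum_left split_beta mv.scaleR_left ver_matrix_E0)
  have "B = 0"
  proof (rule spin9_algebra_eq_0[OF Balg])
    show "B *v E0 = 0" by (simp add: B_def mv.diff_left VE)
    \<comment> \<open>Entries above the diagonal follow by skewness.\<close>
    have lower: "B $ (1, c) $ (1, d) = 0" if "d \<noteq> 0" "d < c" for c d
    proof -
      have cd: "c \<noteq> 0" "1 \<le> d" using that imaginary_index by auto
      have "V $ (1, c) $ (1, d) = (\<Sum>(a, b)\<in>?I. ?A $ (1, a) $ (1, b) * ver_matrix a b $ (1, c) $ (1, d))"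
        by (simp add: V_def split_beta)
      also have "\<dots> = (\<Sum>i\<in>?I. if i = (c, d) then ?A $ (1, c) $ (1, d) else 0)"
      proof (rule sum.cong[OF refl])
        fix i assume "i \<in> ?I"
        then obtain a b where i: "i = (a, b)" "1 \<le> b" "b < a" by blast
        then have ab: "a \<noteq> 0" "b \<noteq> 0" using imaginary_index by auto
        have nd: "\<not> (c = b \<and> d = a)" using i(3) that(2) by (meson less_asym)
        have e: "ver_matrix a b $ (1, c) $ (1, d) = (if c = a \<and> d = b then 1 else 0)"
          unfolding ver_matrix_entry[OF ab cd(1) that(1)] if_not_P[OF nd] by (rule diff_zero)
        show "(case i of (a, b) \<Rightarrow> ?A $ (1, a) $ (1, b) * ver_matrix a b $ (1, c) $ (1, d)) =
            (if i = (c, d) then ?A $ (1, c) $ (1, d) else 0)"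
        proof (cases "c = a \<and> d = b")
          case True
          then have "(a, b) = (c, d)" "c = a" "d = b" by blast+
          then show ?thesis unfolding i(1) prod.case e by (simp only: if_True simp_thms mult_1_right)
        next
          case False
          then have "(a, b) \<noteq> (c, d)" by blast
          then show ?thesis unfolding i(1) prod.case e if_not_P[OF False] by (simp only: if_False mult_zero_right)
        qed
      qed
      also have "\<dots> = ?A $ (1, c) $ (1, d)" using cd that by (simp add: sum.delta)
      finally show ?thesis
        using hor_of_entry[OF lieG_E0[OF v] cd(1) that(1)] by (simp add: B_def)
    qed
    show "B $ (1, a) $ (1, b) = 0" if "a \<noteq> 0" "b \<noteq> 0" for a b
      using lower[OF that(2), of a] lower[OF that(1), of b] skew_entry[OF Balg, of "(1, a)" "(1, b)"]
      by (cases a b rule: linorder_cases) auto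
  qed
  then have "?A = hor_of (?A *v E0) + V" unfolding B_def by (simp add: algebra_simps)
  then show ?thesis unfolding eq V_def[symmetric] by (simp add: prod_eq_iff)
qed

text \<open>
  Generators are multiplied from the left only. Since they have degree one, the Leibniz rule then
  determines an antiderivation without a decomposition of forms into homogeneous parts.
\<close>

inductive_set word_algebra :: "'a set \<Rightarrow> ('a, real) form set \<Rightarrow> ('a, real) form set" for M S where
  unit: "unit_form M \<in> word_algebra M S"
| add: "\<omega> \<in> word_algebra M S \<Longrightarrow> \<eta> \<in> word_algebra M S \<Longrightarrow> \<omega> + \<eta> \<in> word_algebra M S"
| scale: "\<omega> \<in> word_algebra M S \<Longrightarrow> form_scale c \<omega> \<in> word_algebra M S"
| wedge: "\<omega> \<in> S \<Longrightarrow> \<eta> \<in> word_algebra M S \<Longrightarrow> \<omega> \<and>\<^sub>\<real> \<eta> \<in> word_algebra M S"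

lemma word_algebra_mono:
  assumes "S \<subseteq> T"
  shows "word_algebra M S \<subseteq> word_algebra M T"
proof
  fix \<omega> assume "\<omega> \<in> word_algebra M S"
  then show "\<omega> \<in> word_algebra M T"
  proof (induction rule: word_algebra.induct)
    case (wedge \<omega> \<eta>)
    then show ?case using assms by (intro word_algebra.wedge) auto
  qed (rule word_algebra.unit, rule word_algebra.add, assumption+, rule word_algebra.scale)
qed

lemma word_algebra_generated: "\<omega> \<in> word_algebra M S \<Longrightarrow> \<omega> \<in> generated_algebra M S"
proof (induction rule: word_algebra.induct)
  case (wedge \<omega> \<eta>)
  then show ?case by (intro generated_algebra.wedge[OF generated_algebra.gen])
qed (rule generated_algebra.unit, rule generated_algebra.add, assumption+, rule generated_algebra.scale)

lemma coord_proj_word_algebra: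
  assumes "finite S" "S \<subseteq> hor_coords \<union> ver_coords" "f \<in> alt_forms lieG"
  shows "left_form (pull_alt lieG (coord_proj S) f) \<in> word_algebra G (coord_form ` S)"
  using assms
proof (induction S arbitrary: f rule: finite_induct)
  case empty
  have "pull_alt lieG (coord_proj {}) f vs = f [] * ext_one vs" for vs
    using alt_cons_zero[OF empty(2)] by (cases vs) (simp_all add: pull_alt_def coord_proj_def ext_one_def)
  then have "pull_alt lieG (coord_proj {}) f = (\<lambda>vs. f [] * ext_one vs)" by blast
  then show ?case
    by (simp add: left_form_scale left_form_ext_one word_algebra.scale word_algebra.unit)
next
  case (insert m S)
  have m: "coord_vec m \<in> lieG" and S: "S \<subseteq> hor_coords \<union> ver_coords"
    using insert.prems coord_vec_lieG by auto
  have "coord_proj (insert m S) = (\<lambda>v. coord_proj S v + coord_fun m v *\<^sub>R coord_vec m)"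
    using insert by (simp add: coord_proj_def fun_eq_iff)
  then have "pull_alt lieG (coord_proj (insert m S)) f = pull_alt lieG (coord_proj S) f +
      ext_prod (alt_one lieG (coord_fun m)) (pull_alt lieG (coord_proj S) (contract (coord_vec m) f))"
    using split_coordinate[OF linear_coord_proj coord_proj_lieG[OF S] m subspace_lieG insert.prems(2)] by simp
  moreover have "left_form (pull_alt lieG (coord_proj S) f) \<in> word_algebra G (coord_form ` insert m S)"
      and "coord_form m \<in> coord_form ` insert m S" and "left_form (pull_alt lieG (coord_proj S) (contract (coord_vec m) f)) \<in> word_algebra G (coord_form ` insert m S)"
    using insert.IH[OF S insert.prems(2)] insert.IH[OF S contract_alt[OF insert.prems(2) m]]
      word_algebra_mono[of "coord_form ` S" "coord_form ` insert m S" G] by blast+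
  ultimately show ?case
    unfolding coord_form_def[of m]
    by (simp only: left_form_add left_form_ext_prod) (intro word_algebra.add word_algebra.wedge)
qed

lemma left_invariant_word_algebra:
  assumes "\<omega> \<in> left_invariant_forms"
  shows "\<omega> \<in> word_algebra G (coord_form ` (hor_coords \<union> ver_coords))"
proof -
  obtain f where f: "f \<in> alt_forms lieG" "\<omega> = left_form f" using assms left_invariant_iff by blast
  have "left_form (pull_alt lieG (coord_proj (hor_coords \<union> ver_coords)) f) = left_form f"
    by (rule left_form_cong) (auto simp: pull_alt_def coord_proj_all subset_iff intro!: arg_cong[of _ _ f] map_idI)
  then show ?thesis
    using coord_proj_word_algebra[OF _ subset_refl f(1)] finite_coords f(2) by simp
qed

lemma coord_form_invariant: "coord_form c \<in> left_invariant_forms"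
  unfolding coord_form_def by (intro left_form_invariant alt_one_alt linear_coord_fun subspace_lieG)


section \<open>The horizontal projection\<close>

lemma left_form_alt_one:
  "left_form (alt_one lieG l) = one_form G (\<lambda>x v. l (transl (transpose (fst x)) v))"
proof (intro ext)
  fix x vs
  have "transl (transpose (fst x)) (hd vs) \<in> lieG" if "x \<in> G" "length vs = 1" "set vs \<subseteq> tangent_space G x"
    using that tangent_space_G_iff[of "fst x" _ "snd x"] by (cases vs) (auto simp: G_def)
  then show "left_form (alt_one lieG l) x vs = one_form G (\<lambda>x v. l (transl (transpose (fst x)) v)) x vs"
    by (cases vs) (auto simp: left_form_def pull_alt_def alt_one_def one_form_def)
qed

lemma theta_entry_eq: "theta_entry k a = coord_form (Theta (k, a))"
  unfolding coord_form_def left_form_alt_one theta_entry_def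
  by (auto simp: fun_eq_iff one_form_def transl_def G_def Spin9_matrix_inv split_beta)

lemma phi_entry_eq: "phi_entry i j = left_form (alt_one lieG (\<lambda>v. fst v $ i $ j))"
  unfolding left_form_alt_one phi_entry_def
  by (auto simp: fun_eq_iff one_form_def transl_def G_def Spin9_matrix_inv split_beta)

lemma phi_col_eq: "phi_col k a = coord_form (Phi (k, a))"
proof -
  have "coord_fun (Phi (k, a)) = (\<lambda>v. fst v $ (k, a) $ (0, 0))" by (simp add: fun_eq_iff)
  then show ?thesis unfolding phi_col_def phi_entry_eq coord_form_def by simp
qed

lemma phi_entry_Psi: "phi_entry (1, a) (1, b) = coord_form (Psi a b)"
proof -
  have "coord_fun (Psi a b) = (\<lambda>v. fst v $ (1, a) $ (1, b))" by (simp add: fun_eq_iff)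
  then show ?thesis unfolding phi_entry_eq coord_form_def by simp
qed

lemma horizontal_generators_eq: "horizontal_generators = coord_form ` hor_coords"
proof -
  have k: "k = 0 \<or> k = 1" for k :: 2 using exhaust_2[of k] by auto
  show ?thesis
    unfolding horizontal_generators_def hor_coords_def theta_entry_eq phi_col_eq
    using k by (auto simp: image_iff) metis+
qed

definition horizontalize :: "real G_form \<Rightarrow> real G_form" where
  "horizontalize = (\<lambda>\<omega>\<in>left_invariant_forms. left_form (pull_alt lieG hor_proj (\<omega> (mat 1, 0))))"

lemma horizontalize_left_form:
  assumes "f \<in> alt_forms lieG"
  shows "horizontalize (left_form f) = left_form (pull_alt lieG hor_proj f)"
  using left_form_one[OF alt_formsD_off[OF assms]] left_form_invariant[OF assms]
  by (simp add: horizontalize_def)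

lemma pull_hor_alt: "f \<in> alt_forms lieG \<Longrightarrow> pull_alt lieG hor_proj f \<in> alt_forms lieG"
  using hor_proj_lieG by (intro pull_alt_alt linear_hor_proj subspace_lieG) auto

lemma horizontalize_endo: "algebra_endo G left_invariant_forms horizontalize"
  unfolding algebra_endo_def linear_on_forms_def
proof (intro conjI ballI allI funcsetI)
  fix \<omega> assume "\<omega> \<in> left_invariant_forms"
  then obtain f where f: "f \<in> alt_forms lieG" "\<omega> = left_form f" using left_invariant_iff by blast
  show "horizontalize \<omega> \<in> left_invariant_forms"
    using f by (simp add: horizontalize_left_form left_form_invariant pull_hor_alt)
  have "pull_alt lieG hor_proj (\<lambda>vs. c * f vs) = (\<lambda>vs. c * pull_alt lieG hor_proj f vs)" for c
    by (auto simp: fun_eq_iff pull_alt_def)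
  then show "horizontalize (form_scale c \<omega>) = form_scale c (horizontalize \<omega>)" for c
    using f by (simp add: horizontalize_left_form alt_scale flip: left_form_scale)
  fix \<eta> assume "\<eta> \<in> left_invariant_forms"
  then obtain g where g: "g \<in> alt_forms lieG" "\<eta> = left_form g" using left_invariant_iff by blast
  have "pull_alt lieG hor_proj (f + g) = pull_alt lieG hor_proj f + pull_alt lieG hor_proj g"
    by (auto simp: fun_eq_iff pull_alt_def)
  then show "horizontalize (\<omega> + \<eta>) = horizontalize \<omega> + horizontalize \<eta>"
    using f g by (simp add: horizontalize_left_form alt_add flip: left_form_add)
  show "horizontalize (\<omega> \<and>\<^sub>\<real> \<eta>) = horizontalize \<omega> \<and>\<^sub>\<real> horizontalize \<eta>"
    using f g by (simp add: horizontalize_left_form ext_prod_alt subspace_lieG ext_prod_pull_alt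
        flip: left_form_ext_prod)
next
  have "pull_alt lieG hor_proj ext_one = ext_one"
    by (auto simp: fun_eq_iff pull_alt_def ext_one_def)
  then show "horizontalize (unit_form G) = unit_form G"
    using horizontalize_left_form[OF alt_ext_one[of lieG]] by (simp add: left_form_ext_one)
qed

lemma horizontalize_coord_form:
  assumes "\<And>v. v \<in> lieG \<Longrightarrow> coord_fun c (hor_proj v) = l v"
  shows "horizontalize (coord_form c) = left_form (alt_one lieG l)"
  unfolding coord_form_def horizontalize_left_form[OF alt_one_alt[OF linear_coord_fun subspace_lieG]]
proof (rule left_form_cong)
  fix vs assume "set vs \<subseteq> lieG"
  then show "pull_alt lieG hor_proj (alt_one lieG (coord_fun c)) vs = alt_one lieG l vs"
    using assms hor_proj_lieG by (cases vs) (auto simp: pull_alt_def alt_one_def)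
qed

lemma horizontalize_hor:
  assumes "c \<in> hor_coords"
  shows "horizontalize (coord_form c) = coord_form c"
  using assms horizontalize_coord_form[of c "coord_fun c"]
  by (auto simp: hor_coords_def hor_proj_def coord_form_def column_E0)

lemma horizontalize_ver:
  assumes "a \<noteq> 0" "b \<noteq> 0"
  shows "horizontalize (coord_form (Psi a b)) = 0"
proof -
  have "horizontalize (coord_form (Psi a b)) = left_form (alt_one lieG (\<lambda>v. 0))"
    by (rule horizontalize_coord_form) (simp add: hor_proj_def hor_of_entry lieG_E0 assms)
  also have "\<dots> = 0"
    by (auto simp: fun_eq_iff left_form_def pull_alt_def alt_one_def)
  finally show ?thesis .
qed

lemma is_horizontal_projection_horizontalize: "is_horizontal_projection horizontalize"
  unfolding is_horizontal_projection_def
proof (intro conjI ballI allI impI)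
  show "horizontalize \<in> extensional left_invariant_forms" by (simp add: horizontalize_def)
  show "algebra_endo G left_invariant_forms horizontalize" by (rule horizontalize_endo)
  show "horizontalize \<omega> = \<omega>" if "\<omega> \<in> horizontal_generators" for \<omega>
    using that horizontalize_hor unfolding horizontal_generators_eq by blast
  show "horizontalize (phi_entry (1, a) (1, b)) = 0" if "1 \<le> b \<and> b < a" for a b
    unfolding phi_entry_Psi using that imaginary_index by (intro horizontalize_ver) auto
qed

lemma is_horizontal_projection_unique:
  assumes h: "is_horizontal_projection h"
  shows "h = horizontalize"
proof (rule extensionalityI)
  let ?A = left_invariant_forms
  note k = is_horizontal_projection_horizontalize
  show "h \<in> extensional ?A" "horizontalize \<in> extensional ?A"
    using h k unfolding is_horizontal_projection_def by blast+
  have e: "algebra_endo G ?A h" using h by (simp add: is_horizontal_projection_def)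
  have gen: "h (coord_form c) = horizontalize (coord_form c)" if c: "c \<in> hor_coords \<union> ver_coords" for c
  proof (cases "c \<in> hor_coords")
    case True
    then show ?thesis using h k unfolding is_horizontal_projection_def horizontal_generators_eq by auto
  next
    case False
    then obtain a b where "c = Psi a b" "1 \<le> b \<and> b < a" using c unfolding ver_coords_def by blast
    then show ?thesis using h k unfolding is_horizontal_projection_def phi_entry_Psi by auto
  qed
  fix \<omega> assume "\<omega> \<in> ?A"
  then have "\<omega> \<in> word_algebra G (coord_form ` (hor_coords \<union> ver_coords))" by (rule left_invariant_word_algebra)
  then have "\<omega> \<in> ?A \<and> h \<omega> = horizontalize \<omega>"
  proof (induction rule: word_algebra.induct)
    case unit
    then show ?case using e horizontalize_endo left_invariant_closed(4) by (simp add: algebra_endo_def)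
  next
    case (add \<omega> \<eta>)
    then show ?case
      using e horizontalize_endo left_invariant_closed(1)[of \<omega> \<eta>]
      unfolding algebra_endo_def linear_on_forms_def by metis
  next
    case (scale \<omega> c)
    then show ?case
      using e horizontalize_endo left_invariant_closed(2) by (simp add: algebra_endo_def linear_on_forms_def)
  next
    case (wedge \<omega> \<eta>)
    then obtain c where c: "c \<in> hor_coords \<union> ver_coords" "\<omega> = coord_form c" by blast
    then show ?case
      using wedge gen[OF c(1)] coord_form_invariant[of c] e horizontalize_endo left_invariant_closed(3)
      by (simp add: algebra_endo_def)
  qed
  then show "h \<omega> = horizontalize \<omega>" by simp
qed

lemma horizontal_projection_eq: "horizontal_projection = horizontalize"
  unfolding horizontal_projection_def
  using is_horizontal_projection_horizontalize is_horizontal_projection_unique by blast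

text \<open>
  A form fixed by \<open>h\<close> comes from an alternating form which depends only on the horizontal
  coordinates, so that splitting off these coordinates exhausts it.
\<close>

lemma horizontal_algebra_iff:
  "\<omega> \<in> horizontal_algebra \<longleftrightarrow> \<omega> \<in> left_invariant_forms \<and> horizontalize \<omega> = \<omega>"
  "\<omega> \<in> horizontal_algebra \<longleftrightarrow> \<omega> \<in> word_algebra G (coord_form ` hor_coords)"
proof -
  have 1: "\<omega> \<in> left_invariant_forms \<and> horizontalize \<omega> = \<omega>" if "\<omega> \<in> horizontal_algebra" for \<omega>
    using that unfolding horizontal_algebra_def horizontal_generators_eq
  proof (induction rule: generated_algebra.induct)
    case (gen \<omega>)
    then show ?case using coord_form_invariant horizontalize_hor by blast
  next
    case (add \<omega> \<eta>)
    then show ?case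
      using horizontalize_endo left_invariant_closed(1)[of \<omega> \<eta>]
      unfolding algebra_endo_def linear_on_forms_def by metis
  qed (use horizontalize_endo left_invariant_closed in \<open>simp_all add: algebra_endo_def linear_on_forms_def\<close>)
  have 2: "\<omega> \<in> word_algebra G (coord_form ` hor_coords)"
    if \<omega>: "\<omega> \<in> left_invariant_forms" "horizontalize \<omega> = \<omega>" for \<omega>
  proof -
    obtain f where f: "f \<in> alt_forms lieG" "\<omega> = left_form f" using \<omega> left_invariant_iff by blast
    have "left_form (pull_alt lieG (coord_proj hor_coords) f) = left_form (pull_alt lieG hor_proj f)"
      by (rule left_form_cong) (auto simp: pull_alt_def coord_proj_hor subset_iff intro!: arg_cong[of _ _ f])
    also have "\<dots> = \<omega>" using \<omega>(2) f horizontalize_left_form by simp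
    finally show ?thesis
      using coord_proj_word_algebra[OF finite_coords(1) _ f(1)] by simp
  qed
  have 3: "\<omega> \<in> horizontal_algebra" if "\<omega> \<in> word_algebra G (coord_form ` hor_coords)" for \<omega>
    using that word_algebra_generated unfolding horizontal_algebra_def horizontal_generators_eq by blast
  show "\<omega> \<in> horizontal_algebra \<longleftrightarrow> \<omega> \<in> left_invariant_forms \<and> horizontalize \<omega> = \<omega>"
    "\<omega> \<in> horizontal_algebra \<longleftrightarrow> \<omega> \<in> word_algebra G (coord_form ` hor_coords)"
    using 1 2 3 by blast+
qed


section \<open>The exterior derivative of left-invariant forms\<close>

lemma left_invariant_forms_subset: "\<omega> \<in> left_invariant_forms \<Longrightarrow> \<omega> \<in> forms G"
  by (simp add: invariant_forms_def)

text \<open>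
  Left translations are affine maps of the ambient space and commute with \<open>d\<close>.
\<close>

lemma ext_deriv_left_invariant:
  assumes \<omega>: "\<omega> \<in> left_invariant_forms"
  shows "ext_deriv G \<omega> \<in> left_invariant_forms"
proof -
  have f: "\<omega> \<in> forms G" using \<omega> by (rule left_invariant_forms_subset)
  have "pullback G (G_mult a) (ext_deriv G \<omega>) = ext_deriv G \<omega>" if a: "a \<in> G" for a
  proof -
    have "pullback G (G_mult a) (ext_deriv G \<omega>) = ext_deriv G (pullback G (G_mult a) \<omega>)"
      unfolding G_mult_affine
      by (rule ext_deriv_pullback[OF affine_homogeneous_G affine_homogeneous_G bounded_linear_transl
            G_mult_closed[OF a] f, symmetric])
    then show ?thesis using \<omega> a by (simp add: invariant_forms_def)
  qed
  then show ?thesis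
    using ext_deriv_forms[OF affine_homogeneous_G f] unfolding invariant_forms_def by blast
qed

lemma ext_deriv_add:
  assumes "affine_homogeneous M" "\<omega> \<in> forms M" "\<zeta> \<in> forms M"
  shows "ext_deriv M (\<omega> + \<zeta>) = ext_deriv M \<omega> + ext_deriv M \<zeta>"
proof (intro ext)
  fix x vs
  have "\<omega> + \<zeta> = (\<lambda>x vs. 1 * \<omega> x vs + 1 * \<zeta> x vs)" by (intro ext) simp
  then show "ext_deriv M (\<omega> + \<zeta>) x vs = (ext_deriv M \<omega> + ext_deriv M \<zeta>) x vs"
    using ext_deriv_linear[OF assms, of 1 1 x vs] by (simp only:) simp
qed

lemma ext_deriv_scale:
  assumes "affine_homogeneous M" "\<omega> \<in> forms M"
  shows "ext_deriv M (form_scale c \<omega>) = form_scale c (ext_deriv M \<omega>)"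
proof (intro ext)
  fix x vs
  have "form_scale c \<omega> = (\<lambda>x vs. c * \<omega> x vs + 0 * \<omega> x vs)" by (intro ext) (simp add: form_scale_def)
  then show "ext_deriv M (form_scale c \<omega>) x vs = form_scale c (ext_deriv M \<omega>) x vs"
    using ext_deriv_linear[OF assms(1,2,2), of c 0 x vs] by (simp only:) (simp add: form_scale_def)
qed

lemma wedge_scale_left: "form_scale c \<omega> \<and>\<^sub>\<real> \<eta> = form_scale c (\<omega> \<and>\<^sub>\<real> \<eta>)"
  by (intro ext) (simp add: wedge_eq_ext_prod form_scale_def ext_prod_scale_left)

lemma grade_has_degree:
  assumes "has_degree k \<omega>"
  shows "(\<lambda>x. grade (\<omega> x)) = form_scale ((-1) ^ k) \<omega>"
proof (intro ext)
  fix x vs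
  show "grade (\<omega> x) vs = form_scale ((-1) ^ k) \<omega> x vs"
    using assms by (cases "\<omega> x vs = 0") (auto simp: grade_def form_scale_def has_degree_def)
qed

lemma d\<^sub>h_eq: "d\<^sub>h \<omega> = horizontalize (ext_deriv G \<omega>)"
  by (simp add: d\<^sub>h_def horizontal_projection_eq)

lemma horizontalize_horizontal:
  assumes "\<omega> \<in> left_invariant_forms"
  shows "horizontalize \<omega> \<in> horizontal_algebra"
proof -
  obtain f where f: "f \<in> alt_forms lieG" "\<omega> = left_form f" using assms left_invariant_iff by blast
  have "pull_alt lieG hor_proj (pull_alt lieG hor_proj f) = pull_alt lieG hor_proj f"
    using hor_proj_lieG by (auto simp: fun_eq_iff pull_alt_def o_def)
  then show ?thesis
    unfolding horizontal_algebra_iff(1) f(2) horizontalize_left_form[OF f(1)]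
    by (simp add: horizontalize_left_form[OF pull_hor_alt[OF f(1)]] left_form_invariant pull_hor_alt f(1))
qed

lemma antiderivation_d\<^sub>h: "antiderivation horizontal_algebra d\<^sub>h"
  unfolding antiderivation_def linear_on_forms_def
proof (intro conjI ballI allI impI funcsetI)
  note M = affine_homogeneous_G
  have H: "algebra_endo G left_invariant_forms horizontalize" by (rule horizontalize_endo)
  have inv: "\<omega> \<in> left_invariant_forms" "horizontalize \<omega> = \<omega>" "\<omega> \<in> forms G" "ext_deriv G \<omega> \<in> left_invariant_forms"
    if "\<omega> \<in> horizontal_algebra" for \<omega>
    using that left_invariant_forms_subset ext_deriv_left_invariant unfolding horizontal_algebra_iff(1) by blast+
  have add: "horizontalize (\<omega> + \<eta>) = horizontalize \<omega> + horizontalize \<eta>"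
    and scale: "horizontalize (form_scale c \<omega>) = form_scale c (horizontalize \<omega>)"
    and wedge: "horizontalize (\<omega> \<and>\<^sub>\<real> \<eta>) = horizontalize \<omega> \<and>\<^sub>\<real> horizontalize \<eta>"
    if "\<omega> \<in> left_invariant_forms" "\<eta> \<in> left_invariant_forms" for \<omega> \<eta> c
    using H that unfolding algebra_endo_def linear_on_forms_def by blast+
  fix \<omega> assume \<omega>: "\<omega> \<in> horizontal_algebra"
  show "d\<^sub>h \<omega> \<in> horizontal_algebra"
    unfolding d\<^sub>h_eq using inv(4)[OF \<omega>] by (rule horizontalize_horizontal)
  show "d\<^sub>h (form_scale c \<omega>) = form_scale c (d\<^sub>h \<omega>)" for c
    unfolding d\<^sub>h_eq ext_deriv_scale[OF M inv(3)[OF \<omega>]] by (rule scale[OF inv(4)[OF \<omega>] inv(4)[OF \<omega>]])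
  fix \<eta> assume \<eta>: "\<eta> \<in> horizontal_algebra"
  show "d\<^sub>h (\<omega> + \<eta>) = d\<^sub>h \<omega> + d\<^sub>h \<eta>"
    unfolding d\<^sub>h_eq ext_deriv_add[OF M inv(3)[OF \<omega>] inv(3)[OF \<eta>]] by (rule add[OF inv(4)[OF \<omega>] inv(4)[OF \<eta>]])
  fix k assume k: "has_degree k \<omega>"
  have 1: "ext_deriv G \<omega> \<and>\<^sub>\<real> \<eta> \<in> left_invariant_forms" "\<omega> \<and>\<^sub>\<real> ext_deriv G \<eta> \<in> left_invariant_forms"
    by (intro left_invariant_closed(3) inv \<omega> \<eta>)+
  have "ext_deriv G (\<omega> \<and>\<^sub>\<real> \<eta>) = ext_deriv G \<omega> \<and>\<^sub>\<real> \<eta> + form_scale ((-1) ^ k) (\<omega> \<and>\<^sub>\<real> ext_deriv G \<eta>)"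
    unfolding ext_deriv_wedge[OF M inv(3)[OF \<omega>] inv(3)[OF \<eta>]] grade_has_degree[OF k] wedge_scale_left ..
  then show "d\<^sub>h (\<omega> \<and>\<^sub>\<real> \<eta>) = d\<^sub>h \<omega> \<and>\<^sub>\<real> \<eta> + form_scale ((-1) ^ k) (\<omega> \<and>\<^sub>\<real> d\<^sub>h \<eta>)"
    unfolding d\<^sub>h_eq
    by (simp only: add[OF 1(1) left_invariant_closed(2)[OF 1(2)]] scale[OF 1(2) 1(2)]
        wedge[OF inv(4)[OF \<omega>] inv(1)[OF \<eta>]] wedge[OF inv(1)[OF \<omega>] inv(4)[OF \<eta>]] inv(2)[OF \<omega>] inv(2)[OF \<eta>])
qed

text \<open>
  Induction over products with a generator on the left, which has degree one. On the unit
  an antiderivation vanishes, because \<open>D 1 = D (1 \<and> 1) = 2 D 1\<close>.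
\<close>

lemma antiderivation_unique:
  assumes D: "antiderivation horizontal_algebra D" and D': "antiderivation horizontal_algebra D'"
    and gen: "\<And>\<omega>. \<omega> \<in> horizontal_generators \<Longrightarrow> D \<omega> = D' \<omega>" and \<omega>: "\<omega> \<in> horizontal_algebra"
  shows "D \<omega> = D' \<omega>"
proof -
  have E_unit: "E (unit_form G) = 0" if E: "antiderivation horizontal_algebra E" for E
  proof -
    let ?u = "unit_form G"
    have u: "?u \<in> horizontal_algebra" by (simp add: horizontal_algebra_iff(2) word_algebra.unit)
    have d: "has_degree 0 ?u" by (simp add: has_degree_def unit_form_def)
    have one: "\<eta> \<and>\<^sub>\<real> ?u = \<eta>" "?u \<and>\<^sub>\<real> \<eta> = \<eta>" if "\<eta> \<in> horizontal_algebra" for \<eta>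
    proof -
      have "\<eta> \<in> left_invariant_forms" using that by (simp only: horizontal_algebra_iff(1))
      from left_invariant_eq[OF this] obtain f where "\<eta> = left_form f" ..
      then show "\<eta> \<and>\<^sub>\<real> ?u = \<eta>" "?u \<and>\<^sub>\<real> \<eta> = \<eta>"
        unfolding left_form_ext_one[symmetric] left_form_ext_prod[symmetric]
        by (simp_all add: left_form_ext_prod[symmetric] ext_prod_one_left ext_prod_one_right)
    qed
    have Eu: "E ?u \<in> horizontal_algebra" using E u unfolding antiderivation_def by blast
    have "E (?u \<and>\<^sub>\<real> ?u) = E ?u \<and>\<^sub>\<real> ?u + form_scale ((-1) ^ 0) (?u \<and>\<^sub>\<real> E ?u)"
      using E u d unfolding antiderivation_def by blast
    moreover have "form_scale 1 \<eta> = \<eta>" for \<eta> :: "real G_form"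
      by (intro ext) (simp add: form_scale_def)
    ultimately have "E ?u = E ?u + E ?u" by (simp only: one(1)[OF u] one[OF Eu] power_0)
    then show ?thesis using add_cancel_right_right[of "E ?u" "E ?u"] by blast
  qed
  from \<omega> have "\<omega> \<in> word_algebra G (coord_form ` hor_coords)" by (simp only: horizontal_algebra_iff(2))
  then show ?thesis
  proof (induction rule: word_algebra.induct)
    case unit
    then show ?case using E_unit[OF D] E_unit[OF D'] by simp
  next
    case (add \<omega> \<eta>)
    then have "\<omega> \<in> horizontal_algebra" "\<eta> \<in> horizontal_algebra" by (simp_all only: horizontal_algebra_iff(2))
    then have "D (\<omega> + \<eta>) = D \<omega> + D \<eta>" "D' (\<omega> + \<eta>) = D' \<omega> + D' \<eta>"
      using D D' unfolding antiderivation_def linear_on_forms_def by blast+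
    then show ?case using add.IH by (simp only:)
  next
    case (scale \<omega> c)
    then have "\<omega> \<in> horizontal_algebra" by (simp only: horizontal_algebra_iff(2))
    then have "D (form_scale c \<omega>) = form_scale c (D \<omega>)" "D' (form_scale c \<omega>) = form_scale c (D' \<omega>)"
      using D D' unfolding antiderivation_def linear_on_forms_def by blast+
    then show ?case using scale.IH by (simp only:)
  next
    case (wedge \<omega> \<eta>)
    then obtain c where c: "\<omega> = coord_form c" by blast
    have d: "has_degree 1 \<omega>"
      unfolding c coord_form_def left_form_alt_one by (auto simp: has_degree_def one_form_def)
    have \<omega>: "\<omega> \<in> horizontal_algebra"
      using wedge by (simp add: horizontal_algebra_def horizontal_generators_eq generated_algebra.gen)
    have \<eta>: "\<eta> \<in> horizontal_algebra" using wedge by (simp only: horizontal_algebra_iff(2))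
    have g: "D \<omega> = D' \<omega>" using wedge gen by (simp add: horizontal_generators_eq)
    have "D (\<omega> \<and>\<^sub>\<real> \<eta>) = D \<omega> \<and>\<^sub>\<real> \<eta> + form_scale ((-1) ^ 1) (\<omega> \<and>\<^sub>\<real> D \<eta>)"
      "D' (\<omega> \<and>\<^sub>\<real> \<eta>) = D' \<omega> \<and>\<^sub>\<real> \<eta> + form_scale ((-1) ^ 1) (\<omega> \<and>\<^sub>\<real> D' \<eta>)"
      using D D' d \<omega> \<eta> unfolding antiderivation_def by blast+
    then show ?case using wedge.IH g by (simp only:)
  qed
qed


section \<open>The structure equations\<close>

text \<open>
  The value of \<open>-l\<close> on the bracket of two elements of the Lie algebra of \<open>G\<close>.
\<close>

definition mc_form :: "(oct_matrix \<times> oct_plane \<Rightarrow> real) \<Rightarrow> (oct_matrix \<times> oct_plane) list \<Rightarrow> real" where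
  "mc_form l vs = (if length vs = 2 \<and> set vs \<subseteq> lieG
     then l (transl (fst (vs ! 1)) (vs ! 0)) - l (transl (fst (vs ! 0)) (vs ! 1)) else 0)"

text \<open>
  The Maurer-Cartan equation. The form \<open>l (g\<^sup>T v)\<close> extends linearly in \<open>g\<close> to the ambient space, so its
  derivative is \<open>l (v\<^sub>1\<^sup>T v\<^sub>2) - l (v\<^sub>2\<^sup>T v\<^sub>1)\<close>; at the identity the transpose of the matrix part of a
  tangent vector is its negative.
\<close>

lemma ext_deriv_alt_one:
  assumes l: "linear l"
  shows "ext_deriv G (left_form (alt_one lieG l)) = left_form (mc_form l)"
proof (intro ext)
  fix x vs
  show "ext_deriv G (left_form (alt_one lieG l)) x vs = left_form (mc_form l) x vs"
  proof (cases "x \<in> G \<and> set vs \<subseteq> tangent_space G x")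
    case True
    then have gx: "fst x \<in> Spin9" by (auto simp: G_def)
    define \<eta> where "\<eta> y = alt_one UNIV (\<lambda>v. l (transl (transpose (fst y)) v))"
      for y :: "oct_matrix \<times> oct_plane"
    have bl: "bounded_linear (\<lambda>y :: oct_matrix \<times> oct_plane. l (transl (transpose (fst y)) w))" for w
    proof -
      have t: "bounded_linear (\<lambda>y :: oct_matrix \<times> oct_plane. transpose (fst y))"
        using bounded_linear_compose[OF linear_transpose[unfolded linear_conv_bounded_linear] bounded_linear_fst] .
      have "bounded_linear (\<lambda>y :: oct_matrix \<times> oct_plane. transl (transpose (fst y)) w)"
        unfolding transl_def
        by (rule bounded_linear_Pair[OF bounded_linear_compose[OF mm.bounded_linear_left t]
              bounded_linear_compose[OF mv.bounded_linear_left t]])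
      then show ?thesis
        by (rule bounded_linear_compose[OF l[unfolded linear_conv_bounded_linear]])
    qed
    have sm: "smooth_on UNIV (\<lambda>y. \<eta> y us)" for us
    proof (cases "length us = 1")
      case True
      then have "(\<lambda>y. \<eta> y us) = (\<lambda>y. l (transl (transpose (fst y)) (hd us)))"
        by (simp add: \<eta>_def alt_one_def)
      then show ?thesis using smooth_on_linear_map[OF open_UNIV bl] by simp
    next
      case False
      then show ?thesis by (simp add: \<eta>_def alt_one_def smooth_on_const)
    qed
    have "\<eta> y \<in> alt_forms UNIV" for y
      unfolding \<eta>_def
      by (intro alt_one_alt subspace_UNIV linear_compose[OF bounded_linear.linear[OF bounded_linear_transl] l, unfolded o_def])
    then have sf: "smooth_form UNIV \<eta>" using sm by (simp add: smooth_form_def)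
    have "local_extension G (left_form (alt_one lieG l)) x UNIV \<eta>"
      unfolding local_extension_iff left_form_alt_one
      using sf by (auto simp: one_form_def \<eta>_def alt_one_def)
    then have e: "ext_deriv G (left_form (alt_one lieG l)) x vs = flat_ext_deriv \<eta> x vs"
      using True by (intro ext_deriv_eq[OF affine_homogeneous_G]) auto
    have r: "left_form (mc_form l) x vs = mc_form l (map (transl (transpose (fst x))) vs)"
      using True by (simp add: left_form_def pull_alt_def)
    show ?thesis
    proof (cases "length vs = 2")
      case len: True
      then obtain v w where vs: "vs = [v, w]" by (auto simp: length_Suc_conv numeral_2_eq_2)
      let ?V = "transl (transpose (fst x)) v" and ?W = "transl (transpose (fst x)) w"
      have VW: "?V \<in> lieG" "?W \<in> lieG" using True gx vs tangent_space_G_iff[of "fst x" _ "snd x"] by auto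
      have al: "along \<eta> x u [u'] = l (transl (transpose (fst u)) u')" for u u'
      proof -
        have "(\<lambda>y. \<eta> y [u']) = (\<lambda>y. l (transl (transpose (fst y)) u'))" by (simp add: \<eta>_def alt_one_def)
        then show ?thesis
          using frechet_derivative_eqI[OF bounded_linear_imp_has_derivative[OF bl]] by simp
      qed
      \<comment> \<open>A tangent vector at \<open>g\<close> is \<open>u = g A\<close> with skew \<open>A\<close>, so that \<open>u\<^sup>T = - A g\<^sup>T\<close>.\<close>
      have neg: "l (transl (transpose (fst u)) u') =
          - l (transl (fst (transl (transpose (fst x)) u)) (transl (transpose (fst x)) u'))"
        if "transl (transpose (fst x)) u \<in> lieG" for u u'
      proof -
        let ?A = "transpose (fst x) ** fst u"
        have "?A \<in> spin9_algebra" using that by (simp add: lieG_def transl_def)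
        then have "transpose ?A = - ?A" by (simp add: spin9_algebra_def)
        then have "transpose (fst u) ** fst x = - ?A" by (simp add: matrix_transpose_mul)
        then have A: "transpose (fst u) = - ?A ** transpose (fst x)"
          using Spin9_orthogonal(1)[OF gx] by (metis matrix_mul_assoc matrix_mul_rid)
        have "transl (transpose (fst u)) u' = - transl ?A (transl (transpose (fst x)) u')"
          unfolding A transl_mult by (simp add: transl_def mm.minus_left mv.minus_left)
        then show ?thesis by (simp add: linear_neg[OF l]) (simp add: transl_def)
      qed
      have "flat_ext_deriv \<eta> x vs = along \<eta> x v [w] - along \<eta> x w [v]"
        unfolding vs by (simp add: flat_ext_deriv_Cons contract_def)
      then show ?thesis
        unfolding e r al neg[OF VW(1)] neg[OF VW(2)] using VW by (simp add: vs mc_form_def)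
    next
      case False
      have "along \<eta> x u us = 0" if "length us \<noteq> 1" for u us
        using that by (simp add: \<eta>_def alt_one_def)
      then have "flat_ext_deriv \<eta> x vs = 0"
        unfolding flat_ext_deriv_def using False by (intro sum.neutral) auto
      then show ?thesis unfolding e r using False by (simp add: mc_form_def)
    qed
  next
    case False
    then show ?thesis by (auto simp: ext_deriv_off left_form_def pull_alt_def)
  qed
qed

lemma d\<^sub>h_coord_form:
  assumes "x \<in> G" "set vs \<subseteq> tangent_space G x"
  shows "d\<^sub>h (coord_form c) x vs =
     mc_form (coord_fun c) (map hor_proj (map (transl (transpose (fst x))) vs))"
proof -
  have off: "mc_form l us = 0" if "\<not> set us \<subseteq> lieG" for l us
    using that by (auto simp: mc_form_def)
  have "left_form (mc_form (coord_fun c)) \<in> left_invariant_forms"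
    using ext_deriv_left_invariant[OF coord_form_invariant[of c]]
    unfolding coord_form_def ext_deriv_alt_one[OF linear_coord_fun] .
  then have "d\<^sub>h (coord_form c) = left_form (pull_alt lieG hor_proj (mc_form (coord_fun c)))"
    unfolding d\<^sub>h_eq coord_form_def ext_deriv_alt_one[OF linear_coord_fun]
    by (simp add: horizontalize_def left_form_one[OF off])
  moreover have "set (map (transl (transpose (fst x))) vs) \<subseteq> lieG"
    using assms tangent_space_G_iff[of "fst x" _ "snd x"] by (auto simp: G_def)
  ultimately show ?thesis using assms by (simp add: left_form_def pull_alt_def)
qed

lemma d\<^sub>h_off: "\<not> (x \<in> G \<and> set vs \<subseteq> tangent_space G x) \<Longrightarrow> d\<^sub>h (coord_form c) x vs = 0"
proof -
  have "d\<^sub>h (coord_form c) \<in> horizontal_algebra"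
    unfolding d\<^sub>h_eq by (intro horizontalize_horizontal ext_deriv_left_invariant coord_form_invariant)
  then have "d\<^sub>h (coord_form c) \<in> forms G"
    unfolding horizontal_algebra_iff(1) using left_invariant_forms_subset by blast
  moreover assume "\<not> (x \<in> G \<and> set vs \<subseteq> tangent_space G x)"
  ultimately show ?thesis by (rule forms_off)
qed

text \<open>
  The left-invariant octonion-valued 1-form with the value \<open>F\<close> at the identity.
\<close>

definition oct_one_form :: "(oct_matrix \<times> oct_plane \<Rightarrow> octonion) \<Rightarrow> octonion G_form" where
  "oct_one_form F x vs = (if x \<in> G \<and> length vs = 1 \<and> set vs \<subseteq> tangent_space G x
     then F (transl (transpose (fst x)) (hd vs)) else 0)"

lemma oct_one_form_nth: "(\<lambda>y ws. oct_one_form F y ws $ a) = left_form (alt_one lieG (\<lambda>v. F v $ a))"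
  unfolding left_form_alt_one by (auto simp: fun_eq_iff oct_one_form_def one_form_def)

lemma oct_form_eqI:
  assumes "\<And>a. (\<lambda>y ws. \<omega> y ws $ a) = (\<lambda>y ws. \<eta> y ws $ a)"
  shows "\<omega> = (\<eta> :: octonion G_form)"
proof (intro ext)
  fix x vs
  have "\<omega> x vs $ a = \<eta> x vs $ a" for a using fun_cong[OF fun_cong[OF assms[of a]]] .
  then show "\<omega> x vs = \<eta> x vs" by (simp add: vec_eq_iff)
qed

lemma oct_tensor_nth: "oct_tensor u \<omega> x vs $ a = \<omega> x vs * u $ a"
  by (simp add: oct_tensor_def)

lemma sum_apply2: "(\<Sum>a\<in>S. f a) x y = (\<Sum>a\<in>S. f a x y)" for f :: "'a \<Rightarrow> 'b \<Rightarrow> 'c \<Rightarrow> 'd::comm_monoid_add"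
  by (induction S rule: infinite_finite_induct) simp_all

lemma coord_fun_eq:
  "coord_fun (Theta i) = (\<lambda>v. snd v $ i)" "coord_fun (Phi i) = (\<lambda>v. (fst v *v E0) $ i)"
  by (simp_all add: fun_eq_iff column_E0)

lemma alpha_theta\<^sub>0_eq: "\<alpha> + \<theta>\<^sub>0 = oct_one_form (\<lambda>v. oct_comp 0 (snd v))"
proof (intro oct_form_eqI)
  fix a :: 8
  have "(\<alpha> + \<theta>\<^sub>0) y ws $ a = theta_entry 0 a y ws" for y ws
    unfolding \<alpha>_def \<theta>\<^sub>0_def plus_fun_apply sum_apply2 vector_add_component sum_component oct_tensor_nth oct_basis_nth
    by (cases "a = 0") (simp_all add: if_distrib cong: if_cong)
  then show "(\<lambda>y ws. (\<alpha> + \<theta>\<^sub>0) y ws $ a) = (\<lambda>y ws. oct_one_form (\<lambda>v. oct_comp 0 (snd v)) y ws $ a)"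
    unfolding oct_one_form_nth theta_entry_eq coord_form_def by (simp add: oct_comp_def coord_fun_eq)
qed

lemma theta\<^sub>1_eq: "\<theta>\<^sub>1 = oct_one_form (\<lambda>v. oct_comp 1 (snd v))"
proof (intro oct_form_eqI)
  fix a :: 8
  have "\<theta>\<^sub>1 y ws $ a = theta_entry 1 a y ws" for y ws
    unfolding \<theta>\<^sub>1_def sum_apply2 sum_component oct_tensor_nth oct_basis_nth
    by (simp add: if_distrib cong: if_cong)
  then show "(\<lambda>y ws. \<theta>\<^sub>1 y ws $ a) = (\<lambda>y ws. oct_one_form (\<lambda>v. oct_comp 1 (snd v)) y ws $ a)"
    unfolding oct_one_form_nth theta_entry_eq coord_form_def by (simp add: oct_comp_def coord_fun_eq)
qed

text \<open>
  The real part of \<open>\<phi>\<^sub>0\<close> may be added to its definition, since the Lie algebra is skew.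
\<close>

lemma phi_col_0_0: "phi_col 0 0 = (\<lambda>x vs. 0)"
proof -
  have "phi_col 0 0 = left_form (\<lambda>vs. 0)"
    unfolding phi_col_eq coord_form_def
  proof (rule left_form_cong)
    fix vs :: "(oct_matrix \<times> oct_plane) list" assume "set vs \<subseteq> lieG"
    then show "alt_one lieG (coord_fun (Phi (0, 0))) vs = 0"
      using lieG_E0[of "hd vs"] by (cases vs) (auto simp: alt_one_def column_E0)
  qed
  then show ?thesis by (auto simp: fun_eq_iff left_form_def pull_alt_def)
qed

lemma phi\<^sub>0_eq: "\<phi>\<^sub>0 = oct_one_form (\<lambda>v. oct_comp 0 (fst v *v E0))"
proof (intro oct_form_eqI)
  fix a :: 8
  have "\<phi>\<^sub>0 y ws $ a = phi_col 0 a y ws" for y ws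
    unfolding \<phi>\<^sub>0_def sum_apply2 sum_component oct_tensor_nth oct_basis_nth
    by (cases "a = 0") (simp_all add: if_distrib phi_col_0_0 cong: if_cong)
  then show "(\<lambda>y ws. \<phi>\<^sub>0 y ws $ a) = (\<lambda>y ws. oct_one_form (\<lambda>v. oct_comp 0 (fst v *v E0)) y ws $ a)"
    unfolding oct_one_form_nth phi_col_eq coord_form_def by (simp add: oct_comp_def coord_fun_eq)
qed

lemma phi\<^sub>1_eq: "\<phi>\<^sub>1 = oct_one_form (\<lambda>v. oct_comp 1 (fst v *v E0))"
proof (intro oct_form_eqI)
  fix a :: 8
  have "\<phi>\<^sub>1 y ws $ a = phi_col 1 a y ws" for y ws
    unfolding \<phi>\<^sub>1_def sum_apply2 sum_component oct_tensor_nth oct_basis_nth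
    by (simp add: if_distrib cong: if_cong)
  then show "(\<lambda>y ws. \<phi>\<^sub>1 y ws $ a) = (\<lambda>y ws. oct_one_form (\<lambda>v. oct_comp 1 (fst v *v E0)) y ws $ a)"
    unfolding oct_one_form_nth phi_col_eq coord_form_def by (simp add: oct_comp_def coord_fun_eq)
qed

lemma cnj_oct_one_form: "cnj_form (oct_one_form F) = oct_one_form (\<lambda>v. oct_cnj (F v))"
  by (auto simp: fun_eq_iff cnj_form_def oct_one_form_def oct_cnj_linear)

lemma shuffle_sign_2: "shuffle_sign 2 {0} = 1" "shuffle_sign 2 {Suc 0} = -1"
proof -
  have 0: "{(i, j). i \<in> {0} \<and> j \<in> {..<2} - {0} \<and> j < i} = ({} :: (nat \<times> nat) set)" by auto
  show "shuffle_sign 2 {0} = 1" unfolding shuffle_sign_def 0 by simp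
  have 1: "{(i, j). i \<in> {Suc 0} \<and> j \<in> {..<2} - {Suc 0} \<and> j < i} = {(Suc 0, 0)}" by auto
  show "shuffle_sign 2 {Suc 0} = -1" unfolding shuffle_sign_def 1 by simp
qed

lemma wedge_oct_one_form:
  "(oct_one_form F \<and>\<^sub>O oct_one_form F') x vs =
     (if x \<in> G \<and> length vs = 2 \<and> set vs \<subseteq> tangent_space G x
      then oct_mult (F (transl (transpose (fst x)) (vs ! 0))) (F' (transl (transpose (fst x)) (vs ! 1)))
         - oct_mult (F (transl (transpose (fst x)) (vs ! 1))) (F' (transl (transpose (fst x)) (vs ! 0))) else 0)"
proof (cases "length vs = 2")
  case True
  then obtain v w where vs: "vs = [v, w]" by (auto simp: length_Suc_conv numeral_2_eq_2)
  have P: "Pow {..<2} = {{}, {0}, {Suc 0}, {0, Suc 0}}"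
    by (simp add: numeral_2_eq_2 lessThan_Suc Pow_insert insert_commute)
  have n: "nths [v, w] {} = []" "nths [v, w] {0} = [v]" "nths [v, w] {Suc 0} = [w]" "nths [v, w] {0, Suc 0} = [v, w]"
    "nths [v, w] (- {0}) = [w]" "nths [v, w] (- {Suc 0}) = [v]"
    by (simp_all add: nths_Cons)
  have "(oct_one_form F \<and>\<^sub>O oct_one_form F') x vs =
      oct_mult (oct_one_form F x [v]) (oct_one_form F' x [w]) - oct_mult (oct_one_form F x [w]) (oct_one_form F' x [v])"
  proof -
    have l2: "length vs = 2" by fact
    have z: "oct_one_form E x [] = 0" "oct_one_form E x [v, w] = 0" for E by (simp_all add: oct_one_form_def)
    show ?thesis
      unfolding wedge_by_def l2 P unfolding vs
      by (simp add: n z shuffle_sign_2 oct_mult.zero_left oct_mult.zero_right)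
  qed
  then show ?thesis
    by (auto simp: vs oct_one_form_def oct_mult.zero_left oct_mult.zero_right)
next
  case False
  have "oct_mult (oct_one_form F x (nths vs I)) (oct_one_form F' x (nths vs (- I))) = 0" for I
  proof -
    have "length (nths vs I) + length (nths vs (- I)) = length vs"
    proof -
      have "{i. i < length vs \<and> i \<in> I} \<union> {i. i < length vs \<and> i \<in> - I} = {..<length vs}"
        "{i. i < length vs \<and> i \<in> I} \<inter> {i. i < length vs \<and> i \<in> - I} = {}" by auto
      then show ?thesis
        unfolding length_nths using card_Un_disjoint[of "{i. i < length vs \<and> i \<in> I}" "{i. i < length vs \<and> i \<in> - I}"] by simp
    qed
    then have "length (nths vs I) \<noteq> 1 \<or> length (nths vs (- I)) \<noteq> 1" using False by linarith
    then show ?thesis by (auto simp: oct_one_form_def oct_mult.zero_left oct_mult.zero_right)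
  qed
  then show ?thesis using False by (simp add: wedge_by_def)
qed

text \<open>
  On horizontal vectors the Lie bracket is given by the octonionic matrices \<open>hor_matrix w z\<close>, so that
  the four rules can be read off from their two rows.
\<close>

lemma componentwise_d\<^sub>h:
  assumes c: "\<And>a v. coord_fun (c a) v = F v $ a"
  shows "componentwise d\<^sub>h (oct_one_form F) x vs =
     (if x \<in> G \<and> length vs = 2 \<and> set vs \<subseteq> tangent_space G x
      then F (transl (fst (hor_proj (transl (transpose (fst x)) (vs ! 1)))) (hor_proj (transl (transpose (fst x)) (vs ! 0))))
         - F (transl (fst (hor_proj (transl (transpose (fst x)) (vs ! 0)))) (hor_proj (transl (transpose (fst x)) (vs ! 1))))
      else 0)"
proof -
  have cf: "coord_fun (c a) = (\<lambda>v. F v $ a)" for a using c by auto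
  have *: "componentwise d\<^sub>h (oct_one_form F) x vs $ a = d\<^sub>h (coord_form (c a)) x vs" for a
    unfolding componentwise_def oct_one_form_nth coord_form_def cf by simp
  show ?thesis
  proof (cases "x \<in> G \<and> set vs \<subseteq> tangent_space G x")
    case True
    then have gx: "fst x \<in> Spin9" by (auto simp: G_def)
    have "hor_proj (transl (transpose (fst x)) v) \<in> lieG" if "v \<in> set vs" for v
      using True that tangent_space_G_iff[OF gx, of v "snd x"] by (intro hor_proj_lieG) auto
    then have "set (map hor_proj (map (transl (transpose (fst x))) vs)) \<subseteq> lieG" by auto
    then show ?thesis
      using True unfolding vec_eq_iff * by (simp add: d\<^sub>h_coord_form mc_form_def cf)
  next
    case False
    then show ?thesis unfolding vec_eq_iff * by (auto simp: d\<^sub>h_off)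
  qed
qed

lemma hor_proj_apply:
  "fst (hor_proj V) *v y = oct_pair
     (oct_mult (oct_comp 0 (fst V *v E0)) (oct_comp 0 y) - oct_mult (oct_comp 1 y) (oct_cnj (oct_comp 1 (fst V *v E0))))
     (oct_mult (oct_comp 0 y) (oct_comp 1 (fst V *v E0)) +
       (oct_mult (oct_comp 0 (fst V *v E0)) (oct_comp 1 y) + oct_mult (oct_comp 1 y) (oct_comp 0 (fst V *v E0))))"
  using hor_matrix_apply[of _ _ "oct_comp 0 y" "oct_comp 1 y"] by (simp add: hor_proj_def hor_of_def)

lemma bracket_rules:
  fixes V W :: "oct_matrix \<times> oct_plane"
  defines "p \<equiv> oct_comp 0 (snd V)" and "p' \<equiv> oct_comp 0 (snd W)"
    and "q \<equiv> oct_comp 1 (snd V)" and "q' \<equiv> oct_comp 1 (snd W)"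
    and "w \<equiv> oct_comp 0 (fst V *v E0)" and "w' \<equiv> oct_comp 0 (fst W *v E0)"
    and "z \<equiv> oct_comp 1 (fst V *v E0)" and "z' \<equiv> oct_comp 1 (fst W *v E0)"
    and "X \<equiv> transl (fst (hor_proj W)) (hor_proj V)" and "Y \<equiv> transl (fst (hor_proj V)) (hor_proj W)"
  shows "oct_comp 0 (snd X) - oct_comp 0 (snd Y) =
      - (oct_mult w p' - oct_mult w' p) - (oct_mult q (oct_cnj z') - oct_mult q' (oct_cnj z))"
    and "oct_comp 1 (snd X) - oct_comp 1 (snd Y) =
      (oct_mult p z' - oct_mult p' z) - (oct_mult w q' - oct_mult w' q) + (oct_mult q w' - oct_mult q' w)"
    and "oct_comp 0 (fst X *v E0) - oct_comp 0 (fst Y *v E0) =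
      - (oct_mult w w' - oct_mult w' w) - (oct_mult z (oct_cnj z') - oct_mult z' (oct_cnj z))"
    and "oct_comp 1 (fst X *v E0) - oct_comp 1 (fst Y *v E0) = oct_mult z w' - oct_mult z' w"
proof -
  have s: "snd (hor_proj U) = snd U" and f: "fst (hor_proj U) *v E0 = fst U *v E0" for U
    by (simp_all add: hor_proj_def)
  have t: "snd (transl g U) = g *v snd U" "fst (transl g U) *v E0 = g *v (fst U *v E0)" for g U
    by (simp_all add: transl_def matrix_vector_mul_assoc)
  note defs = p_def p'_def q_def q'_def w_def w'_def z_def z'_def X_def Y_def
  show "oct_comp 0 (snd X) - oct_comp 0 (snd Y) =
      - (oct_mult w p' - oct_mult w' p) - (oct_mult q (oct_cnj z') - oct_mult q' (oct_cnj z))"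
    unfolding defs t s f unfolding hor_proj_apply oct_comp_pair by simp
  show "oct_comp 1 (snd X) - oct_comp 1 (snd Y) =
      (oct_mult p z' - oct_mult p' z) - (oct_mult w q' - oct_mult w' q) + (oct_mult q w' - oct_mult q' w)"
    unfolding defs t s f unfolding hor_proj_apply oct_comp_pair by simp
  show "oct_comp 0 (fst X *v E0) - oct_comp 0 (fst Y *v E0) =
      - (oct_mult w w' - oct_mult w' w) - (oct_mult z (oct_cnj z') - oct_mult z' (oct_cnj z))"
    unfolding defs t s f unfolding hor_proj_apply oct_comp_pair by simp
  show "oct_comp 1 (fst X *v E0) - oct_comp 1 (fst Y *v E0) = oct_mult z w' - oct_mult z' w"
    unfolding defs t s f unfolding hor_proj_apply oct_comp_pair by simp
qed

lemma differentiation_rules_d\<^sub>h: "differentiation_rules d\<^sub>h"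
  unfolding differentiation_rules_def alpha_theta\<^sub>0_eq theta\<^sub>1_eq phi\<^sub>0_eq phi\<^sub>1_eq cnj_oct_one_form
proof (intro conjI ext)
  fix x vs
  have c: "coord_fun (Theta (k, a)) v = oct_comp k (snd v) $ a"
    "coord_fun (Phi (k, a)) v = oct_comp k (fst v *v E0) $ a" for k a v
    by (simp_all add: coord_fun_eq oct_comp_def del: coord_fun.simps)
  have d: "componentwise d\<^sub>h (oct_one_form F) x vs =
     (if x \<in> G \<and> length vs = 2 \<and> set vs \<subseteq> tangent_space G x
      then F (transl (fst (hor_proj (transl (transpose (fst x)) (vs ! 1)))) (hor_proj (transl (transpose (fst x)) (vs ! 0))))
         - F (transl (fst (hor_proj (transl (transpose (fst x)) (vs ! 0)))) (hor_proj (transl (transpose (fst x)) (vs ! 1))))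
      else 0)" if "F = (\<lambda>v. oct_comp k (snd v)) \<or> F = (\<lambda>v. oct_comp k (fst v *v E0))" for F k
    using that componentwise_d\<^sub>h[of "\<lambda>a. Theta (k, a)", OF c(1)] componentwise_d\<^sub>h[of "\<lambda>a. Phi (k, a)", OF c(2)]
    by blast
  note e = plus_fun_apply minus_apply uminus_apply wedge_oct_one_form
  show "componentwise d\<^sub>h (oct_one_form (\<lambda>v. oct_comp 0 (snd v))) x vs =
    (- (oct_one_form (\<lambda>v. oct_comp 0 (fst v *v E0)) \<and>\<^sub>O oct_one_form (\<lambda>v. oct_comp 0 (snd v))) -
     oct_one_form (\<lambda>v. oct_comp 1 (snd v)) \<and>\<^sub>O oct_one_form (\<lambda>v. oct_cnj (oct_comp 1 (fst v *v E0)))) x vs"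
    unfolding e d[OF disjI1, OF refl] bracket_rules
    by (cases "x \<in> G \<and> length vs = 2 \<and> set vs \<subseteq> tangent_space G x"; simp only: if_P if_not_P; simp)
  show "componentwise d\<^sub>h (oct_one_form (\<lambda>v. oct_comp 1 (snd v))) x vs =
    (oct_one_form (\<lambda>v. oct_comp 0 (snd v)) \<and>\<^sub>O oct_one_form (\<lambda>v. oct_comp 1 (fst v *v E0)) -
     oct_one_form (\<lambda>v. oct_comp 0 (fst v *v E0)) \<and>\<^sub>O oct_one_form (\<lambda>v. oct_comp 1 (snd v)) +
     oct_one_form (\<lambda>v. oct_comp 1 (snd v)) \<and>\<^sub>O oct_one_form (\<lambda>v. oct_comp 0 (fst v *v E0))) x vs"
    unfolding e d[OF disjI1, OF refl] bracket_rules
    by (cases "x \<in> G \<and> length vs = 2 \<and> set vs \<subseteq> tangent_space G x"; simp only: if_P if_not_P; simp)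
  show "componentwise d\<^sub>h (oct_one_form (\<lambda>v. oct_comp 0 (fst v *v E0))) x vs =
    (- (oct_one_form (\<lambda>v. oct_comp 0 (fst v *v E0)) \<and>\<^sub>O oct_one_form (\<lambda>v. oct_comp 0 (fst v *v E0))) -
     oct_one_form (\<lambda>v. oct_comp 1 (fst v *v E0)) \<and>\<^sub>O oct_one_form (\<lambda>v. oct_cnj (oct_comp 1 (fst v *v E0)))) x vs"
    unfolding e d[OF disjI2, OF refl] bracket_rules
    by (cases "x \<in> G \<and> length vs = 2 \<and> set vs \<subseteq> tangent_space G x"; simp only: if_P if_not_P; simp)
  show "componentwise d\<^sub>h (oct_one_form (\<lambda>v. oct_comp 1 (fst v *v E0))) x vs =
    (oct_one_form (\<lambda>v. oct_comp 1 (fst v *v E0)) \<and>\<^sub>O oct_one_form (\<lambda>v. oct_comp 0 (fst v *v E0))) x vs"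
    unfolding e d[OF disjI2, OF refl] bracket_rules
    by (cases "x \<in> G \<and> length vs = 2 \<and> set vs \<subseteq> tangent_space G x"; simp only: if_P if_not_P; simp)
qed

text \<open>
  The generators are the coordinates of the four octonion-valued forms in the rules.
\<close>

lemma rules_determine_generators:
  assumes D: "differentiation_rules D" and D': "differentiation_rules D'" and \<omega>: "\<omega> \<in> horizontal_generators"
  shows "D \<omega> = D' \<omega>"
proof -
  have eq: "componentwise D \<eta> = componentwise D' \<eta>" if "\<eta> \<in> {\<alpha> + \<theta>\<^sub>0, \<theta>\<^sub>1, \<phi>\<^sub>0, \<phi>\<^sub>1}" for \<eta>
    using that D D' unfolding differentiation_rules_def by auto
  have "D (\<lambda>y ws. \<eta> y ws $ a) = D' (\<lambda>y ws. \<eta> y ws $ a)" if "\<eta> \<in> {\<alpha> + \<theta>\<^sub>0, \<theta>\<^sub>1, \<phi>\<^sub>0, \<phi>\<^sub>1}" for \<eta> and a :: 8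
  proof (intro ext)
    fix x vs
    have "componentwise D \<eta> x vs $ a = componentwise D' \<eta> x vs $ a" using eq[OF that] by simp
    then show "D (\<lambda>y ws. \<eta> y ws $ a) x vs = D' (\<lambda>y ws. \<eta> y ws $ a) x vs" by (simp add: componentwise_def)
  qed
  note * = this[unfolded alpha_theta\<^sub>0_eq theta\<^sub>1_eq phi\<^sub>0_eq phi\<^sub>1_eq]
  have t: "D (coord_form (Theta (k, a))) = D' (coord_form (Theta (k, a)))" for k a
  proof -
    have "coord_fun (Theta (k, a)) = (\<lambda>v. oct_comp k (snd v) $ a)" by (simp add: fun_eq_iff oct_comp_def)
    moreover have "k = 0 \<or> k = 1" using exhaust_2[of k] by auto
    ultimately show ?thesis
      using *[of "oct_one_form (\<lambda>v. oct_comp k (snd v))" a] unfolding oct_one_form_nth coord_form_def by auto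
  qed
  have p: "D (coord_form (Phi (k, a))) = D' (coord_form (Phi (k, a)))" for k a
  proof -
    have "coord_fun (Phi (k, a)) = (\<lambda>v. oct_comp k (fst v *v E0) $ a)" by (simp add: fun_eq_iff oct_comp_def column_E0)
    moreover have "k = 0 \<or> k = 1" using exhaust_2[of k] by auto
    ultimately show ?thesis
      using *[of "oct_one_form (\<lambda>v. oct_comp k (fst v *v E0))" a] unfolding oct_one_form_nth coord_form_def by auto
  qed
  show ?thesis using \<omega> t p unfolding horizontal_generators_eq hor_coords_def by auto
qed


section \<open>Invariant forms on the sphere bundle\<close>

definition bundle_move :: "oct_matrix \<Rightarrow> oct_plane \<times> oct_plane \<Rightarrow> oct_plane \<times> oct_plane" where
  "bundle_move g v = (g *v fst v, g *v snd v)"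

lemma bounded_linear_bundle_move: "bounded_linear (bundle_move g)"
  unfolding bundle_move_def[abs_def]
  by (intro bounded_linear_Pair bounded_linear_compose[OF mv.bounded_linear_right bounded_linear_fst]
      bounded_linear_compose[OF mv.bounded_linear_right bounded_linear_snd])

lemma bundle_move_mult: "bundle_move g (bundle_move h v) = bundle_move (g ** h) v"
  by (simp add: bundle_move_def matrix_vector_mul_assoc)

lemma bundle_move_one [simp]: "bundle_move (mat 1) v = v"
  by (simp add: bundle_move_def)

lemma G_act_affine: "G_act a = (\<lambda>y. bundle_move (fst a) y + (snd a, 0))"
  by (auto simp: G_act_def bundle_move_def fun_eq_iff split_beta)

lemma G_act_closed: "a \<in> G \<Longrightarrow> y \<in> sphere_bundle \<Longrightarrow> bundle_move (fst a) y + (snd a, 0) \<in> sphere_bundle"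
  using Spin9_sphere by (auto simp: G_def sphere_bundle_def bundle_move_def)

lemma base_point_sphere_bundle: "base_point \<in> sphere_bundle"
  using E0_sphere by (simp add: base_point_def sphere_bundle_def)

abbreviation base_tangent :: "(oct_plane \<times> oct_plane) set" where
  "base_tangent \<equiv> tangent_space sphere_bundle base_point"

lemma base_tangent_eq: "base_tangent = {(u, w). w \<bullet> E0 = 0}"
  unfolding base_point_def by (rule tangent_space_sphere_bundle[OF E0_sphere])

lemma subspace_base_tangent: "subspace base_tangent"
  using affine_homogeneous_sphere_bundle base_point_sphere_bundle by (simp add: affine_homogeneous_def)

lemma bundle_move_base_tangent:
  assumes g: "g \<in> Spin9" and v: "g *v E0 = v" and t: "t \<in> tangent_space sphere_bundle (y, v)"
  shows "bundle_move (transpose g) t \<in> base_tangent"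
proof -
  have "v \<in> sphere 0 1" using Spin9_sphere[OF g E0_sphere] v by simp
  from t[unfolded tangent_space_sphere_bundle[OF this]] obtain u w where uw: "t = (u, w)" "w \<bullet> v = 0" by blast
  have "(transpose g *v w) \<bullet> E0 = 0" using uw(2) v by (simp only: transpose_inner)
  then show ?thesis unfolding base_tangent_eq uw(1) bundle_move_def by simp
qed

text \<open>An invariant form is the translate of its value at the base point by any group element.\<close>

lemma bundle_invariant_translate:
  assumes \<omega>: "\<omega> \<in> bundle_invariant_forms" and g: "g \<in> Spin9" and v: "g *v E0 = v"
    and vs: "set vs \<subseteq> tangent_space sphere_bundle (y, v)"
  shows "\<omega> (y, v) vs = \<omega> base_point (map (bundle_move (transpose g)) vs)"
proof -
  let ?a = "(transpose g, - (transpose g *v y))"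
  have a: "?a \<in> G" using g by (simp add: G_def Spin9_transpose)
  have yv: "(y, v) \<in> sphere_bundle" using Spin9_sphere[OF g E0_sphere] v by (simp add: sphere_bundle_def)
  have "\<omega> = pullback sphere_bundle (G_act ?a) \<omega>"
    using \<omega> a unfolding invariant_forms_def by simp
  from fun_cong[OF fun_cong[OF this, of "(y, v)"], of vs]
  have "\<omega> (y, v) vs = \<omega> (bundle_move (transpose g) (y, v) + (- (transpose g *v y), 0)) (map (bundle_move (transpose g)) vs)"
    unfolding G_act_affine pullback_affine[OF bounded_linear_bundle_move] using yv vs by (simp add: pull_alt_def)
  moreover have "bundle_move (transpose g) (y, v) + (- (transpose g *v y), 0) = base_point"
    using g v[symmetric] by (simp add: bundle_move_def base_point_def del: transpose_matrix_vector)
  ultimately show ?thesis by simp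
qed

lemma bundle_invariant_eqI:
  assumes \<omega>: "\<omega> \<in> bundle_invariant_forms" and \<eta>: "\<eta> \<in> bundle_invariant_forms"
    and eq: "\<And>vs. set vs \<subseteq> base_tangent \<Longrightarrow> \<omega> base_point vs = \<eta> base_point vs"
  shows "\<omega> = \<eta>"
proof (intro ext)
  fix x vs
  show "\<omega> x vs = \<eta> x vs"
  proof (cases "x \<in> sphere_bundle \<and> set vs \<subseteq> tangent_space sphere_bundle x")
    case True
    then obtain y v where x: "x = (y, v)" and v: "v \<in> sphere 0 1" by (auto simp: sphere_bundle_def)
    obtain g where g: "g \<in> Spin9" "g *v E0 = v" using Spin9_transitive[OF v] .
    have vs: "set vs \<subseteq> tangent_space sphere_bundle (y, v)" using True x by simp
    have "set (map (bundle_move (transpose g)) vs) \<subseteq> base_tangent"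
      using bundle_move_base_tangent[OF g] vs by auto
    then show ?thesis
      unfolding x bundle_invariant_translate[OF \<omega> g vs] bundle_invariant_translate[OF \<eta> g vs] by (rule eq)
  next
    case False
    then show ?thesis
      using forms_off[of \<omega> sphere_bundle x vs] forms_off[of \<eta> sphere_bundle x vs] \<omega> \<eta>
      by (simp add: invariant_forms_def)
  qed
qed

lemma frechet_derivative_G_act: "frechet_derivative (G_act s) (at x) = bundle_move (fst s)"
proof (rule frechet_derivative_at[symmetric])
  show "(G_act s has_derivative bundle_move (fst s)) (at x)"
    unfolding G_act_affine
    using has_derivative_add_const[OF bounded_linear_imp_has_derivative[OF bounded_linear_bundle_move]] by blast
qed

definition point_mover :: "oct_plane \<Rightarrow> oct_matrix" where
  "point_mover v = (SOME g. g \<in> Spin9 \<and> g *v E0 = v)"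

lemma point_mover:
  assumes "v \<in> sphere 0 1"
  shows "point_mover v \<in> Spin9" "point_mover v *v E0 = v"
  using someI_ex[of "\<lambda>g. g \<in> Spin9 \<and> g *v E0 = v"] Spin9_transitive[OF assms]
  unfolding point_mover_def by blast+

text \<open>
  The choice of \<open>point_mover\<close> is not smooth. For a form fixed by the stabilizer it can be replaced at
  each point by a smooth section (\<open>spread_form_eq\<close>).
\<close>

definition spread_form :: "((oct_plane \<times> oct_plane) list \<Rightarrow> real) \<Rightarrow> (oct_plane \<times> oct_plane, real) form" where
  "spread_form f x vs = (if x \<in> sphere_bundle \<and> set vs \<subseteq> tangent_space sphere_bundle x
     then f (map (bundle_move (transpose (point_mover (snd x)))) vs) else 0)"

lemma spread_form_eq:
  assumes f: "f \<in> stabilizer_invariants" and g: "g \<in> Spin9" and v: "g *v E0 = v"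
    and vs: "set vs \<subseteq> tangent_space sphere_bundle (y, v)"
  shows "spread_form f (y, v) vs = f (map (bundle_move (transpose g)) vs)"
proof -
  let ?h = "point_mover v"
  have vS: "v \<in> sphere 0 1" using Spin9_sphere[OF g E0_sphere] v by simp
  note h = point_mover[OF vS]
  \<comment> \<open>Two group elements which move \<open>E\<^sub>0\<close> to \<open>v\<close> differ by an element of the stabilizer.\<close>
  let ?s = "(transpose g ** ?h, 0 :: oct_plane)"
  have "(transpose g ** ?h) *v E0 = transpose g *v (g *v E0)"
    by (simp only: v h(2) matrix_vector_mul_assoc[symmetric])
  then have "(transpose g ** ?h) *v E0 = E0" by (simp only: Spin9_cancel(3)[OF g])
  then have s: "?s \<in> stabilizer"
    using g h by (simp add: stabilizer_def G_def G_act_affine base_point_def bundle_move_def Spin9_mult Spin9_transpose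
        del: transpose_matrix_vector)
  have t: "set (map (bundle_move (transpose ?h)) vs) \<subseteq> base_tangent"
    using bundle_move_base_tangent[OF h] vs by auto
  have inv: "f (map (bundle_move (fst ?s)) (map (bundle_move (transpose ?h)) vs)) = f (map (bundle_move (transpose ?h)) vs)"
    using f s t unfolding stabilizer_invariants_def frechet_derivative_G_act[symmetric, where x = base_point] by blast
  have "bundle_move (fst ?s) (bundle_move (transpose ?h) w) = bundle_move (transpose g) w" for w
    using h(1) by (simp add: bundle_move_mult Spin9_orthogonal flip: matrix_mul_assoc)
  then have "map (bundle_move (fst ?s)) (map (bundle_move (transpose ?h)) vs) = map (bundle_move (transpose g)) vs"
    by simp
  from inv[unfolded this] have "spread_form f (y, v) vs = f (map (bundle_move (transpose g)) vs)"
    if "(y, v) \<in> sphere_bundle" using that vs by (simp add: spread_form_def)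
  then show ?thesis using vS by (simp add: sphere_bundle_def)
qed

lemma spread_form_invariant:
  assumes f: "f \<in> stabilizer_invariants"
  shows "spread_form f \<in> bundle_invariant_forms"
  unfolding invariant_forms_def
proof (intro CollectI conjI ballI)
  have fa: "f \<in> alt_forms base_tangent" using f by (simp add: stabilizer_invariants_def)
  show "spread_form f \<in> forms sphere_bundle"
  proof (rule forms_of_frame[OF _ fa subspace_base_tangent])
    show "spread_form f x vs = 0" if "\<not> (x \<in> sphere_bundle \<and> set vs \<subseteq> tangent_space sphere_bundle x)" for x vs
      unfolding spread_form_def if_not_P[OF that] ..
    show "subspace (tangent_space sphere_bundle x)" if "x \<in> sphere_bundle" for x
      using affine_homogeneous_sphere_bundle that by (simp add: affine_homogeneous_def)
    fix x assume x: "x \<in> sphere_bundle"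
    then have "snd x \<in> sphere 0 1" by (auto simp: sphere_bundle_def)
    from sphere_local_section[OF this] obtain U s where U: "open U" "snd x \<in> U" "smooth_on U s"
      and "\<forall>y\<in>U \<inter> sphere 0 1. s y \<in> Spin9 \<and> s y *v E0 = y"
      by - (elim exE conjE, rule that)
    then have s: "\<And>y. y \<in> U \<Longrightarrow> y \<in> sphere 0 1 \<Longrightarrow> s y \<in> Spin9" "\<And>y. y \<in> U \<Longrightarrow> y \<in> sphere 0 1 \<Longrightarrow> s y *v E0 = y"
      by simp_all
    let ?U = "(UNIV :: oct_plane set) \<times> U"
    let ?\<kappa> = "\<lambda>y :: oct_plane \<times> oct_plane. bundle_move (transpose (s (snd y)))"
    have op: "open ?U" using U(1) by (simp add: open_Times)
    have xU: "x \<in> ?U" using U(2) by (simp add: mem_Times_iff)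
    have sm: "smooth_on ?U (\<lambda>y. ?\<kappa> y w)" for w
    proof -
      have "smooth_on ?U (\<lambda>y. s (snd y + 0))"
        by (rule smooth_on_compose_affine[OF U(1) op bounded_linear_snd _ U(3)]) auto
      then have t: "smooth_on ?U (\<lambda>y. transpose (s (snd y)))"
        using smooth_on_bounded_linear[OF op linear_transpose[unfolded linear_conv_bounded_linear]] by simp
      show ?thesis
        unfolding bundle_move_def
        by (rule smooth_on_Pair[OF op smooth_on_bilinear[OF op bounded_bilinear_matrix_vector t smooth_on_const]
              smooth_on_bilinear[OF op bounded_bilinear_matrix_vector t smooth_on_const]])
    qed
    have 1: "?\<kappa> y ` tangent_space sphere_bundle y \<subseteq> base_tangent" if "y \<in> ?U \<inter> sphere_bundle" for y
    proof -
      have "snd y \<in> U" "snd y \<in> sphere 0 1" using that by (auto simp: sphere_bundle_def)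
      then show ?thesis using bundle_move_base_tangent[OF s, of "snd y" _ "fst y"] by auto
    qed
    have 2: "spread_form f y vs = f (map (?\<kappa> y) vs)"
      if "y \<in> ?U \<inter> sphere_bundle" "set vs \<subseteq> tangent_space sphere_bundle y" for y vs
    proof -
      have "snd y \<in> U" "snd y \<in> sphere 0 1" using that by (auto simp: sphere_bundle_def)
      then show ?thesis using spread_form_eq[OF f s, of "snd y" vs "fst y"] that by simp
    qed
    show "\<exists>U \<kappa>. open U \<and> x \<in> U \<and> (\<forall>y\<in>U. linear (\<kappa> y)) \<and> (\<forall>w. smooth_on U (\<lambda>y. \<kappa> y w)) \<and>
        (\<forall>y\<in>U \<inter> sphere_bundle. \<kappa> y ` tangent_space sphere_bundle y \<subseteq> base_tangent) \<and>
        (\<forall>y\<in>U \<inter> sphere_bundle. \<forall>vs. set vs \<subseteq> tangent_space sphere_bundle y \<longrightarrow> spread_form f y vs = f (map (\<kappa> y) vs))"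
      by (rule exI[of _ ?U], rule exI[of _ ?\<kappa>])
        (intro conjI ballI allI impI op xU sm 1 2 bounded_linear.linear[OF bounded_linear_bundle_move])
  qed
  fix a assume a: "a \<in> G"
  then have ga: "fst a \<in> Spin9" by (auto simp: G_def)
  show "pullback sphere_bundle (G_act a) (spread_form f) = spread_form f"
  proof (intro ext)
    fix x vs
    show "pullback sphere_bundle (G_act a) (spread_form f) x vs = spread_form f x vs"
    proof (cases "x \<in> sphere_bundle \<and> set vs \<subseteq> tangent_space sphere_bundle x")
      case True
      obtain y v where x: "x = (y, v)" by fastforce
      have v: "v \<in> sphere 0 1" using True x by (auto simp: sphere_bundle_def)
      note h = point_mover[OF v]
      let ?g = "fst a ** point_mover v"
      have g: "?g \<in> Spin9" "?g *v E0 = fst a *v v"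
        using ga h by (simp_all add: Spin9_mult flip: matrix_vector_mul_assoc)
      have z: "bundle_move (fst a) x + (snd a, 0) = (fst a *v y + snd a, fst a *v v)"
        by (simp add: x bundle_move_def)
      have "set (map (bundle_move (fst a)) vs) \<subseteq> tangent_space sphere_bundle (bundle_move (fst a) x + (snd a, 0))"
        using tangent_space_affine[where M = sphere_bundle and x = x, OF bounded_linear_bundle_move G_act_closed[OF a]] True
        by auto
      then have "spread_form f (bundle_move (fst a) x + (snd a, 0)) (map (bundle_move (fst a)) vs) =
          f (map (bundle_move (transpose ?g)) (map (bundle_move (fst a)) vs))"
        unfolding z by (rule spread_form_eq[OF f g])
      moreover have "bundle_move (transpose ?g) (bundle_move (fst a) w) = bundle_move (transpose (point_mover v)) w" for w
        using ga by (simp add: bundle_move_mult matrix_transpose_mul Spin9_orthogonal flip: matrix_mul_assoc)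
      then have "map (bundle_move (transpose ?g)) (map (bundle_move (fst a)) vs) = map (bundle_move (transpose (point_mover v))) vs"
        by simp
      ultimately show ?thesis
        unfolding G_act_affine pullback_affine[OF bounded_linear_bundle_move]
        using True by (simp add: pull_alt_def spread_form_def[of f "(y, v)" vs] x del: map_map)
    next
      case False
      then show ?thesis
        unfolding G_act_affine pullback_affine[OF bounded_linear_bundle_move] spread_form_def[of f x vs] if_not_P[OF False]
        by (auto simp: pull_alt_def)
    qed
  qed
qed

lemma bij_betw_base_point: "bij_betw (\<lambda>\<omega>. \<omega> base_point) bundle_invariant_forms stabilizer_invariants"
proof (rule bij_betw_imageI)
  show "inj_on (\<lambda>\<omega>. \<omega> base_point) bundle_invariant_forms"
    by (rule inj_onI) (rule bundle_invariant_eqI, simp_all)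
  have "\<omega> base_point \<in> stabilizer_invariants" if \<omega>: "\<omega> \<in> bundle_invariant_forms" for \<omega>
    unfolding stabilizer_invariants_def
  proof (intro CollectI conjI ballI allI impI)
    show "\<omega> base_point \<in> alt_forms base_tangent"
      using forms_alt[OF _ base_point_sphere_bundle] \<omega> by (simp add: invariant_forms_def)
    fix s vs assume s: "s \<in> stabilizer" and vs: "set vs \<subseteq> base_tangent"
    have "\<omega> = pullback sphere_bundle (G_act s) \<omega>" using \<omega> s by (simp add: invariant_forms_def stabilizer_def)
    from fun_cong[OF fun_cong[OF this, of base_point], of vs]
    show "\<omega> base_point (map (frechet_derivative (G_act s) (at base_point)) vs) = \<omega> base_point vs"
      using s vs base_point_sphere_bundle by (simp add: pullback_def stabilizer_def)
  qed
  moreover have "f \<in> (\<lambda>\<omega>. \<omega> base_point) ` bundle_invariant_forms" if f: "f \<in> stabilizer_invariants" for f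
  proof (rule image_eqI[OF _ spread_form_invariant[OF f]])
    show "f = spread_form f base_point"
    proof
      fix vs
      show "f vs = spread_form f base_point vs"
      proof (cases "set vs \<subseteq> base_tangent")
        case True
        then show ?thesis
          using spread_form_eq[OF f Spin9_one, of E0 vs 0] by (simp add: base_point_def transpose_mat map_idI)
      next
        case False
        then show ?thesis
          using f alt_formsD_off[of f base_tangent vs] by (simp add: stabilizer_invariants_def spread_form_def)
      qed
    qed
  qed
  ultimately show "(\<lambda>\<omega>. \<omega> base_point) ` bundle_invariant_forms = stabilizer_invariants" by blast
qed

lemma ext_deriv_bundle_invariant:
  assumes \<omega>: "\<omega> \<in> bundle_invariant_forms"
  shows "ext_deriv sphere_bundle \<omega> \<in> bundle_invariant_forms"
proof -
  note S = affine_homogeneous_sphere_bundle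
  have f: "\<omega> \<in> forms sphere_bundle" using \<omega> by (simp add: invariant_forms_def)
  have "pullback sphere_bundle (G_act a) (ext_deriv sphere_bundle \<omega>) = ext_deriv sphere_bundle \<omega>" if a: "a \<in> G" for a
  proof -
    have "pullback sphere_bundle (G_act a) (ext_deriv sphere_bundle \<omega>) =
        ext_deriv sphere_bundle (pullback sphere_bundle (G_act a) \<omega>)"
      unfolding G_act_affine
      by (rule ext_deriv_pullback[OF S S bounded_linear_bundle_move G_act_closed[OF a] f, symmetric])
    then show ?thesis using \<omega> a by (simp add: invariant_forms_def)
  qed
  then show ?thesis using ext_deriv_forms[OF S f] unfolding invariant_forms_def by blast
qed


section \<open>The projection to the sphere bundle\<close>

definition proj_map :: "oct_matrix \<times> oct_plane \<Rightarrow> oct_plane \<times> oct_plane" where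
  "proj_map v = (snd v, fst v *v E0)"

lemma bounded_linear_proj_map: "bounded_linear proj_map"
  unfolding proj_map_def[abs_def]
  by (intro bounded_linear_Pair bounded_linear_snd bounded_linear_compose[OF mv.bounded_linear_left bounded_linear_fst])

lemma G_proj_affine: "G_proj = (\<lambda>y. proj_map y + 0)"
  by (auto simp: G_proj_def proj_map_def fun_eq_iff)

lemma G_proj_closed: "y \<in> G \<Longrightarrow> proj_map y + 0 \<in> sphere_bundle"
  using Spin9_sphere[OF _ E0_sphere] by (auto simp: G_def sphere_bundle_def proj_map_def)

lemma proj_map_hor [simp]: "proj_map (hor_proj v) = proj_map v"
  by (simp add: proj_map_def hor_proj_def)

lemma proj_map_lieG: "v \<in> lieG \<Longrightarrow> proj_map v \<in> base_tangent"
  unfolding base_tangent_eq proj_map_def using E0_orthogonal by (auto simp: lieG_def)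

lemma proj_map_surj:
  assumes "t \<in> base_tangent"
  shows "\<exists>v\<in>lieG. proj_map v = t"
proof -
  obtain u w where t: "t = (u, w)" "w \<bullet> E0 = 0" using assms unfolding base_tangent_eq by blast
  have "w $ (0, 0) = 0" using t(2) by (simp add: E0_eq inner_axis flip: axis_pair(1))
  then have "hor_of w \<in> spin9_algebra" by (rule hor_of_algebra)
  then show ?thesis by (intro bexI[of _ "(hor_of w, u)"]) (simp_all add: lieG_def proj_map_def t)
qed

lemma pullback_G_proj:
  assumes \<omega>: "\<omega> \<in> bundle_invariant_forms"
  shows "pullback G G_proj \<omega> = left_form (pull_alt lieG proj_map (\<omega> base_point))"
proof (intro ext)
  fix x vs
  show "pullback G G_proj \<omega> x vs = left_form (pull_alt lieG proj_map (\<omega> base_point)) x vs"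
  proof (cases "x \<in> G \<and> set vs \<subseteq> tangent_space G x")
    case True
    obtain g y where x: "x = (g, y)" by fastforce
    have g: "g \<in> Spin9" using True x by (simp add: G_def)
    have "set (map proj_map vs) \<subseteq> tangent_space sphere_bundle (proj_map x + 0)"
      using tangent_space_affine[where M = G and x = x, OF bounded_linear_proj_map G_proj_closed] True by auto
    then have "set (map proj_map vs) \<subseteq> tangent_space sphere_bundle (y, g *v E0)" by (simp add: x proj_map_def)
    from bundle_invariant_translate[OF \<omega> g refl this]
    have "\<omega> (y, g *v E0) (map proj_map vs) = \<omega> base_point (map (bundle_move (transpose g)) (map proj_map vs))" .
    also have "map (bundle_move (transpose g)) (map proj_map vs) = map proj_map (map (transl (transpose g)) vs)"
      by (simp add: bundle_move_def proj_map_def transl_def o_def matrix_vector_mul_assoc del: transpose_matrix_vector)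
    finally have "\<omega> (y, g *v E0) (map proj_map vs) = \<omega> base_point (map proj_map (map (transl (transpose g)) vs))" .
    moreover have "set (map (transl (transpose g)) vs) \<subseteq> lieG"
      using True tangent_space_G_iff[OF g] x by auto
    moreover have "proj_map x + 0 = (y, g *v E0)" by (simp add: x proj_map_def)
    ultimately show ?thesis
      unfolding G_proj_affine pullback_affine[OF bounded_linear_proj_map]
      using True by (simp add: left_form_def pull_alt_def x del: map_map)
  next
    case False
    then show ?thesis
      unfolding G_proj_affine pullback_affine[OF bounded_linear_proj_map] by (auto simp: left_form_def pull_alt_def)
  qed
qed

text \<open>
  The differential of the projection reads only \<open>\<theta>\<close> and the first column of \<open>\<phi>\<close>, which are
  unchanged by \<open>hor_proj\<close>.
\<close>

lemma pullback_G_proj_horizontal: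
  assumes \<omega>: "\<omega> \<in> bundle_invariant_forms"
  shows "pullback G G_proj \<omega> \<in> horizontal_algebra"
proof -
  have b: "\<omega> base_point \<in> alt_forms base_tangent"
    using forms_alt[OF _ base_point_sphere_bundle] \<omega> by (simp add: invariant_forms_def)
  have a: "pull_alt lieG proj_map (\<omega> base_point) \<in> alt_forms lieG"
    using proj_map_lieG
    by (intro pull_alt_alt[OF bounded_linear.linear[OF bounded_linear_proj_map] b] subspace_lieG) auto
  have "pull_alt lieG hor_proj (pull_alt lieG proj_map (\<omega> base_point)) = pull_alt lieG proj_map (\<omega> base_point)"
    using hor_proj_lieG by (auto simp: fun_eq_iff pull_alt_def o_def)
  then show ?thesis
    unfolding horizontal_algebra_iff(1) pullback_G_proj[OF \<omega>]
    using horizontalize_left_form[OF a] left_form_invariant[OF a] by simp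
qed

lemma inj_on_pullback_G_proj: "inj_on (pullback G G_proj) bundle_invariant_forms"
proof (rule inj_onI)
  fix \<omega> \<eta> assume \<omega>: "\<omega> \<in> bundle_invariant_forms" and \<eta>: "\<eta> \<in> bundle_invariant_forms"
    and eq: "pullback G G_proj \<omega> = pullback G G_proj \<eta>"
  have one: "left_form (pull_alt lieG proj_map f) (mat 1, 0) = pull_alt lieG proj_map f" for f
    by (rule left_form_one) (simp add: pull_alt_def)
  have e: "pull_alt lieG proj_map (\<omega> base_point) = pull_alt lieG proj_map (\<eta> base_point)"
    using eq unfolding pullback_G_proj[OF \<omega>] pullback_G_proj[OF \<eta>] by (metis one)
  show "\<omega> = \<eta>"
  proof (rule bundle_invariant_eqI[OF \<omega> \<eta>])
    fix vs assume vs: "set vs \<subseteq> base_tangent"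
    have "\<exists>ws. set ws \<subseteq> lieG \<and> map proj_map ws = vs"
      using vs
    proof (induction vs)
      case (Cons t vs)
      then obtain ws where "set ws \<subseteq> lieG" "map proj_map ws = vs" by auto
      moreover obtain v where "v \<in> lieG" "proj_map v = t" using Cons.prems proj_map_surj[of t] by auto
      ultimately show ?case by (intro exI[of _ "v # ws"]) simp
    qed simp
    then obtain ws where "set ws \<subseteq> lieG" "map proj_map ws = vs" by blast
    then show "\<omega> base_point vs = \<eta> base_point vs"
      using fun_cong[OF e, of ws] by (simp add: pull_alt_def)
  qed
qed

theorem theorem1p2:
  shows
    "bij_betw (\<lambda>\<omega>. \<omega> base_point) bundle_invariant_forms stabilizer_invariants \<and>
     (\<exists>!h. is_horizontal_projection h) \<and>
     antiderivation horizontal_algebra d\<^sub>h \<and>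
     differentiation_rules d\<^sub>h \<and>
     (\<forall>D. antiderivation horizontal_algebra D \<and> differentiation_rules D \<longrightarrow>
        (\<forall>\<omega>\<in>horizontal_algebra. D \<omega> = d\<^sub>h \<omega>)) \<and>
     inj_on (pullback G G_proj) bundle_invariant_forms \<and>
     (\<forall>\<omega>\<in>bundle_invariant_forms.
        ext_deriv sphere_bundle \<omega> \<in> bundle_invariant_forms \<and>
        pullback G G_proj \<omega> \<in> horizontal_algebra \<and>
        ext_deriv G (pullback G G_proj \<omega>) = d\<^sub>h (pullback G G_proj \<omega>) \<and>
        pullback G G_proj (ext_deriv sphere_bundle \<omega>) = d\<^sub>h (pullback G G_proj \<omega>))"
proof (intro conjI ballI allI impI)
  show "bij_betw (\<lambda>\<omega>. \<omega> base_point) bundle_invariant_forms stabilizer_invariants"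
    by (rule bij_betw_base_point)
  show "\<exists>!h. is_horizontal_projection h"
    using is_horizontal_projection_horizontalize is_horizontal_projection_unique by blast
  show "antiderivation horizontal_algebra d\<^sub>h" by (rule antiderivation_d\<^sub>h)
  show "differentiation_rules d\<^sub>h" by (rule differentiation_rules_d\<^sub>h)
  show "D \<omega> = d\<^sub>h \<omega>" if D: "antiderivation horizontal_algebra D \<and> differentiation_rules D"
    and \<omega>: "\<omega> \<in> horizontal_algebra" for D \<omega>
    by (rule antiderivation_unique[OF conjunct1[OF D] antiderivation_d\<^sub>h
          rules_determine_generators[OF conjunct2[OF D] differentiation_rules_d\<^sub>h] \<omega>])
  show "inj_on (pullback G G_proj) bundle_invariant_forms" by (rule inj_on_pullback_G_proj)
  fix \<omega> assume \<omega>: "\<omega> \<in> bundle_invariant_forms"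
  show d\<omega>: "ext_deriv sphere_bundle \<omega> \<in> bundle_invariant_forms" by (rule ext_deriv_bundle_invariant[OF \<omega>])
  show "pullback G G_proj \<omega> \<in> horizontal_algebra" by (rule pullback_G_proj_horizontal[OF \<omega>])
  have f: "\<omega> \<in> forms sphere_bundle" using \<omega> by (simp add: invariant_forms_def)
  have comm: "ext_deriv G (pullback G G_proj \<omega>) = pullback G G_proj (ext_deriv sphere_bundle \<omega>)"
    unfolding G_proj_affine
    by (rule ext_deriv_pullback[OF affine_homogeneous_G affine_homogeneous_sphere_bundle bounded_linear_proj_map
          G_proj_closed f])
  \<comment> \<open>The projection \<open>h\<close> fixes the pullback of \<open>d\<omega>\<close>, which is horizontal because \<open>d\<omega>\<close> is invariant.\<close>
  have "horizontalize (pullback G G_proj (ext_deriv sphere_bundle \<omega>)) = pullback G G_proj (ext_deriv sphere_bundle \<omega>)"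
    using pullback_G_proj_horizontal[OF d\<omega>] by (simp only: horizontal_algebra_iff(1))
  then show "ext_deriv G (pullback G G_proj \<omega>) = d\<^sub>h (pullback G G_proj \<omega>)"
    and "pullback G G_proj (ext_deriv sphere_bundle \<omega>) = d\<^sub>h (pullback G G_proj \<omega>)"
    unfolding d\<^sub>h_eq comm by simp_all
qed

end
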